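(* Let $F$ be a Ferrers shape, $n\ge0$ an integer and $s,t$ positive integers. Then $$N^*(F;n;\mathit{NE}=s,se=t)=N^*(F;n;ne=t,\mathit{SE}=s)$$ and $$N^{01}(F;n;nE=s,\mathit{Se}=t)=N^{01}(F;n;\mathit{Ne}=t,sE=s).$$
   Context: A Ferrers shape (French notation) has columns $1,\dots,m$ from left to right and rows numbered from the bottom, column $j$ consisting of the cells in rows $1,\dots,h_j$, $h_1\ge\dots\ge h_m\ge1$. Chains are sequences of distinct cells with nonzero entries in which each cell is positioned relative to the preceding one as follows: NE-chain: weakly above and weakly right; length = sum of entries. SE-chain: weakly below and weakly right; length = sum of entries. ne-chain: strictly above and strictly right; length = number of cells. se-chain: strictly below and strictly right; length = number of cells. nE-chain: strictly above and weakly right; Ne-chain: weakly above and strictly right; Se-chain: weakly below and strictly right; sE-chain: strictly below and weakly right (these four are used for $0$-$1$-fillings, length = number of cells). For chains going downward to the right (SE, se, Se, sE) only chains whose smallest enclosing rectangle (cells with column between those of the first and last cell and row between those of the first and last cell) is contained in $F$ are considered; for chains going upward to the right this holds automatically. $N^*(F;n;\mathit{NE}=s,se=t)$ is the number of fillings of $F$ with non-negative integers with sum of entries $n$ such that the longest NE-chain has length $s$ and the longest se-chain has length $t$; $N^*(F;n;ne=t,\mathit{SE}=s)$ is defined analogously. $N^{01}(F;n;nE=s,\mathit{Se}=t)$ is the number of $0$-$1$-fillings of $F$ (no restriction on the number of $1$'s per row or column) with exactly $n$ ones such that the longest nE-chain has length $s$ and the longest Se-chain has length $t$; $N^{01}(F;n;\mathit{Ne}=t,sE=s)$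 is defined analogously. *)

theory Defs
  imports "HOL-Library.FuncSet"
begin

text \<open>A cell is a pair (column, row); both are numbered from 1, rows from the bottom.\<close>

type_synonym cell = "nat \<times> nat"

definition ferrers_shape :: "cell set \<Rightarrow> bool" where
  "ferrers_shape F \<longleftrightarrow>
     (\<exists>m h. (\<forall>i\<in>{1..m}. \<forall>j\<in>{1..m}. i \<le> j \<longrightarrow> h j \<le> h i) \<and> (\<forall>j\<in>{1..m}. 1 \<le> h j) \<and>
            F = {(j, i). j \<in> {1..m} \<and> i \<in> {1..h j}})"

text \<open>Fillings are extensional functions, so that distinct fillings differ on the shape.\<close>

definition fillings :: "cell set \<Rightarrow> nat \<Rightarrow> (cell \<Rightarrow> nat) set" where
  "fillings F n = {f \<in> F \<rightarrow>\<^sub>E UNIV. (\<Sum>c\<in>F. f c) = n}"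

definition fillings01 :: "cell set \<Rightarrow> nat \<Rightarrow> (cell \<Rightarrow> nat) set" where
  "fillings01 F n = {f \<in> F \<rightarrow>\<^sub>E {0, 1}. card {c \<in> F. f c = 1} = n}"

text \<open>In each relation the first argument is the preceding cell of the chain. A capital letter
  stands for a weak inequality, a small letter for a strict one.\<close>

definition rel_NE :: "cell \<Rightarrow> cell \<Rightarrow> bool" where
  "rel_NE a b \<longleftrightarrow> snd a \<le> snd b \<and> fst a \<le> fst b"

definition rel_ne :: "cell \<Rightarrow> cell \<Rightarrow> bool" where
  "rel_ne a b \<longleftrightarrow> snd a < snd b \<and> fst a < fst b"

definition rel_nE :: "cell \<Rightarrow> cell \<Rightarrow> bool" where
  "rel_nE a b \<longleftrightarrow> snd a < snd b \<and> fst a \<le> fst b"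

definition rel_Ne :: "cell \<Rightarrow> cell \<Rightarrow> bool" where
  "rel_Ne a b \<longleftrightarrow> snd a \<le> snd b \<and> fst a < fst b"

definition rel_SE :: "cell \<Rightarrow> cell \<Rightarrow> bool" where
  "rel_SE a b \<longleftrightarrow> snd b \<le> snd a \<and> fst a \<le> fst b"

definition rel_se :: "cell \<Rightarrow> cell \<Rightarrow> bool" where
  "rel_se a b \<longleftrightarrow> snd b < snd a \<and> fst a < fst b"

definition rel_Se :: "cell \<Rightarrow> cell \<Rightarrow> bool" where
  "rel_Se a b \<longleftrightarrow> snd b \<le> snd a \<and> fst a < fst b"

definition rel_sE :: "cell \<Rightarrow> cell \<Rightarrow> bool" where
  "rel_sE a b \<longleftrightarrow> snd b < snd a \<and> fst a \<le> fst b"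

definition chains :: "(cell \<Rightarrow> cell \<Rightarrow> bool) \<Rightarrow> cell set \<Rightarrow> (cell \<Rightarrow> nat) \<Rightarrow> cell list set" where
  "chains R F f =
     {cs. set cs \<subseteq> F \<and> distinct cs \<and> (\<forall>c\<in>set cs. f c \<noteq> 0) \<and> successively R cs}"

definition enclosing_rectangle :: "cell \<Rightarrow> cell \<Rightarrow> cell set" where
  "enclosing_rectangle a b =
     {min (fst a) (fst b)..max (fst a) (fst b)} \<times> {min (snd a) (snd b)..max (snd a) (snd b)}"

text \<open>For chains going downward to the right the enclosing rectangle has to lie in the shape;
  for chains going upward to the right this is automatic.\<close>

definition down_chains :: "(cell \<Rightarrow> cell \<Rightarrow> bool) \<Rightarrow> cell set \<Rightarrow> (cell \<Rightarrow> nat) \<Rightarrow> cell list set" where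
  "down_chains R F f =
     {cs \<in> chains R F f. cs \<noteq> [] \<longrightarrow> enclosing_rectangle (hd cs) (last cs) \<subseteq> F}"

text \<open>The empty chain has length 0, so each maximum below is taken over a nonempty set, which is
  finite because chains consist of distinct cells.\<close>

definition longest_NE :: "cell set \<Rightarrow> (cell \<Rightarrow> nat) \<Rightarrow> nat" where
  "longest_NE F f = Max ((\<lambda>cs. \<Sum>c\<leftarrow>cs. f c) ` chains rel_NE F f)"

definition longest_SE :: "cell set \<Rightarrow> (cell \<Rightarrow> nat) \<Rightarrow> nat" where
  "longest_SE F f = Max ((\<lambda>cs. \<Sum>c\<leftarrow>cs. f c) ` down_chains rel_SE F f)"

definition longest_ne :: "cell set \<Rightarrow> (cell \<Rightarrow> nat) \<Rightarrow> nat" where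
  "longest_ne F f = Max (length ` chains rel_ne F f)"

definition longest_se :: "cell set \<Rightarrow> (cell \<Rightarrow> nat) \<Rightarrow> nat" where
  "longest_se F f = Max (length ` down_chains rel_se F f)"

definition longest_nE :: "cell set \<Rightarrow> (cell \<Rightarrow> nat) \<Rightarrow> nat" where
  "longest_nE F f = Max (length ` chains rel_nE F f)"

definition longest_Ne :: "cell set \<Rightarrow> (cell \<Rightarrow> nat) \<Rightarrow> nat" where
  "longest_Ne F f = Max (length ` chains rel_Ne F f)"

definition longest_Se :: "cell set \<Rightarrow> (cell \<Rightarrow> nat) \<Rightarrow> nat" where
  "longest_Se F f = Max (length ` down_chains rel_Se F f)"

definition longest_sE :: "cell set \<Rightarrow> (cell \<Rightarrow> nat) \<Rightarrow> nat" where
  "longest_sE F f = Max (length ` down_chains rel_sE F f)"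

definition Nstar_NE_se :: "cell set \<Rightarrow> nat \<Rightarrow> nat \<Rightarrow> nat \<Rightarrow> nat" where
  "Nstar_NE_se F n s t = card {f \<in> fillings F n. longest_NE F f = s \<and> longest_se F f = t}"

definition Nstar_ne_SE :: "cell set \<Rightarrow> nat \<Rightarrow> nat \<Rightarrow> nat \<Rightarrow> nat" where
  "Nstar_ne_SE F n t s = card {f \<in> fillings F n. longest_ne F f = t \<and> longest_SE F f = s}"

definition N01_nE_Se :: "cell set \<Rightarrow> nat \<Rightarrow> nat \<Rightarrow> nat \<Rightarrow> nat" where
  "N01_nE_Se F n s t = card {f \<in> fillings01 F n. longest_nE F f = s \<and> longest_Se F f = t}"

definition N01_Ne_sE :: "cell set \<Rightarrow> nat \<Rightarrow> nat \<Rightarrow> nat \<Rightarrow> nat" where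
  "N01_Ne_sE F n t s = card {f \<in> fillings01 F n. longest_Ne F f = t \<and> longest_sE F f = s}"

end

theory Submission
  imports Defs
begin

text \<open>
  Label the corners of the cells of \<open>F\<close> by partitions, the empty partition on the left and bottom
  axes, with a local rule that computes the label of the upper right corner of a cell from the
  other three corners and the entry. Each rule is a bijection, so a filling is determined by the
  labels along the upper right border of \<open>F\<close>, and every sequence of border labels whose steps are
  horizontal or vertical strips of the right kind occurs. The rules of RSK, of Burge's variant and
  of dual RSK differ only in the kind of strips, and conjugating the labels matches RSK with Burge
  and dual RSK with the transposed dual RSK. Hence there are bijections between the fillings that
  conjugate the border labels.

  It remains to read off the chain lengths in the rectangle below a corner: the first part of its
  label is the longest chain of one kind, by the same recursion, and the number of parts is the
  longest chain of the other kind. The latter is shown by removing the first parts of all labels,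
  which replaces the filling by the filling of carries and shortens the longest chain by one. For
  RSK and dual RSK this is Viennot's shadow line argument: nonzero entries and nonzero carries
  interlace along chains. For Burge's rule, every chain is enlarged by cells on the shadow lines
  until the sums of the entries and of the carries along it differ by exactly one.
\<close>

section \<open>Chains\<close>

text \<open>Only the first part and the number of parts of a label are interpreted, by two
  recursions, in place of Greene's theorem for all parts. So each longest chain is a maximum of
  statistics of rectangles, and the rectangles below border corners contain all others.

  Two local rules can be compared only if their labels run through the same kinds of strips. RSK has
  horizontal strips in both directions and Burge's rule vertical ones, and conjugation exchanges
  these. Dual RSK has horizontal strips in one direction and vertical ones in the other; conjugation
  exchanges the kinds, and reflecting the diagram in the diagonal puts them back. The sum of entries
  is kept because each rule conserves sizes.

  The obstacle is the number of parts under Burge's rule: SE-chains are weak and weighted, so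
  interlacing cells say nothing about their lengths. There the loss of exactly one is an identity of
  sums along saturated chains.\<close>

definition ne_chain_order :: "(cell \<Rightarrow> cell \<Rightarrow> bool) \<Rightarrow> bool" where
  "ne_chain_order R \<longleftrightarrow> transp R \<and> antisymp R \<and> (\<forall>a b. R a b \<longrightarrow> fst a \<le> fst b \<and> snd a \<le> snd b)"

definition se_chain_order :: "(cell \<Rightarrow> cell \<Rightarrow> bool) \<Rightarrow> bool" where
  "se_chain_order R \<longleftrightarrow> transp R \<and> antisymp R \<and> (\<forall>a b. R a b \<longrightarrow> fst a \<le> fst b \<and> snd b \<le> snd a)"

text \<open>Weak relations such as \<open>rel_NE\<close> are reflexive; deleting the diagonal builds
  the distinctness of chains into the relation and leaves irreflexive relations unchanged.\<close>

definition strict :: "(cell \<Rightarrow> cell \<Rightarrow> bool) \<Rightarrow> cell \<Rightarrow> cell \<Rightarrow> bool" where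
  "strict R a b \<longleftrightarrow> R a b \<and> a \<noteq> b"

text \<open>An upper bound in place of a maximum: two longest chains are compared through all
  \<open>k\<close>. Cells of weight zero may occur, since they do not change the sum; with
  \<open>ind f\<close> as weight the sum counts the nonzero cells.\<close>

definition chain_bound :: "(cell \<Rightarrow> cell \<Rightarrow> bool) \<Rightarrow> (cell \<Rightarrow> nat) \<Rightarrow> cell set \<Rightarrow> nat \<Rightarrow> bool" where
  "chain_bound R w S k \<longleftrightarrow>
     (\<forall>cs. sorted_wrt (strict R) cs \<longrightarrow> set cs \<subseteq> S \<longrightarrow> (\<Sum>c\<leftarrow>cs. w c) \<le> k)"

definition ind :: "(cell \<Rightarrow> nat) \<Rightarrow> cell \<Rightarrow> nat" where
  "ind f c = (if f c = 0 then 0 else 1)"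

definition rect :: "nat \<Rightarrow> nat \<Rightarrow> cell set" where
  "rect p q = {1..p} \<times> {1..q}"

definition down_shape :: "cell set \<Rightarrow> bool" where
  "down_shape F \<longleftrightarrow> finite F \<and> (\<forall>p q. (p, q) \<in> F \<longrightarrow> 0 < p \<and> 0 < q \<and> rect p q \<subseteq> F)"

lemma in_rect [simp]: "(x, y) \<in> rect p q \<longleftrightarrow> 1 \<le> x \<and> x \<le> p \<and> 1 \<le> y \<and> y \<le> q"
  by (auto simp: rect_def)

lemma rect_mono: "p \<le> p' \<Longrightarrow> q \<le> q' \<Longrightarrow> rect p q \<subseteq> rect p' q'"
  by auto

lemma down_shape_closed:
  assumes "down_shape F" "(p, q) \<in> F" "0 < p'" "p' \<le> p" "0 < q'" "q' \<le> q"
  shows "(p', q') \<in> F"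
proof -
  have "rect p q \<subseteq> F" using assms(1,2) by (simp add: down_shape_def)
  then show ?thesis using assms(3-6) by auto
qed

lemma ferrers_down_shape:
  assumes "ferrers_shape F"
  shows "down_shape F"
proof -
  obtain m h where h: "\<And>i j. i \<in> {1..m} \<Longrightarrow> j \<in> {1..m} \<Longrightarrow> i \<le> j \<Longrightarrow> h j \<le> h i"
    and F: "F = {(j, i). j \<in> {1..m} \<and> i \<in> {1..h j}}"
    using assms unfolding ferrers_shape_def by blast
  have "F = Sigma {1..m} (\<lambda>j. {1..h j})" using F by auto
  then have "finite F" by simp
  moreover have "(x, y) \<in> F" if "(p, q) \<in> F" "(x, y) \<in> rect p q" for p q x y
  proof -
    have "h p \<le> h x" by (rule h) (use that F in auto)
    with that F show ?thesis by auto
  qed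
  ultimately show ?thesis using F by (auto simp: down_shape_def)
qed

lemma transp_strict: "transp R \<Longrightarrow> antisymp R \<Longrightarrow> transp (strict R)"
  unfolding transp_def antisymp_def strict_def by metis

lemma sorted_wrt_strict_distinct: "sorted_wrt (strict R) cs \<Longrightarrow> distinct cs"
  by (induction cs) (auto simp: strict_def)

lemma chain_iff_sorted:
  assumes "transp R" "antisymp R"
  shows "distinct cs \<and> successively R cs \<longleftrightarrow> sorted_wrt (strict R) cs"
proof
  assume "distinct cs \<and> successively R cs"
  then have "distinct cs" "sorted_wrt R cs"
    using successively_conv_sorted_wrt[OF assms(1)] by auto
  then show "sorted_wrt (strict R) cs"
    by (induction cs) (auto simp: strict_def)
next
  assume s: "sorted_wrt (strict R) cs"
  then have "sorted_wrt R cs" by (rule sorted_wrt_mono_rel[rotated]) (auto simp: strict_def)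
  with s show "distinct cs \<and> successively R cs"
    using successively_if_sorted_wrt sorted_wrt_strict_distinct by blast
qed

lemma chain_boundI_support:
  assumes "\<And>cs. sorted_wrt (strict R) cs \<Longrightarrow> set cs \<subseteq> {c \<in> S. w c \<noteq> 0} \<Longrightarrow> (\<Sum>c\<leftarrow>cs. w c) \<le> k"
  shows "chain_bound R w S k"
  unfolding chain_bound_def
proof (intro allI impI)
  fix cs assume cs: "sorted_wrt (strict R) cs" "set cs \<subseteq> S"
  let ?ds = "filter (\<lambda>c. w c \<noteq> 0) cs"
  have "(\<Sum>c\<leftarrow>cs. w c) = (\<Sum>c\<leftarrow>?ds. w c)"
    by (induction cs) auto
  also have "\<dots> \<le> k"
    by (rule assms) (use cs in \<open>auto intro: sorted_wrt_filter\<close>)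
  finally show "(\<Sum>c\<leftarrow>cs. w c) \<le> k" .
qed

lemma chain_boundD:
  "chain_bound R w S k \<Longrightarrow> sorted_wrt (strict R) cs \<Longrightarrow> set cs \<subseteq> S \<Longrightarrow> (\<Sum>c\<leftarrow>cs. w c) \<le> k"
  by (auto simp: chain_bound_def)

lemma chain_bound_mono: "chain_bound R w S k \<Longrightarrow> T \<subseteq> S \<Longrightarrow> chain_bound R w T k"
  unfolding chain_bound_def by blast

lemma chain_bound_cong:
  assumes "\<And>c. c \<in> S \<Longrightarrow> w c = w' c"
  shows "chain_bound R w S k \<longleftrightarrow> chain_bound R w' S k"
proof -
  have "(\<Sum>c\<leftarrow>cs. w c) = (\<Sum>c\<leftarrow>cs. w' c)" if "set cs \<subseteq> S" for cs
    using that assms by (intro arg_cong[where f=sum_list] map_cong) auto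
  then show ?thesis unfolding chain_bound_def by auto
qed

lemma chain_bound_ind_iff:
  "chain_bound R (ind f) S k \<longleftrightarrow>
     (\<forall>cs. sorted_wrt (strict R) cs \<longrightarrow> set cs \<subseteq> {c \<in> S. f c \<noteq> 0} \<longrightarrow> length cs \<le> k)"
proof -
  have len: "(\<Sum>c\<leftarrow>cs. ind f c) = length cs" if "set cs \<subseteq> {c \<in> S. f c \<noteq> 0}" for cs
    using that by (induction cs) (auto simp: ind_def)
  have sub: "{c \<in> S. ind f c \<noteq> 0} = {c \<in> S. f c \<noteq> 0}" by (auto simp: ind_def)
  show ?thesis
  proof
    assume "chain_bound R (ind f) S k"
    then show "\<forall>cs. sorted_wrt (strict R) cs \<longrightarrow> set cs \<subseteq> {c \<in> S. f c \<noteq> 0} \<longrightarrow> length cs \<le> k"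
      using len by (fastforce simp: chain_bound_def)
  next
    assume "\<forall>cs. sorted_wrt (strict R) cs \<longrightarrow> set cs \<subseteq> {c \<in> S. f c \<noteq> 0} \<longrightarrow> length cs \<le> k"
    then show "chain_bound R (ind f) S k"
      by (intro chain_boundI_support) (simp only: sub len)
  qed
qed

lemma finite_chains: "finite F \<Longrightarrow> finite (chains R F f)"
  by (rule finite_subset[OF _ finite_subset_distinct[of F]]) (auto simp: chains_def)

lemma ne_chain_in_rect:
  assumes "ne_chain_order R" "sorted_wrt (strict R) (cs @ [(p, q)])" "set (cs @ [(p, q)]) \<subseteq> F"
    and "down_shape F"
  shows "set (cs @ [(p, q)]) \<subseteq> rect p q"
proof (intro subsetI)
  fix c assume c: "c \<in> set (cs @ [(p, q)])"
  then have "c = (p, q) \<or> R c (p, q)"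
    using assms(2) by (auto simp: sorted_wrt_append strict_def)
  then have "fst c \<le> p \<and> snd c \<le> q"
    using assms(1) unfolding ne_chain_order_def by fastforce
  moreover have "(fst c, snd c) \<in> F" using assms(3) c by auto
  then have "0 < fst c \<and> 0 < snd c" using assms(4) by (simp add: down_shape_def del: prod.collapse)
  ultimately show "c \<in> rect p q" by (cases c) auto
qed

text \<open>The last cell of an upward chain is weakly above and to the right of all others, so the
  chain lies in the rectangle below it.\<close>

lemma longest_ne_le_iff:
  assumes F: "down_shape F" and R: "ne_chain_order R"
    and w: "\<And>cs. cs \<in> chains R F f \<Longrightarrow> len cs = (\<Sum>c\<leftarrow>cs. w c)" "\<And>c. w c = 0 \<longleftrightarrow> f c = 0"
  shows "Max (len ` chains R F f) \<le> k \<longleftrightarrow> (\<forall>(p, q)\<in>F. chain_bound R w (rect p q) k)"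
proof -
  have tr: "transp R" "antisymp R" using R by (auto simp: ne_chain_order_def)
  have fin: "finite F" using F by (simp add: down_shape_def)
  have "[] \<in> chains R F f" by (simp add: chains_def)
  then have "Max (len ` chains R F f) \<le> k \<longleftrightarrow> (\<forall>cs\<in>chains R F f. len cs \<le> k)"
    using finite_chains[OF fin] by (subst Max_le_iff) auto
  also have "\<dots> \<longleftrightarrow> (\<forall>(p, q)\<in>F. chain_bound R w (rect p q) k)"
  proof
    assume l: "\<forall>cs\<in>chains R F f. len cs \<le> k"
    show "\<forall>(p, q)\<in>F. chain_bound R w (rect p q) k"
    proof clarify
      fix p q assume pq: "(p, q) \<in> F"
      show "chain_bound R w (rect p q) k"
      proof (rule chain_boundI_support)
        fix cs assume cs: "sorted_wrt (strict R) cs" "set cs \<subseteq> {c \<in> rect p q. w c \<noteq> 0}"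
        have "rect p q \<subseteq> F" using F pq by (simp add: down_shape_def)
        with cs chain_iff_sorted[OF tr, of cs] have "cs \<in> chains R F f"
          by (auto simp: chains_def w(2))
        with l w(1) show "(\<Sum>c\<leftarrow>cs. w c) \<le> k" by force
      qed
    qed
  next
    assume b: "\<forall>(p, q)\<in>F. chain_bound R w (rect p q) k"
    show "\<forall>cs\<in>chains R F f. len cs \<le> k"
    proof
      fix cs assume cs: "cs \<in> chains R F f"
      then have s: "sorted_wrt (strict R) cs" "set cs \<subseteq> F"
        using chain_iff_sorted[OF tr, of cs] by (auto simp: chains_def)
      show "len cs \<le> k"
      proof (cases cs rule: rev_cases)
        case Nil then show ?thesis using w(1)[OF cs] by simp
      next
        case (snoc ds c)
        obtain p q where c: "c = (p, q)" by (cases c)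
        have "chain_bound R w (rect p q) k" using b s(2) snoc c by auto
        from chain_boundD[OF this s(1)] show ?thesis
          using ne_chain_in_rect[OF R, of ds p q F] s snoc c F w(1)[OF cs] by auto
      qed
    qed
  qed
  finally show ?thesis .
qed

text \<open>The cell in the column of the last and the row of the first chain cell belongs to the
  enclosing rectangle, hence to \<open>F\<close>, and the whole chain lies in the rectangle below
  it. Conversely, the enclosing rectangle of a chain inside \<open>rect p q\<close> stays
  inside.\<close>

lemma longest_se_le_iff:
  assumes F: "down_shape F" and R: "se_chain_order R"
    and w: "\<And>cs. cs \<in> chains R F f \<Longrightarrow> len cs = (\<Sum>c\<leftarrow>cs. w c)" "\<And>c. w c = 0 \<longleftrightarrow> f c = 0"
  shows "Max (len ` down_chains R F f) \<le> k \<longleftrightarrow> (\<forall>(p, q)\<in>F. chain_bound R w (rect p q) k)"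
proof -
  have tr: "transp R" "antisymp R" using R by (auto simp: se_chain_order_def)
  have fin: "finite F" using F by (simp add: down_shape_def)
  have "down_chains R F f \<subseteq> chains R F f" by (auto simp: down_chains_def)
  then have fin2: "finite (down_chains R F f)" using finite_chains[OF fin] finite_subset by blast
  have "[] \<in> down_chains R F f" by (simp add: chains_def down_chains_def)
  then have "Max (len ` down_chains R F f) \<le> k \<longleftrightarrow> (\<forall>cs\<in>down_chains R F f. len cs \<le> k)"
    using fin2 by (subst Max_le_iff) auto
  also have "\<dots> \<longleftrightarrow> (\<forall>(p, q)\<in>F. chain_bound R w (rect p q) k)"
  proof
    assume l: "\<forall>cs\<in>down_chains R F f. len cs \<le> k"
    show "\<forall>(p, q)\<in>F. chain_bound R w (rect p q) k"
    proof clarify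
      fix p q assume pq: "(p, q) \<in> F"
      show "chain_bound R w (rect p q) k"
      proof (rule chain_boundI_support)
        fix cs assume cs: "sorted_wrt (strict R) cs" "set cs \<subseteq> {c \<in> rect p q. w c \<noteq> 0}"
        have sub: "rect p q \<subseteq> F" using F pq by (simp add: down_shape_def)
        with cs chain_iff_sorted[OF tr, of cs] have ch: "cs \<in> chains R F f"
          by (auto simp: chains_def w(2))
        have "enclosing_rectangle (hd cs) (last cs) \<subseteq> rect p q" if "cs \<noteq> []"
        proof -
          have "hd cs \<in> rect p q" "last cs \<in> rect p q"
            using cs(2) that hd_in_set[OF that] last_in_set[OF that] by blast+
          then show ?thesis by (cases "hd cs"; cases "last cs") (auto simp: enclosing_rectangle_def)
        qed
        with ch sub have "cs \<in> down_chains R F f" by (auto simp: down_chains_def)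
        with l w(1)[OF ch] show "(\<Sum>c\<leftarrow>cs. w c) \<le> k" by force
      qed
    qed
  next
    assume b: "\<forall>(p, q)\<in>F. chain_bound R w (rect p q) k"
    show "\<forall>cs\<in>down_chains R F f. len cs \<le> k"
    proof
      fix cs assume cs0: "cs \<in> down_chains R F f"
      then have cs: "cs \<in> chains R F f" by (simp add: down_chains_def)
      then have s: "sorted_wrt (strict R) cs" "set cs \<subseteq> F"
        using chain_iff_sorted[OF tr, of cs] by (auto simp: chains_def)
      show "len cs \<le> k"
      proof (cases "cs = []")
        case True then show ?thesis using w(1)[OF cs] by simp
      next
        case False
        obtain p1 q1 where hd: "hd cs = (p1, q1)" by fastforce
        obtain p2 q2 where la: "last cs = (p2, q2)" by fastforce
        have er: "enclosing_rectangle (p1, q1) (p2, q2) \<subseteq> F"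
          using cs0 False hd la by (auto simp: down_chains_def)
        have "(p2, q1) \<in> enclosing_rectangle (p1, q1) (p2, q2)"
          by (simp add: enclosing_rectangle_def)
        with er have in_F: "(p2, q1) \<in> F" by blast
        have h: "c = (p1, q1) \<or> R (p1, q1) c" if "c \<in> set cs" for c
          using s(1) that hd by (cases cs) (auto simp: strict_def)
        have l: "c = (p2, q2) \<or> R c (p2, q2)" if "c \<in> set cs" for c
          using s(1) that la by (cases cs rule: rev_cases) (auto simp: sorted_wrt_append strict_def)
        have "set cs \<subseteq> rect p2 q1"
        proof
          fix c assume c: "c \<in> set cs"
          obtain x y where xy: "c = (x, y)" by fastforce
          have "0 < x \<and> 0 < y" using F s(2) c xy by (auto simp: down_shape_def)
          moreover have "x \<le> p2" using l[OF c] R xy unfolding se_chain_order_def by fastforce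
          moreover have "y \<le> q1" using h[OF c] R xy unfolding se_chain_order_def by fastforce
          ultimately show "c \<in> rect p2 q1" using xy by simp
        qed
        moreover have "chain_bound R w (rect p2 q1) k" using b in_F by auto
        ultimately show ?thesis using chain_boundD[OF _ s(1)] w(1)[OF cs] by auto
      qed
    qed
  qed
  finally show ?thesis .
qed

lemma chain_length_ind: "cs \<in> chains R F f \<Longrightarrow> length cs = (\<Sum>c\<leftarrow>cs. ind f c)"
proof -
  assume "cs \<in> chains R F f"
  then have "\<forall>c\<in>set cs. f c \<noteq> 0" by (simp add: chains_def)
  then show ?thesis by (induction cs) (auto simp: ind_def)
qed

lemma ind_eq_0_iff: "ind f c = 0 \<longleftrightarrow> f c = 0"
  by (simp add: ind_def)

lemmas rel_defs = rel_NE_def rel_ne_def rel_nE_def rel_Ne_def rel_SE_def rel_se_def rel_Se_def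
  rel_sE_def

lemma chain_orders:
  "ne_chain_order rel_NE" "ne_chain_order rel_ne" "ne_chain_order rel_nE" "ne_chain_order rel_Ne"
  "se_chain_order rel_SE" "se_chain_order rel_se" "se_chain_order rel_Se" "se_chain_order rel_sE"
  by (auto simp: ne_chain_order_def se_chain_order_def transp_def antisymp_def rel_defs)

lemma longest_le_iff:
  assumes "down_shape F"
  shows "longest_NE F f \<le> k \<longleftrightarrow> (\<forall>(p, q)\<in>F. chain_bound rel_NE f (rect p q) k)"
    and "longest_ne F f \<le> k \<longleftrightarrow> (\<forall>(p, q)\<in>F. chain_bound rel_ne (ind f) (rect p q) k)"
    and "longest_nE F f \<le> k \<longleftrightarrow> (\<forall>(p, q)\<in>F. chain_bound rel_nE (ind f) (rect p q) k)"
    and "longest_Ne F f \<le> k \<longleftrightarrow> (\<forall>(p, q)\<in>F. chain_bound rel_Ne (ind f) (rect p q) k)"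
    and "longest_SE F f \<le> k \<longleftrightarrow> (\<forall>(p, q)\<in>F. chain_bound rel_SE f (rect p q) k)"
    and "longest_se F f \<le> k \<longleftrightarrow> (\<forall>(p, q)\<in>F. chain_bound rel_se (ind f) (rect p q) k)"
    and "longest_Se F f \<le> k \<longleftrightarrow> (\<forall>(p, q)\<in>F. chain_bound rel_Se (ind f) (rect p q) k)"
    and "longest_sE F f \<le> k \<longleftrightarrow> (\<forall>(p, q)\<in>F. chain_bound rel_sE (ind f) (rect p q) k)"
proof -
  show "longest_NE F f \<le> k \<longleftrightarrow> (\<forall>(p, q)\<in>F. chain_bound rel_NE f (rect p q) k)"
    unfolding longest_NE_def by (rule longest_ne_le_iff[OF assms chain_orders(1) refl refl])
  show "longest_SE F f \<le> k \<longleftrightarrow> (\<forall>(p, q)\<in>F. chain_bound rel_SE f (rect p q) k)"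
    unfolding longest_SE_def by (rule longest_se_le_iff[OF assms chain_orders(5) refl refl])
qed (unfold longest_ne_def longest_nE_def longest_Ne_def longest_se_def longest_Se_def longest_sE_def,
    (rule longest_ne_le_iff[OF assms _ chain_length_ind ind_eq_0_iff]
      longest_se_le_iff[OF assms _ chain_length_ind ind_eq_0_iff],
      (rule chain_orders | assumption)+)+)

section \<open>Partitions\<close>

definition part :: "(nat \<Rightarrow> nat) \<Rightarrow> bool" where
  "part l \<longleftrightarrow> antimono l \<and> (\<exists>N. l N = 0)"

definition hstrip :: "(nat \<Rightarrow> nat) \<Rightarrow> (nat \<Rightarrow> nat) \<Rightarrow> bool" where
  "hstrip r l \<longleftrightarrow> part r \<and> part l \<and> (\<forall>i. r i \<le> l i \<and> l (Suc i) \<le> r i)"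

definition vstrip :: "(nat \<Rightarrow> nat) \<Rightarrow> (nat \<Rightarrow> nat) \<Rightarrow> bool" where
  "vstrip r l \<longleftrightarrow> part r \<and> part l \<and> (\<forall>i. r i \<le> l i \<and> l i \<le> Suc (r i))"

text \<open>The number of parts greater than \<open>j\<close>, that is, the length of column
  \<open>j\<close> of the diagram, with columns counted from 0.\<close>

definition conj_part :: "(nat \<Rightarrow> nat) \<Rightarrow> nat \<Rightarrow> nat" where
  "conj_part l j = (LEAST i. l i \<le> j)"

definition psize :: "(nat \<Rightarrow> nat) \<Rightarrow> nat" where
  "psize l = card {(i, j). j < l i}"

definition zero_part :: "nat \<Rightarrow> nat" where
  "zero_part i = 0"

lemma part_zero: "part zero_part"
  by (simp add: part_def zero_part_def monotone_def)

lemma part_antimono: "part l \<Longrightarrow> i \<le> j \<Longrightarrow> l j \<le> l i"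
  by (auto simp: part_def antimono_def)

lemma part_eventually_0:
  assumes "part l"
  obtains N where "\<And>i. N \<le> i \<Longrightarrow> l i = 0"
proof -
  obtain N where "l N = 0" using assms by (auto simp: part_def)
  then have "l i = 0" if "N \<le> i" for i
    using part_antimono[OF assms that] by simp
  then show ?thesis by (rule that)
qed

lemma partI: "(\<And>i. l (Suc i) \<le> l i) \<Longrightarrow> l N = 0 \<Longrightarrow> part l"
  unfolding part_def antimono_def using lift_Suc_antimono_le[of l] by auto

lemma parts_eventually_0:
  assumes "part u" "part w"
  obtains N where "\<And>i. N \<le> i \<Longrightarrow> u i = 0" "\<And>i. N \<le> i \<Longrightarrow> w i = 0"
proof -
  obtain N1 where N1: "\<And>i. N1 \<le> i \<Longrightarrow> u i = 0" by (rule part_eventually_0[OF assms(1)]) blast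
  obtain N2 where N2: "\<And>i. N2 \<le> i \<Longrightarrow> w i = 0" by (rule part_eventually_0[OF assms(2)]) blast
  show ?thesis by (rule that[of "max N1 N2"]) (simp_all add: N1 N2)
qed

lemma partI_between:
  assumes "\<And>i. l (Suc i) \<le> u i" "\<And>i. u i \<le> l i" "l N = 0"
  shows "part l"
  by (rule partI[of _ N]) (use assms le_trans in blast)+

text \<open>A Galois connection: inequalities between conjugates become inequalities between the
  partitions. That conjugation is an involution and exchanges the two kinds of strips follows by
  comparing bounds.\<close>

lemma conj_part_le_iff:
  assumes "part l"
  shows "conj_part l j \<le> i \<longleftrightarrow> l i \<le> j"
proof
  assume "conj_part l j \<le> i"
  moreover have "l (conj_part l j) \<le> j"
    unfolding conj_part_def
    by (rule LeastI_ex) (use assms in \<open>unfold part_def, metis le0\<close>)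
  ultimately show "l i \<le> j" using part_antimono[OF assms] le_trans by blast
next
  assume "l i \<le> j" then show "conj_part l j \<le> i" unfolding conj_part_def by (rule Least_le)
qed

lemma part_conj: assumes "part l" shows "part (conj_part l)"
proof (rule partI)
  show "conj_part l (Suc i) \<le> conj_part l i" for i
    using conj_part_le_iff[OF assms] by (meson le_SucI le_refl)
  show "conj_part l (l 0) = 0"
    using conj_part_le_iff[OF assms, of "l 0" 0] by simp
qed

lemma conj_conj: assumes "part l" shows "conj_part (conj_part l) = l"
proof
  fix i
  have "conj_part (conj_part l) i \<le> k \<longleftrightarrow> l i \<le> k" for k
    by (simp add: conj_part_le_iff part_conj assms)
  then show "conj_part (conj_part l) i = l i" by (meson antisym le_refl)
qed

lemma conj_zero: "conj_part zero_part = zero_part"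
  by (auto simp: conj_part_def zero_part_def)

lemma vstrip_conj: assumes "hstrip r l" shows "vstrip (conj_part r) (conj_part l)"
proof -
  have p: "part r" "part l" and s: "\<And>i. r i \<le> l i" "\<And>i. l (Suc i) \<le> r i"
    using assms by (auto simp: hstrip_def)
  have "conj_part r j \<le> conj_part l j" for j
    using conj_part_le_iff p s(1) by (meson le_refl le_trans)
  moreover have "conj_part l j \<le> Suc (conj_part r j)" for j
    using conj_part_le_iff p s(2) by (meson le_refl le_trans)
  ultimately show ?thesis by (simp add: vstrip_def part_conj p)
qed

lemma hstrip_conj: assumes "vstrip r l" shows "hstrip (conj_part r) (conj_part l)"
proof -
  have p: "part r" "part l" and s: "\<And>i. r i \<le> l i" "\<And>i. l i \<le> Suc (r i)"
    using assms by (auto simp: vstrip_def)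
  have "conj_part r j \<le> conj_part l j" for j
    using conj_part_le_iff p s(1) by (meson le_refl le_trans)
  moreover have "conj_part l (Suc j) \<le> conj_part r j" for j
    using conj_part_le_iff p s(2) by (meson le_refl le_trans Suc_le_mono)
  ultimately show ?thesis by (simp add: hstrip_def part_conj p)
qed

lemma psize_conj: assumes "part l" shows "psize (conj_part l) = psize l"
proof -
  have "j < conj_part l i \<longleftrightarrow> i < l j" for i j
    using conj_part_le_iff[OF assms, of i j] by linarith
  then have "{(i, j). j < conj_part l i} = prod.swap ` {(i, j). j < l i}"
    by (auto simp: image_iff)
  then show ?thesis unfolding psize_def by (simp add: card_image)
qed

lemma psize_sum: assumes "\<And>i. N \<le> i \<Longrightarrow> l i = 0" shows "psize l = (\<Sum>i<N. l i)"
proof -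
  have "{(i, j). j < l i} = (SIGMA i:{..<N}. {..<l i})"
    using assms by (auto simp: not_le[symmetric])
  then show ?thesis unfolding psize_def by simp
qed

section \<open>Growth diagrams\<close>

text \<open>\<open>grow \<phi> Z f p q\<close> labels the upper right corner of the cell \<open>(p, q)\<close>. The arguments of the
  local rule \<open>\<phi>\<close> are the labels of the lower left, upper left and lower right corners of a cell
  and its entry.\<close>

fun grow :: "('l \<Rightarrow> 'l \<Rightarrow> 'l \<Rightarrow> nat \<Rightarrow> 'l) \<Rightarrow> 'l \<Rightarrow> (cell \<Rightarrow> nat) \<Rightarrow> nat \<Rightarrow> nat \<Rightarrow> 'l" where
  "grow \<phi> Z f 0 q = Z"
| "grow \<phi> Z f (Suc p) 0 = Z"
| "grow \<phi> Z f (Suc p) (Suc q) =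
     \<phi> (grow \<phi> Z f p q) (grow \<phi> Z f p (Suc q)) (grow \<phi> Z f (Suc p) q) (f (Suc p, Suc q))"

lemma grow_0_right [simp]: "grow \<phi> Z f p 0 = Z"
  by (cases p) auto

lemma grow_cong:
  "(\<And>c. c \<in> rect p q \<Longrightarrow> f c = g c) \<Longrightarrow> grow \<phi> Z f p q = grow \<phi> Z g p q"
proof (induction \<phi> Z f p q rule: grow.induct)
  case (3 \<phi> Z f p q)
  have "grow \<phi> Z f p q = grow \<phi> Z g p q"
    "grow \<phi> Z f p (Suc q) = grow \<phi> Z g p (Suc q)" "grow \<phi> Z f (Suc p) q = grow \<phi> Z g (Suc p) q"
    by (rule 3; use 3(4) in auto)+
  then show ?case using 3(4) by simp
qed auto

text \<open>A corner is named after the cell to its lower left. Both axes belong to it in full, so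
  that the border of the empty shape consists of the axes; this is the base case of
  \<open>filling_with_labels\<close>.\<close>

definition corners :: "cell set \<Rightarrow> cell set" where
  "corners F = {(p, q). p = 0 \<or> q = 0 \<or> (p, q) \<in> F}"

definition border :: "cell set \<Rightarrow> cell set" where
  "border F = {(p, q). (p, q) \<in> corners F \<and> (Suc p, Suc q) \<notin> F}"

lemma corners_closed:
  assumes "down_shape F" "(p, q) \<in> corners F" "p' \<le> p" "q' \<le> q"
  shows "(p', q') \<in> corners F"
  using assms down_shape_closed[OF assms(1), of p q p' q'] by (auto simp: corners_def)

definition border_labelling :: "('l \<Rightarrow> 'l \<Rightarrow> bool) \<Rightarrow> ('l \<Rightarrow> 'l \<Rightarrow> bool) \<Rightarrow> 'l \<Rightarrow>
    cell set \<Rightarrow> (nat \<Rightarrow> nat \<Rightarrow> 'l) \<Rightarrow> bool" where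
  "border_labelling H V Z F M \<longleftrightarrow> (\<forall>p q. (p, q) \<in> border F \<longrightarrow>
     (p = 0 \<or> q = 0 \<longrightarrow> M p q = Z) \<and>
     ((Suc p, q) \<in> border F \<longrightarrow> H (M p q) (M (Suc p) q)) \<and>
     ((p, Suc q) \<in> border F \<longrightarrow> V (M p q) (M p (Suc q))))"

lemma cell_corners:
  assumes F: "down_shape F" and c: "(Suc p, Suc q) \<in> F"
  shows "(Suc p, Suc q) \<in> corners F" "(p, Suc q) \<in> corners F" "(Suc p, q) \<in> corners F"
    "(p, q) \<in> corners F"
proof -
  show 1: "(Suc p, Suc q) \<in> corners F" using c by (simp add: corners_def)
  show "(p, Suc q) \<in> corners F" "(Suc p, q) \<in> corners F" "(p, q) \<in> corners F"
    by (rule corners_closed[OF F 1]; simp)+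
qed

lemma down_shape_SucE:
  assumes "down_shape F" "c \<in> F"
  obtains p q where "c = (Suc p, Suc q)"
proof -
  obtain x y where "c = (x, y)" by fastforce
  moreover from this have "0 < x" "0 < y" using assms by (auto simp: down_shape_def)
  ultimately show ?thesis using that by (auto simp: gr0_conv_Suc)
qed

text \<open>\<open>rule_surj\<close> and \<open>rule_inj\<close> say that, with \<open>u\<close> and
  \<open>v\<close> fixed, lower left label and entry correspond bijectively to the upper right
  label. \<open>H_Z_left\<close> and \<open>V_Z_left\<close> force the label \<open>Z\<close> onto
  the axes when the rule is run backwards.\<close>

locale growth =
  fixes E :: "nat set" and H V :: "'l \<Rightarrow> 'l \<Rightarrow> bool" and Z :: 'l
    and \<phi> :: "'l \<Rightarrow> 'l \<Rightarrow> 'l \<Rightarrow> nat \<Rightarrow> 'l" and sz :: "'l \<Rightarrow> nat"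
  assumes H_Z: "H Z Z" and V_Z: "V Z Z"
    and H_Z_left: "H r Z \<Longrightarrow> r = Z" and V_Z_left: "V r Z \<Longrightarrow> r = Z"
    and rule_H: "V r u \<Longrightarrow> H r v \<Longrightarrow> m \<in> E \<Longrightarrow> H u (\<phi> r u v m)"
    and rule_V: "V r u \<Longrightarrow> H r v \<Longrightarrow> m \<in> E \<Longrightarrow> V v (\<phi> r u v m)"
    and rule_surj: "H u l \<Longrightarrow> V v l \<Longrightarrow> \<exists>r m. m \<in> E \<and> V r u \<and> H r v \<and> \<phi> r u v m = l"
    and rule_inj: "V r u \<Longrightarrow> H r v \<Longrightarrow> m \<in> E \<Longrightarrow> V r' u \<Longrightarrow> H r' v \<Longrightarrow> m' \<in> E \<Longrightarrow>
      \<phi> r u v m = \<phi> r' u v m' \<Longrightarrow> r = r' \<and> m = m'"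
    and rule_size: "V r u \<Longrightarrow> H r v \<Longrightarrow> m \<in> E \<Longrightarrow> sz (\<phi> r u v m) + sz r = sz u + sz v + m"
begin

abbreviation "lab \<equiv> grow \<phi> Z"

text \<open>Both kinds of edges are treated at once, because either outgoing edge of a cell depends
  on the two edges at its lower left corner.\<close>

lemma lab_steps:
  assumes F: "down_shape F" and f: "\<And>c. c \<in> F \<Longrightarrow> f c \<in> E"
  shows "((Suc p, q) \<in> corners F \<longrightarrow> H (lab f p q) (lab f (Suc p) q)) \<and>
         ((p, Suc q) \<in> corners F \<longrightarrow> V (lab f p q) (lab f p (Suc q)))"
proof (induction "p + q" arbitrary: p q rule: less_induct)
  case less
  have "H (lab f p q) (lab f (Suc p) q)" if c: "(Suc p, q) \<in> corners F"
  proof (cases q)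
    case 0 then show ?thesis by (simp add: H_Z)
  next
    case (Suc q')
    have "(p, Suc q') \<in> corners F" "(Suc p, q') \<in> corners F"
      using corners_closed[OF F c] Suc by auto
    moreover have "f (Suc p, Suc q') \<in> E" using f c Suc by (auto simp: corners_def)
    ultimately show ?thesis using less[of p q'] Suc by (auto intro: rule_H)
  qed
  moreover have "V (lab f p q) (lab f p (Suc q))" if c: "(p, Suc q) \<in> corners F"
  proof (cases p)
    case 0 then show ?thesis by (simp add: V_Z)
  next
    case (Suc p')
    have "(p', Suc q) \<in> corners F" "(Suc p', q) \<in> corners F"
      using corners_closed[OF F c] Suc by auto
    moreover have "f (Suc p', Suc q) \<in> E" using f c Suc by (auto simp: corners_def)
    ultimately show ?thesis using less[of p' q] Suc by (auto intro: rule_V)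
  qed
  ultimately show ?case by blast
qed

text \<open>The local rule is run backwards from the border: at a cell whose other three corners are
  settled, \<open>rule_inj\<close> yields the lower left label and the entry together.\<close>

lemma labels_determine_filling:
  assumes F: "down_shape F" and f: "\<And>c. c \<in> F \<Longrightarrow> f c \<in> E" and g: "\<And>c. c \<in> F \<Longrightarrow> g c \<in> E"
    and eq: "\<And>p q. (p, q) \<in> border F \<Longrightarrow> lab f p q = lab g p q"
    and c: "c \<in> F"
  shows "f c = g c"
proof -
  have "finite F" using F by (simp add: down_shape_def)
  then have "finite ((\<lambda>(p, q). p + q) ` F)" by simp
  then obtain N where N: "\<And>p q. (p, q) \<in> F \<Longrightarrow> p + q \<le> N"
    using finite_nat_set_iff_bounded_le[of "(\<lambda>(p, q). p + q) ` F"] by force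
  have main: "lab f p q = lab g p q \<and> ((Suc p, Suc q) \<in> F \<longrightarrow> f (Suc p, Suc q) = g (Suc p, Suc q))"
    if "(p, q) \<in> corners F" for p q
    using that
  proof (induction "Suc (Suc N) - (p + q)" arbitrary: p q rule: less_induct)
    case less
    show ?case
    proof (cases "(Suc p, Suc q) \<in> F")
      case False
      then show ?thesis using eq less by (auto simp: border_def)
    next
      case True
      note cs = cell_corners[OF F True]
      have b: "p + q < N" using N[OF True] by simp
      have l: "lab f (Suc p) (Suc q) = lab g (Suc p) (Suc q)" "lab f p (Suc q) = lab g p (Suc q)"
        "lab f (Suc p) q = lab g (Suc p) q"
        using less(1)[OF _ cs(1)] less(1)[OF _ cs(2)] less(1)[OF _ cs(3)] b by auto
      have 1: "V (lab f p q) (lab f p (Suc q))" "H (lab f p q) (lab f (Suc p) q)"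
        "V (lab g p q) (lab g p (Suc q))" "H (lab g p q) (lab g (Suc p) q)"
        using lab_steps[OF F, of f p q] lab_steps[OF F, of g p q] f g cs by auto
      have "lab f p q = lab g p q \<and> f (Suc p, Suc q) = g (Suc p, Suc q)"
        using rule_inj[OF 1(1,2) f[OF True], of "lab g p q" "g (Suc p, Suc q)"] 1(3,4) g[OF True] l
        by simp
      then show ?thesis by simp
    qed
  qed
  obtain p q where pq: "c = (Suc p, Suc q)"
    using down_shape_SucE[OF F c] .
  then have "(p, q) \<in> corners F" using c cell_corners[OF F] by simp
  then show ?thesis using main c pq by blast
qed

lemma border_labelling_lab:
  assumes "down_shape F" "\<And>c. c \<in> F \<Longrightarrow> f c \<in> E"
  shows "border_labelling H V Z F (lab f)"
  using lab_steps[OF assms] by (auto simp: border_labelling_def border_def)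

text \<open>One outermost cell is removed: the inverse rule gives its entry and the label of its
  lower left corner, which then replaces the upper right corner on the border of the smaller
  shape.\<close>

lemma filling_with_labels:
  assumes "down_shape F" "border_labelling H V Z F M"
  shows "\<exists>g. (\<forall>c\<in>F. g c \<in> E) \<and> (\<forall>p q. (p, q) \<in> border F \<longrightarrow> lab g p q = M p q)"
  using assms
proof (induction "card F" arbitrary: F M)
  case 0
  then have "F = {}" by (simp add: down_shape_def)
  then have "lab (\<lambda>_. 0) p q = M p q" if "(p, q) \<in> border F" for p q
    using 0(3) that by (auto simp: border_labelling_def border_def corners_def)
  with \<open>F = {}\<close> show ?case by blast
next
  case (Suc k)
  have fin: "finite F" using Suc by (simp add: down_shape_def)
  have ne: "F \<noteq> {}" using Suc(2) by auto
  \<comment> \<open>A cell maximizing column plus row has no other cell of \<open>F\<close> weakly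
    above and to the right of it, so removing it leaves a down-closed shape.\<close>
  define S where "S = (\<lambda>(p, q). p + q) ` F"
  have "Max S \<in> S" unfolding S_def using fin ne by (intro Max_in) auto
  then obtain p0 q0 where c0: "(p0, q0) \<in> F" "p0 + q0 = Max S" by (auto simp: S_def)
  have mx: "x + y \<le> p0 + q0" if "(x, y) \<in> F" for x y
    using that fin unfolding c0(2) S_def by (intro Max_ge) auto
  obtain p q where pq: "p0 = Suc p" "q0 = Suc q"
    using down_shape_SucE[OF Suc(3) c0(1)] by blast
  let ?c = "(Suc p, Suc q)"
  have cF: "?c \<in> F" using c0 pq by simp
  have corner: "(x, y) = ?c" if "(x, y) \<in> F" "Suc p \<le> x" "Suc q \<le> y" for x y
    using mx[OF that(1)] that pq by auto
  define G where "G = F - {?c}"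
  have G: "down_shape G"
    unfolding down_shape_def
  proof (intro conjI allI impI)
    show "finite G" using fin by (simp add: G_def)
    fix x y assume xy: "(x, y) \<in> G"
    then have xyF: "(x, y) \<in> F" by (simp add: G_def)
    then show "0 < x" "0 < y" using Suc(3) by (auto simp: down_shape_def)
    have "?c \<notin> rect x y" using xy corner[OF xyF] by (auto simp: G_def)
    moreover have "rect x y \<subseteq> F" using Suc(3) xyF by (auto simp: down_shape_def)
    ultimately show "rect x y \<subseteq> G" by (auto simp: G_def)
  qed
  note corners_F = cell_corners(2-4)[OF Suc(3) cF]
  have nF: "(Suc p, Suc (Suc q)) \<notin> F" "(Suc (Suc p), Suc q) \<notin> F" "(Suc (Suc p), Suc (Suc q)) \<notin> F"
    using mx pq by fastforce+
  have bF: "(p, Suc q) \<in> border F" "(Suc p, q) \<in> border F" "?c \<in> border F"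
    using corners_F nF cF by (auto simp: border_def corners_def)
  have bl: "\<And>x y. (x, y) \<in> border F \<Longrightarrow> x = 0 \<or> y = 0 \<Longrightarrow> M x y = Z"
    "\<And>x y. (x, y) \<in> border F \<Longrightarrow> (Suc x, y) \<in> border F \<Longrightarrow> H (M x y) (M (Suc x) y)"
    "\<And>x y. (x, y) \<in> border F \<Longrightarrow> (x, Suc y) \<in> border F \<Longrightarrow> V (M x y) (M x (Suc y))"
    using Suc(4) by (auto simp: border_labelling_def)
  obtain r m where r: "m \<in> E" "V r (M p (Suc q))" "H r (M (Suc p) q)"
    "\<phi> r (M p (Suc q)) (M (Suc p) q) m = M (Suc p) (Suc q)"
    using rule_surj[OF bl(2)[OF bF(1,3)] bl(3)[OF bF(2,3)]] by blast
  define M' where "M' = (\<lambda>x y. if x = p \<and> y = q then r else M x y)"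
  have bG: "(x, y) \<in> border G \<longleftrightarrow> (x, y) = (p, q) \<or> (x, y) \<in> border F \<and> (x, y) \<noteq> ?c" for x y
    using corners_F(3) nF cF by (auto simp: border_def corners_def G_def)
  \<comment> \<open>On an axis the adjacent border label is \<open>Z\<close>, and only
    \<open>Z\<close> steps to \<open>Z\<close>.\<close>
  have r0: "r = Z" if "p = 0 \<or> q = 0"
    using that bl(1)[OF bF(1)] bl(1)[OF bF(2)] r(2,3) V_Z_left H_Z_left by auto
  have rectF: "(x, y) \<in> F" if "0 < x" "0 < y" "x \<le> Suc p" "y \<le> Suc q" for x y
    using down_shape_closed[OF Suc(3) cF] that by simp
  \<comment> \<open>The corners immediately left of and below \<open>(p, q)\<close> are not on the
    border, so the only new border edges are the two that leave \<open>(p, q)\<close>; these are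
    covered by the choice of \<open>r\<close>.\<close>
  have no_prev: "(x, y) \<notin> border F" if "(Suc x, y) = (p, q) \<or> (x, Suc y) = (p, q)" for x y
    using that rectF[of "Suc x" "Suc y"] by (auto simp: border_def)
  have "border_labelling H V Z G M'"
    unfolding border_labelling_def
  proof (intro allI impI conjI)
    fix x y assume xy: "(x, y) \<in> border G"
    show "M' x y = Z" if "x = 0 \<or> y = 0"
      using that xy bl(1) r0 by (auto simp: M'_def bG)
    show "H (M' x y) (M' (Suc x) y)" if s: "(Suc x, y) \<in> border G"
    proof (cases "(x, y) = (p, q)")
      case True then show ?thesis using r(3) by (auto simp: M'_def)
    next
      case False
      then have "(Suc x, y) \<noteq> (p, q)" using no_prev[of x y] xy by (auto simp: bG)
      then show ?thesis using False xy s bl(2) by (auto simp: M'_def bG)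
    qed
    show "V (M' x y) (M' x (Suc y))" if s: "(x, Suc y) \<in> border G"
    proof (cases "(x, y) = (p, q)")
      case True then show ?thesis using r(2) by (auto simp: M'_def)
    next
      case False
      then have "(x, Suc y) \<noteq> (p, q)" using no_prev[of x y] xy by (auto simp: bG)
      then show ?thesis using False xy s bl(3) by (auto simp: M'_def bG)
    qed
  qed
  moreover have "k = card G" using Suc(2) cF fin by (simp add: G_def)
  ultimately obtain g where g: "\<And>c. c \<in> G \<Longrightarrow> g c \<in> E"
    "\<And>x y. (x, y) \<in> border G \<Longrightarrow> lab g x y = M' x y"
    using Suc(1)[of G M'] G by blast
  let ?g = "g(?c := m)"
  have lab_eq: "lab ?g x y = lab g x y" if "\<not> (Suc p \<le> x \<and> Suc q \<le> y)" for x y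
    by (rule grow_cong) (use that in auto)
  have "lab ?g x y = M x y" if xy: "(x, y) \<in> border F" for x y
  proof (cases "(x, y) = ?c")
    case True
    have "lab g p q = r" "lab g p (Suc q) = M p (Suc q)" "lab g (Suc p) q = M (Suc p) q"
      using g(2) bF by (auto simp: bG M'_def)
    then show ?thesis using True r(4) by (simp add: lab_eq)
  next
    case False
    then have "\<not> (Suc p \<le> x \<and> Suc q \<le> y)"
      using corner[of x y] xy by (auto simp: border_def corners_def)
    moreover have "(x, y) \<noteq> (p, q)" using xy cF by (auto simp: border_def)
    ultimately show ?thesis using g(2)[of x y] False xy by (auto simp: lab_eq bG M'_def)
  qed
  moreover have "?g c \<in> E" if "c \<in> F" for c
    using that g(1) r(1) by (auto simp: G_def)
  ultimately show ?case by blast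
qed

text \<open>\<open>rule_size\<close> telescopes when it is added up along a column.\<close>

lemma column_sum:
  assumes F: "down_shape F" and f: "\<And>c. c \<in> F \<Longrightarrow> f c \<in> E" and h: "(Suc p, h) \<in> corners F"
  shows "(\<Sum>q = 1..h. f (Suc p, q)) + sz (lab f p h) = sz (lab f (Suc p) h)"
  using h
proof (induction h)
  case 0 then show ?case by simp
next
  case (Suc h)
  have c: "(Suc p, h) \<in> corners F" "(p, Suc h) \<in> corners F"
    using corners_closed[OF F Suc(2)] by auto
  have "V (lab f p h) (lab f p (Suc h))" "H (lab f p h) (lab f (Suc p) h)"
    using lab_steps[OF F f] c by auto
  moreover have "f (Suc p, Suc h) \<in> E" using f Suc(2) by (auto simp: corners_def)
  ultimately show ?case using Suc(1)[OF c(1)] rule_size by fastforce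
qed

end

section \<open>Sums of entries and equinumerous sets of fillings\<close>

definition column_height :: "cell set \<Rightarrow> nat \<Rightarrow> nat" where
  "column_height F p = card {q. (p, q) \<in> F}"

lemma in_shape_iff_column_height:
  assumes F: "down_shape F"
  shows "(p, q) \<in> F \<longleftrightarrow> 0 < q \<and> q \<le> column_height F p"
proof -
  let ?A = "{q. (p, q) \<in> F}"
  have "?A \<subseteq> snd ` F" by force
  moreover have "finite (snd ` F)" using F by (simp add: down_shape_def)
  ultimately have fin: "finite ?A" by (rule finite_subset)
  have "?A = {1..card ?A}"
  proof (cases "?A = {}")
    case True then show ?thesis by (simp only: True) simp
  next
    case False
    have "Max ?A \<in> ?A" using fin False by (rule Max_in)
    then have "(p, Max ?A) \<in> F" by simp
    moreover from this have "0 < p" using F unfolding down_shape_def by blast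
    ultimately have "(p, x) \<in> F" if "0 < x" "x \<le> Max ?A" for x
      using down_shape_closed[OF F] that by blast
    moreover have "0 < x" if "(p, x) \<in> F" for x
      using F that unfolding down_shape_def by blast
    moreover have "x \<le> Max ?A" if "(p, x) \<in> F" for x
      using fin that by simp
    ultimately have eq: "?A = {1..Max ?A}"
      by (intro set_eqI) (metis One_nat_def Suc_le_eq atLeastAtMost_iff mem_Collect_eq)
    have "card ?A = Max ?A" by (subst eq) simp
    then show ?thesis using eq by simp
  qed
  then have "q \<in> ?A \<longleftrightarrow> q \<in> {1..card ?A}" by simp
  then show ?thesis unfolding column_height_def by (simp add: Suc_le_eq)
qed

text \<open>The top edge of every column joins two border corners, so the border labels already
  determine the column sums.\<close>

lemma equal_labels_equal_sum:
  assumes g1: "growth E1 H V Z \<phi>1 sz" and g2: "growth E2 H V Z \<phi>2 sz" and F: "down_shape F"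
    and f: "\<And>c. c \<in> F \<Longrightarrow> f c \<in> E1" and g: "\<And>c. c \<in> F \<Longrightarrow> g c \<in> E2"
    and eq: "\<And>p q. (p, q) \<in> border F \<Longrightarrow> grow \<phi>1 Z f p q = grow \<phi>2 Z g p q"
  shows "(\<Sum>c\<in>F. f c) = (\<Sum>c\<in>F. g c)"
proof -
  have "finite (fst ` F)" using F by (simp add: down_shape_def)
  let ?h = "column_height F"
  have S: "F = Sigma (fst ` F) (\<lambda>p. {1..?h p})"
    using in_shape_iff_column_height[OF F] by (auto simp: image_iff) force
  have col: "(\<Sum>q = 1..?h p. f (p, q)) = (\<Sum>q = 1..?h p. g (p, q))" if "p \<in> fst ` F" for p
  proof -
    have "0 < p" using that F by (auto simp: down_shape_def)
    then obtain p' where p: "p = Suc p'" by (auto simp: gr0_conv_Suc)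
    have c: "(Suc p', ?h p) \<in> corners F"
      using in_shape_iff_column_height[OF F] p by (auto simp: corners_def)
    have c': "(p', ?h p) \<in> corners F" by (rule corners_closed[OF F c]) auto
    have "(Suc p', Suc (?h p)) \<notin> F" using in_shape_iff_column_height[OF F] p by auto
    moreover have "(Suc (Suc p'), Suc (?h p)) \<notin> F"
      using \<open>(Suc p', Suc (?h p)) \<notin> F\<close> down_shape_closed[OF F, of "Suc (Suc p')" "Suc (?h p)"] by auto
    ultimately have "(Suc p', ?h p) \<in> border F" "(p', ?h p) \<in> border F"
      using c c' by (auto simp: border_def)
    then show ?thesis
      using growth.column_sum[OF g1 F f c] growth.column_sum[OF g2 F g c] eq p by fastforce
  qed
  have "(\<Sum>c\<in>F. f c) = (\<Sum>p\<in>fst ` F. \<Sum>q = 1..?h p. f (p, q))"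
    by (subst S, subst sum.Sigma) (auto simp: \<open>finite (fst ` F)\<close>)
  also have "\<dots> = (\<Sum>p\<in>fst ` F. \<Sum>q = 1..?h p. g (p, q))"
    using col by (rule sum.cong[OF refl])
  also have "\<dots> = (\<Sum>c\<in>F. g c)"
    by (subst (2) S, subst sum.Sigma) (auto simp: \<open>finite (fst ` F)\<close>)
  finally show ?thesis .
qed

lemma card_eq_by_relation:
  assumes "\<And>a. a \<in> A \<Longrightarrow> \<exists>b\<in>B. R a b" "\<And>b. b \<in> B \<Longrightarrow> \<exists>a\<in>A. R a b"
    and "\<And>a b b'. a \<in> A \<Longrightarrow> b \<in> B \<Longrightarrow> b' \<in> B \<Longrightarrow> R a b \<Longrightarrow> R a b' \<Longrightarrow> b = b'"
    and "\<And>a a' b. a \<in> A \<Longrightarrow> a' \<in> A \<Longrightarrow> b \<in> B \<Longrightarrow> R a b \<Longrightarrow> R a' b \<Longrightarrow> a = a'"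
  shows "card A = card B"
proof -
  obtain k where k: "\<And>a. a \<in> A \<Longrightarrow> k a \<in> B \<and> R a (k a)" using assms(1) by metis
  have "inj_on k A" using k assms(4) by (metis inj_onI)
  moreover have "k ` A = B" using k assms(2,3) by blast
  ultimately show ?thesis by (metis card_image)
qed

text \<open>Having the same border labels is a bijection between the two sets of fillings, since
  both rules admit exactly the labellings with steps in \<open>H\<close> and \<open>V\<close>. Thus
  \<open>P\<close> and \<open>Q\<close> have to agree only on fillings related in this way.\<close>

lemma equinumerous_fillings:
  assumes g1: "growth E1 H V Z \<phi>1 sz" and g2: "growth E2 H V Z \<phi>2 sz" and F: "down_shape F"
    and PQ: "\<And>f g. f \<in> F \<rightarrow>\<^sub>E E1 \<Longrightarrow> g \<in> F \<rightarrow>\<^sub>E E2 \<Longrightarrow> (\<Sum>c\<in>F. f c) = (\<Sum>c\<in>F. g c) \<Longrightarrow>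
      (\<And>p q. (p, q) \<in> border F \<Longrightarrow> grow \<phi>1 Z f p q = grow \<phi>2 Z g p q) \<Longrightarrow> P f \<longleftrightarrow> Q g"
  shows "card {f \<in> F \<rightarrow>\<^sub>E E1. P f} = card {g \<in> F \<rightarrow>\<^sub>E E2. Q g}"
proof -
  let ?R = "\<lambda>f g. \<forall>p q. (p, q) \<in> border F \<longrightarrow> grow \<phi>1 Z f p q = grow \<phi>2 Z g p q"
  have PQ': "P f \<longleftrightarrow> Q g" if "f \<in> F \<rightarrow>\<^sub>E E1" "g \<in> F \<rightarrow>\<^sub>E E2" "?R f g" for f g
    using that equal_labels_equal_sum[OF g1 g2 F, of f g] by (intro PQ) (auto simp: PiE_def Pi_def)
  have ex: "\<exists>g\<in>F \<rightarrow>\<^sub>E E2'. \<forall>p q. (p, q) \<in> border F \<longrightarrow> grow \<phi>1' Z f p q = grow \<phi>2' Z g p q"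
    if gr: "growth E1' H V Z \<phi>1' sz" "growth E2' H V Z \<phi>2' sz" "f \<in> F \<rightarrow>\<^sub>E E1'"
    for E1' E2' \<phi>1' \<phi>2' f
  proof -
    have "border_labelling H V Z F (grow \<phi>1' Z f)"
      by (rule growth.border_labelling_lab[OF gr(1) F]) (use gr(3) in auto)
    then obtain g where g: "\<forall>c\<in>F. g c \<in> E2'"
      "\<And>p q. (p, q) \<in> border F \<Longrightarrow> grow \<phi>2' Z g p q = grow \<phi>1' Z f p q"
      using growth.filling_with_labels[OF gr(2) F] by blast
    \<comment> \<open>Outside \<open>F\<close> an extensional filling is \<open>undefined\<close>,
      but border labels read only cells of \<open>F\<close>.\<close>
    have "grow \<phi>2' Z (restrict g F) p q = grow \<phi>2' Z g p q" if "(p, q) \<in> border F" for p q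
    proof (rule grow_cong)
      fix c assume "c \<in> rect p q"
      then have "c \<in> F"
        using that F by (cases c) (auto simp: border_def corners_def down_shape_def subset_iff)
      then show "restrict g F c = g c" by simp
    qed
    with g show ?thesis by (intro bexI[of _ "restrict g F"]) auto
  qed
  have uniq: "f = g" if "growth E' H V Z \<phi>' sz" "f \<in> F \<rightarrow>\<^sub>E E'" "g \<in> F \<rightarrow>\<^sub>E E'"
    "\<And>p q. (p, q) \<in> border F \<Longrightarrow> grow \<phi>' Z f p q = grow \<phi>' Z g p q" for E' \<phi>' f g
    by (rule PiE_ext[OF that(2,3)], rule growth.labels_determine_filling[OF that(1) F])
      (use that in auto)
  show ?thesis
  proof (rule card_eq_by_relation[where R="?R"])
    fix f assume "f \<in> {f \<in> F \<rightarrow>\<^sub>E E1. P f}"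
    then show "\<exists>g\<in>{g \<in> F \<rightarrow>\<^sub>E E2. Q g}. ?R f g" using ex[OF g1 g2, of f] PQ' by blast
  next
    fix g assume g: "g \<in> {g \<in> F \<rightarrow>\<^sub>E E2. Q g}"
    then obtain f where f: "f \<in> F \<rightarrow>\<^sub>E E1" "?R f g" using ex[OF g2 g1, of g] by force
    with g PQ' show "\<exists>f\<in>{f \<in> F \<rightarrow>\<^sub>E E1. P f}. ?R f g" by blast
  next
    fix f g g' assume "g \<in> {g \<in> F \<rightarrow>\<^sub>E E2. Q g}" "g' \<in> {g \<in> F \<rightarrow>\<^sub>E E2. Q g}" "?R f g" "?R f g'"
    then show "g = g'" by (intro uniq[OF g2]) simp_all
  next
    fix f f' g assume "f \<in> {f \<in> F \<rightarrow>\<^sub>E E1. P f}" "f' \<in> {f \<in> F \<rightarrow>\<^sub>E E1. P f}" "?R f g" "?R f' g"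
    then show "f = f'" by (intro uniq[OF g1]) simp_all
  qed
qed

section \<open>Local rules with a carry\<close>

text \<open>Each of the local rules treats the parts of the labels one after the other; whatever entry
  does not fit into part \<open>i\<close> is carried over to part \<open>i + 1\<close>.\<close>

primrec carry :: "(nat \<Rightarrow> nat \<Rightarrow> nat \<Rightarrow> nat \<Rightarrow> nat) \<Rightarrow> (nat \<Rightarrow> nat) \<Rightarrow> (nat \<Rightarrow> nat) \<Rightarrow> (nat \<Rightarrow> nat) \<Rightarrow>
    nat \<Rightarrow> nat \<Rightarrow> nat" where
  "carry g r u v m 0 = m"
| "carry g r u v m (Suc i) =
     carry g r u v m i + u i + v i - r i - g (r i) (u i) (v i) (carry g r u v m i)"

definition carry_label :: "(nat \<Rightarrow> nat \<Rightarrow> nat \<Rightarrow> nat \<Rightarrow> nat) \<Rightarrow> (nat \<Rightarrow> nat) \<Rightarrow> (nat \<Rightarrow> nat) \<Rightarrow>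
    (nat \<Rightarrow> nat) \<Rightarrow> nat \<Rightarrow> nat \<Rightarrow> nat" where
  "carry_label g r u v m i = g (r i) (u i) (v i) (carry g r u v m i)"

text \<open>For inverting a rule: guessed carries are the right ones as soon as they satisfy the
  conservation law, since this law determines each next carry.\<close>

lemma carry_label_eqI:
  assumes "\<And>i. g (r i) (u i) (v i) (c i) = l i" "\<And>i. c (Suc i) + r i + l i = c i + u i + v i"
  shows "carry_label g r u v (c 0) = l"
proof -
  have "carry g r u v (c 0) i = c i" for i
  proof (induction i)
    case (Suc i)
    then show ?case using assms(1)[of i] assms(2)[of i] by simp
  qed simp
  then show ?thesis using assms(1) by (auto simp: carry_label_def)
qed

text \<open>For inverse rules in which a carry is recovered from the following one: the recursion
  starts behind the last part, where all carries vanish.\<close>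

lemma backward_recursion:
  assumes "\<And>i. N \<le> i \<Longrightarrow> G i 0 = (0 :: nat)"
  shows "\<exists>c. (\<forall>i. N \<le> i \<longrightarrow> c i = 0) \<and> (\<forall>i. c i = G i (c (Suc i)))"
proof (intro exI conjI allI impI)
  define d where "d = rec_nat 0 (\<lambda>k. G (N - Suc k))"
  let ?c = "\<lambda>i. if N \<le> i then 0 else d (N - i)"
  show "\<And>i. N \<le> i \<Longrightarrow> ?c i = 0" by simp
  show "?c i = G i (?c (Suc i))" for i
  proof (cases "N \<le> i")
    case True then show ?thesis using assms by simp
  next
    case False
    then obtain k where k: "N - i = Suc k" by (metis Suc_diff_Suc not_le)
    then have "N - Suc i = k" "N - Suc k = i" using False by auto
    moreover have "d (Suc k) = G (N - Suc k) (d k)" "d 0 = 0" by (simp_all add: d_def)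
    ultimately show ?thesis using k False by (auto simp: not_less_eq_eq)
  qed
qed

text \<open>The inverse works from the last part to the first, so \<open>step_inj\<close> may use a
  common outgoing carry \<open>d\<close>. The bound in \<open>conserve\<close> keeps the subtraction
  in \<open>carry\<close> exact, and \<open>zero\<close> makes a carry die out behind the last
  part.\<close>

locale carry_rule =
  fixes g :: "nat \<Rightarrow> nat \<Rightarrow> nat \<Rightarrow> nat \<Rightarrow> nat" and E :: "nat set" and h v :: "nat \<Rightarrow> nat \<Rightarrow> bool"
  assumes conserve: "v r x \<Longrightarrow> h r y \<Longrightarrow> c \<in> E \<Longrightarrow>
      g r x y c + r \<le> c + x + y \<and> c + x + y - r - g r x y c \<in> E"
    and step_inj: "v r x \<Longrightarrow> h r y \<Longrightarrow> c \<in> E \<Longrightarrow> v r' x \<Longrightarrow> h r' y \<Longrightarrow> c' \<in> E \<Longrightarrow>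
      g r x y c = g r' x y c' \<Longrightarrow> d + r + g r x y c = c + x + y \<Longrightarrow>
      d + r' + g r' x y c' = c' + x + y \<Longrightarrow> r = r' \<and> c = c'"
    and zero: "g 0 0 0 0 = 0" "c \<in> E \<Longrightarrow> 0 < c \<Longrightarrow> 0 < g 0 0 0 c"
    and le: "h r y \<Longrightarrow> r \<le> y" "v r x \<Longrightarrow> r \<le> x"
begin

context
  fixes r l1 l2 :: "nat \<Rightarrow> nat" and m N :: nat
  assumes v: "\<And>i. v (r i) (l1 i)" and h: "\<And>i. h (r i) (l2 i)" and m: "m \<in> E"
    and N: "\<And>i. N \<le> i \<Longrightarrow> l1 i = 0" "\<And>i. N \<le> i \<Longrightarrow> l2 i = 0"
begin

lemma carry_in_E: "carry g r l1 l2 m i \<in> E"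
  by (induction i) (use m conserve v h in auto)

lemma carry_eq:
  "carry_label g r l1 l2 m i + r i + carry g r l1 l2 m (Suc i) = carry g r l1 l2 m i + l1 i + l2 i"
  using conserve[OF v[of i] h[of i] carry_in_E[of i]] by (simp add: carry_label_def)

text \<open>Behind the last parts of the two given labels, each nonzero carry deposits at least one
  box in a new part.\<close>

lemma carry_decreases: "carry g r l1 l2 m (N + k) \<le> carry g r l1 l2 m N - k"
proof (induction k)
  case (Suc k)
  let ?c = "carry g r l1 l2 m (N + k)"
  have z: "l1 (N + k) = 0" "l2 (N + k) = 0" "r (N + k) = 0" using N le(2)[OF v[of "N + k"]] by auto
  then have "carry g r l1 l2 m (N + Suc k) = ?c - g 0 0 0 ?c" by simp
  moreover have "?c - g 0 0 0 ?c \<le> ?c - 1" using zero(2)[OF carry_in_E[of "N + k"]] by (cases ?c) auto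
  ultimately show ?case using Suc by simp
qed simp

lemma carry_vanishes:
  obtains K where "N \<le> K" "\<And>i. K \<le> i \<Longrightarrow> carry g r l1 l2 m i = 0 \<and> carry_label g r l1 l2 m i = 0"
proof
  let ?K = "N + carry g r l1 l2 m N"
  show "N \<le> ?K" by simp
  fix i assume i: "?K \<le> i"
  then have "carry g r l1 l2 m i = 0" using carry_decreases[of "i - N"] by simp
  moreover have "l1 i = 0" "l2 i = 0" "r i = 0" using i N[of i] le(2)[OF v[of i]] by auto
  ultimately show "carry g r l1 l2 m i = 0 \<and> carry_label g r l1 l2 m i = 0"
    by (simp add: carry_label_def zero)
qed

lemma carry_psize: "psize (carry_label g r l1 l2 m) + psize r = psize l1 + psize l2 + m"
proof -
  obtain K where K: "N \<le> K" "\<And>i. K \<le> i \<Longrightarrow> carry g r l1 l2 m i = 0 \<and> carry_label g r l1 l2 m i = 0"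
    by (rule carry_vanishes) blast
  have "(\<Sum>i<k. carry_label g r l1 l2 m i) + (\<Sum>i<k. r i) + carry g r l1 l2 m k =
      (\<Sum>i<k. l1 i) + (\<Sum>i<k. l2 i) + m" for k
  proof (induction k)
    case (Suc k) then show ?case using carry_eq[of k] by (simp del: carry.simps)
  qed simp
  from this[of K] show ?thesis
    using K N le(2)[OF v] by (subst (1 2 3 4) psize_sum[of K]) (auto, metis le_0_eq le_trans)
qed

text \<open>Both carry sequences agree at some index behind the last parts; \<open>step_inj\<close>
  moves the agreement down to 0, part by part.\<close>

lemma carry_label_inj:
  assumes v': "\<And>i. v (r' i) (l1 i)" and h': "\<And>i. h (r' i) (l2 i)" and m': "m' \<in> E"
    and eq: "carry_label g r l1 l2 m = carry_label g r' l1 l2 m'"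
    and E': "\<And>i. carry g r' l1 l2 m' i \<in> E"
    and K: "carry g r l1 l2 m K = carry g r' l1 l2 m' K" "N \<le> K"
  shows "r = r' \<and> m = m'"
proof -
  have step: "r i = r' i \<and> carry g r l1 l2 m i = carry g r' l1 l2 m' i"
    if "carry g r l1 l2 m (Suc i) = carry g r' l1 l2 m' (Suc i)" for i
  proof (rule step_inj[OF v h carry_in_E v' h' E'])
    let ?c = "carry g r l1 l2 m i" and ?c' = "carry g r' l1 l2 m' i"
    show "g (r i) (l1 i) (l2 i) ?c = g (r' i) (l1 i) (l2 i) ?c'"
      using fun_cong[OF eq, of i] by (simp add: carry_label_def)
    show "carry g r l1 l2 m (Suc i) + r i + g (r i) (l1 i) (l2 i) ?c = ?c + l1 i + l2 i"
      using conserve[OF v[of i] h[of i] carry_in_E[of i]] by simp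
    show "carry g r l1 l2 m (Suc i) + r' i + g (r' i) (l1 i) (l2 i) ?c' = ?c' + l1 i + l2 i"
      unfolding that using conserve[OF v'[of i] h'[of i] E'[of i]] by simp
  qed
  have down: "carry g r l1 l2 m (K - k) = carry g r' l1 l2 m' (K - k)" for k
  proof (induction k)
    case (Suc k)
    show ?case
    proof (cases "k < K")
      case True
      then have "K - k = Suc (K - Suc k)" by simp
      with Suc step show ?thesis by metis
    qed (use Suc in auto)
  qed (use K in simp)
  have eqc: "carry g r l1 l2 m i = carry g r' l1 l2 m' i" if "i \<le> K" for i
    using that down[of "K - i"] by simp
  have "r i = r' i" for i
  proof (cases "i < K")
    case True then show ?thesis using step[of i] eqc[of "Suc i"] by simp
  next
    case False
    then show ?thesis using N(1)[of i] K(2) le(2)[OF v[of i]] le(2)[OF v'[of i]] by simp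
  qed
  then show ?thesis using eqc[of 0] by auto
qed

end

text \<open>What depends on the interplay of neighbouring parts is left to each rule: that the new
  label forms strips with its neighbours, and that the rule is onto.\<close>

lemma growthI:
  assumes H: "\<And>r l. H r l \<Longrightarrow> part r \<and> part l \<and> (\<forall>i. h (r i) (l i))"
    and V: "\<And>r l. V r l \<Longrightarrow> part r \<and> part l \<and> (\<forall>i. v (r i) (l i))"
    and Z: "H zero_part zero_part" "V zero_part zero_part"
    and rule_H: "\<And>r u w m. V r u \<Longrightarrow> H r w \<Longrightarrow> m \<in> E \<Longrightarrow> H u (carry_label g r u w m)"
    and rule_V: "\<And>r u w m. V r u \<Longrightarrow> H r w \<Longrightarrow> m \<in> E \<Longrightarrow> V w (carry_label g r u w m)"
    and surj: "\<And>u w l. H u l \<Longrightarrow> V w l \<Longrightarrow>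
      \<exists>r m. m \<in> E \<and> V r u \<and> H r w \<and> carry_label g r u w m = l"
  shows "growth E H V zero_part (carry_label g) psize"
proof
  show "r = zero_part" if "H r zero_part" for r
  proof
    fix i show "r i = zero_part i" using H[OF that] le(1)[of "r i" "zero_part i"] by (simp add: zero_part_def)
  qed
  show "r = zero_part" if "V r zero_part" for r
  proof
    fix i show "r i = zero_part i" using V[OF that] le(2)[of "r i" "zero_part i"] by (simp add: zero_part_def)
  qed
  show "psize (carry_label g r u w m) + psize r = psize u + psize w + m"
    if "V r u" "H r w" "m \<in> E" for r u w m
  proof -
    have "part u" "part w" using H[OF that(2)] V[OF that(1)] by auto
    then obtain N where "\<And>i. N \<le> i \<Longrightarrow> u i = 0" "\<And>i. N \<le> i \<Longrightarrow> w i = 0"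
      by (rule parts_eventually_0) blast
    then show ?thesis using H[OF that(2)] V[OF that(1)] that(3) by (intro carry_psize[of r u w m N]) auto
  qed
  show "r = r' \<and> m = m'" if a: "V r u" "H r w" "m \<in> E" "V r' u" "H r' w" "m' \<in> E"
    "carry_label g r u w m = carry_label g r' u w m'" for r u w m r' m'
  proof -
    have "part u" "part w" using H[OF a(2)] V[OF a(1)] by auto
    then obtain N where N: "\<And>i. N \<le> i \<Longrightarrow> u i = 0" "\<And>i. N \<le> i \<Longrightarrow> w i = 0"
      by (rule parts_eventually_0) blast
    note c = V[OF a(1)] H[OF a(2)] V[OF a(4)] H[OF a(5)] a(3,6) N
    obtain K1 where K1: "N \<le> K1" "\<And>i. K1 \<le> i \<Longrightarrow> carry g r u w m i = 0"
      by (rule carry_vanishes[of r u w m N]) (use c in auto)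
    obtain K2 where K2: "N \<le> K2" "\<And>i. K2 \<le> i \<Longrightarrow> carry g r' u w m' i = 0"
      by (rule carry_vanishes[of r' u w m' N]) (use c in auto)
    show ?thesis
      by (rule carry_label_inj[of r u w m N r' m' "max K1 K2"])
        (use c a(7) K1 K2 carry_in_E[of r' u w m' N] in auto)
  qed
qed (use assms in auto)

lemma carry_label_zero:
  assumes "\<And>i. v (r i) (u i)" "\<And>i. h (r i) (w i)" "m \<in> E" "part u" "part w"
  shows "\<exists>K. carry_label g r u w m K = 0"
proof -
  obtain N where N: "\<And>i. N \<le> i \<Longrightarrow> u i = 0" "\<And>i. N \<le> i \<Longrightarrow> w i = 0"
    by (rule parts_eventually_0[OF assms(4,5)]) blast
  show ?thesis
    by (rule carry_vanishes[of r u w m N]) (use assms N in auto)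
qed

end

text \<open>The local rules of RSK, of dual RSK, and of Burge's variant of RSK. The last one acts on the
  transposed labels, so that its carry runs through columns instead of rows.\<close>

definition rsk_rule :: "nat \<Rightarrow> nat \<Rightarrow> nat \<Rightarrow> nat \<Rightarrow> nat" where
  "rsk_rule r x y c = max x y + c"

definition dual_rule :: "nat \<Rightarrow> nat \<Rightarrow> nat \<Rightarrow> nat \<Rightarrow> nat" where
  "dual_rule r x y c = max x (y + c)"

definition burge_rule :: "nat \<Rightarrow> nat \<Rightarrow> nat \<Rightarrow> nat \<Rightarrow> nat" where
  "burge_rule r x y c = (if x = r \<and> y = r \<and> 0 < c then Suc r else max x y)"

interpretation rsk: carry_rule rsk_rule UNIV "(\<le>)" "(\<le>)"
  by unfold_locales (simp_all add: rsk_rule_def max_def split: if_splits)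

interpretation dual: carry_rule dual_rule "{0, 1}" "(\<le>)" "\<lambda>r l. r \<le> l \<and> l \<le> Suc r"
proof
  fix r x y c :: nat assume a: "r \<le> x \<and> x \<le> Suc r" "r \<le> y" "c \<in> {0, 1}"
  show "dual_rule r x y c + r \<le> c + x + y \<and> c + x + y - r - dual_rule r x y c \<in> {0, 1}"
  proof (cases "x \<le> y + c")
    case True
    then have "dual_rule r x y c = y + c" by (simp add: dual_rule_def)
    then show ?thesis using a by auto
  next
    case False
    then have "dual_rule r x y c = x" by (simp add: dual_rule_def)
    then show ?thesis using a False by auto
  qed
next
  fix r x y c r' c' d :: nat
  assume "r \<le> x \<and> x \<le> Suc r" "r \<le> y" "r' \<le> x \<and> x \<le> Suc r'" "r' \<le> y"
    "dual_rule r x y c = dual_rule r' x y c'" "d + r + dual_rule r x y c = c + x + y"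
    "d + r' + dual_rule r' x y c' = c' + x + y"
  then show "r = r' \<and> c = c'" unfolding dual_rule_def max_def by (simp split: if_splits)
qed (simp_all add: dual_rule_def)

interpretation burge: carry_rule burge_rule UNIV "\<lambda>r l. r \<le> l \<and> l \<le> Suc r" "\<lambda>r l. r \<le> l \<and> l \<le> Suc r"
proof
  fix r x y c :: nat assume a: "r \<le> x \<and> x \<le> Suc r" "r \<le> y \<and> y \<le> Suc r"
  show "burge_rule r x y c + r \<le> c + x + y \<and> c + x + y - r - burge_rule r x y c \<in> UNIV"
    using a by (auto simp: burge_rule_def max_def)
next
  fix r x y c r' c' d :: nat
  \<comment> \<open>With \<open>a < b\<close>, both \<open>x\<close> and \<open>y\<close> are
    squeezed to \<open>b = Suc a\<close>, and \<open>k'\<close> is positive. Then the rule gives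
    \<open>b\<close> for the corner \<open>a\<close>, but \<open>Suc b\<close> for the corner
    \<open>b\<close>.\<close>
  have wlog: False if "a < b" "a \<le> x" "x \<le> Suc a" "a \<le> y" "y \<le> Suc a" "b \<le> x" "b \<le> y"
    "burge_rule a x y k = burge_rule b x y k'" "a + k' = b + k" for a b k k' :: nat
  proof -
    have "x = Suc a" "y = Suc a" "b = Suc a" using that(1-7) by linarith+
    moreover from this have "0 < k'" using that(9) by simp
    ultimately show False using that(8) by (simp add: burge_rule_def)
  qed
  assume a: "r \<le> x \<and> x \<le> Suc r" "r \<le> y \<and> y \<le> Suc r" "r' \<le> x \<and> x \<le> Suc r'" "r' \<le> y \<and> y \<le> Suc r'"
    "burge_rule r x y c = burge_rule r' x y c'" "d + r + burge_rule r x y c = c + x + y"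
    "d + r' + burge_rule r' x y c' = c' + x + y"
  have e: "r + c' = r' + c" using a(5-7) by linarith
  have "\<not> r < r'" using wlog[of r r' c c'] a e by auto
  moreover have "\<not> r' < r" using wlog[of r' r c' c] a e by auto
  ultimately show "r = r' \<and> c = c'" using e by simp
qed (simp_all add: burge_rule_def)

section \<open>The three rules as bijections between strips\<close>

lemma growth_rsk: "growth UNIV hstrip hstrip zero_part (carry_label rsk_rule) psize"
proof (rule rsk.growthI)
  fix r u w :: "nat \<Rightarrow> nat" and m :: nat
  assume a: "hstrip r u" "hstrip r w" "m \<in> UNIV"
  then have p: "part r" "part u" "part w" and s: "\<And>i. r i \<le> u i" "\<And>i. u (Suc i) \<le> r i"
    "\<And>i. r i \<le> w i" "\<And>i. w (Suc i) \<le> r i"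
    by (auto simp: hstrip_def)
  let ?l = "carry_label rsk_rule r u w m"
  have ge: "u i \<le> ?l i" "w i \<le> ?l i" for i by (auto simp: carry_label_def rsk_rule_def)
  have up: "?l (Suc i) \<le> min (u i) (w i)" for i
    using s(1)[of i] s(2)[of i] s(3)[of i] s(4)[of i] by (auto simp: carry_label_def rsk_rule_def max_def min_def)
  obtain K where "?l K = 0" using rsk.carry_label_zero[of r u w m] s p by auto
  then have "part ?l" using ge up by (intro partI_between[of ?l u K]) auto
  then show "hstrip u ?l" "hstrip w ?l" using ge up p by (auto simp: hstrip_def)
next
  fix u w l assume a: "hstrip u l" "hstrip w l"
  then have p: "part u" "part w" "part l" and s: "\<And>i. u i \<le> l i" "\<And>i. l (Suc i) \<le> u i"
    "\<And>i. w i \<le> l i" "\<And>i. l (Suc i) \<le> w i"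
    by (auto simp: hstrip_def)
  \<comment> \<open>\<open>c i\<close> is the excess of \<open>l i\<close> over the maximum;
    conservation with this \<open>c\<close> then gives \<open>r i\<close> as the minimum less
    \<open>c (Suc i)\<close>.\<close>
  define r where "r i = min (u i) (w i) + max (u (Suc i)) (w (Suc i)) - l (Suc i)" for i
  define c where "c i = l i - max (u i) (w i)" for i
  have r: "r i \<le> u i" "r i \<le> w i" "u (Suc i) \<le> r i" "w (Suc i) \<le> r i" for i
    using s(1)[of "Suc i"] s(2)[of i] s(3)[of "Suc i"] s(4)[of i] by (auto simp: r_def max_def min_def)
  obtain K where "u K = 0" using p by (auto simp: part_def)
  then have "r K = 0" using r(1)[of K] by simp
  then have "part r" using r by (intro partI_between[of r "\<lambda>i. u (Suc i)" K]) auto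
  moreover have "carry_label rsk_rule r u w (c 0) = l"
  proof (rule carry_label_eqI)
    fix i
    show "rsk_rule (r i) (u i) (w i) (c i) = l i" using s(1)[of i] s(3)[of i] by (simp add: rsk_rule_def c_def)
    show "c (Suc i) + r i + l i = c i + u i + w i"
      using s(1)[of i] s(3)[of i] s(1)[of "Suc i"] s(2)[of i] s(3)[of "Suc i"] s(4)[of i]
      by (auto simp: r_def c_def max_def min_def)
  qed
  ultimately show "\<exists>r m. m \<in> UNIV \<and> hstrip r u \<and> hstrip r w \<and> carry_label rsk_rule r u w m = l"
    using r p by (intro exI[of _ r] exI[of _ "c 0"]) (auto simp: hstrip_def)
qed (auto simp: hstrip_def part_zero zero_part_def)

lemma growth_dual: "growth {0, 1} hstrip vstrip zero_part (carry_label dual_rule) psize"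
proof (rule dual.growthI)
  fix r u w :: "nat \<Rightarrow> nat" and m :: nat
  assume a: "vstrip r u" "hstrip r w" "m \<in> {0, 1}"
  then have p: "part r" "part u" "part w" and s: "\<And>i. r i \<le> u i" "\<And>i. u i \<le> Suc (r i)"
    "\<And>i. r i \<le> w i" "\<And>i. w (Suc i) \<le> r i"
    by (auto simp: hstrip_def vstrip_def)
  let ?l = "carry_label dual_rule r u w m"
  obtain N where N: "\<And>i. N \<le> i \<Longrightarrow> u i = 0" "\<And>i. N \<le> i \<Longrightarrow> w i = 0"
    by (rule parts_eventually_0[OF p(2,3)]) blast
  have cE: "carry dual_rule r u w m i \<in> {0, 1}" for i
    by (rule dual.carry_in_E[where N=N]) (use a s N in auto)
  have l1: "u i \<le> ?l i" "w i \<le> ?l i" "?l i \<le> Suc (w i)" for i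
    using cE[of i] s(2)[of i] s(3)[of i] by (auto simp: carry_label_def dual_rule_def)
  have l2: "?l (Suc i) \<le> u i" for i
    using cE[of i] s(1)[of i] s(2)[of i] s(3)[of i] s(4)[of i] part_antimono[OF p(2), of i "Suc i"]
    by (auto simp: carry_label_def dual_rule_def max_def)
  obtain K where "?l K = 0" using dual.carry_label_zero[of r u w m] s p a by auto
  then have "part ?l" using l1 l2 by (intro partI_between[of ?l u K]) auto
  then show "hstrip u ?l" "vstrip w ?l" using l1 l2 p by (auto simp: hstrip_def vstrip_def)
next
  fix u w l assume a: "hstrip u l" "vstrip w l"
  then have p: "part u" "part w" "part l" and s: "\<And>i. u i \<le> l i" "\<And>i. l (Suc i) \<le> u i"
    "\<And>i. w i \<le> l i" "\<And>i. l i \<le> Suc (w i)"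
    by (auto simp: hstrip_def vstrip_def)
  obtain N where N: "\<And>i. N \<le> i \<Longrightarrow> l i = 0" by (rule part_eventually_0[OF p(3)]) blast
  \<comment> \<open>If \<open>w i < u i\<close>, then \<open>l i = u i\<close> and
    \<open>r i = w i\<close> are forced, the value hides the carry, and the carry passes through
    unchanged. Otherwise the carry is visible as \<open>l i - w i\<close>.\<close>
  define G where "G i k = (if w i < u i then k else l i - w i)" for i k
  have G0: "G i 0 = 0" if "N \<le> i" for i using N[OF that] by (simp add: G_def)
  obtain c where c0: "\<And>i. N \<le> i \<Longrightarrow> c i = 0" and c: "\<And>i. c i = G i (c (Suc i))"
    using backward_recursion[of N G, OF G0] by blast
  define r where "r i = (if w i < u i then w i else u i - c (Suc i))" for i
  have cE: "c i \<le> 1" for i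
  proof (cases "N \<le> i")
    case False
    have "c (N - k) \<le> 1" for k
    proof (induction k)
      case (Suc k)
      show ?case
      proof (cases "k < N")
        case True
        then obtain j where j: "N - k = Suc j" "N - Suc k = j" by (metis Suc_diff_Suc)
        have "l j - w j \<le> 1" using s(4)[of j] by linarith
        then show ?thesis using Suc c[of j] unfolding j by (auto simp: G_def)
      qed (use Suc in auto)
    qed (simp add: c0)
    from this[of "N - i"] False show ?thesis by simp
  qed (simp add: c0)
  \<comment> \<open>Where \<open>r i\<close> is obtained by subtracting a carry, this makes the
    subtraction exact and keeps \<open>r i\<close> at or above \<open>w (Suc i)\<close>, as the
    horizontal strip requires.\<close>
  have key: "w (Suc i) + c (Suc i) \<le> u i" for i
  proof (cases "w (Suc i) < u (Suc i)")
    case True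
    then show ?thesis using cE[of "Suc i"] part_antimono[OF p(1), of i "Suc i"] by simp
  next
    case False
    then show ?thesis using c[of "Suc i"] s(2)[of i] s(3)[of "Suc i"] by (simp add: G_def)
  qed
  have r: "r i \<le> u i" "u i \<le> Suc (r i)" "r i \<le> w i" "w (Suc i) \<le> r i" for i
    using key[of i] cE[of "Suc i"] s(1)[of i] s(4)[of i] part_antimono[OF p(2), of i "Suc i"]
    by (auto simp: r_def)
  obtain K where "w K = 0" using p by (auto simp: part_def)
  then have "r K = 0" using r(3)[of K] by simp
  then have "part r" using r by (intro partI_between[of r "\<lambda>i. w (Suc i)" K]) auto
  moreover have "carry_label dual_rule r u w (c 0) = l"
  proof (rule carry_label_eqI)
    fix i
    show "dual_rule (r i) (u i) (w i) (c i) = l i"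
      using s(1)[of i] s(3)[of i] s(4)[of i] cE[of i] c[of i]
      by (auto simp: dual_rule_def G_def max_def split: if_splits)
    show "c (Suc i) + r i + l i = c i + u i + w i"
      using s(1)[of i] s(3)[of i] s(4)[of i] key[of i] c[of i]
      by (auto simp: r_def G_def)
  qed
  moreover have "c 0 \<in> {0, 1}" using cE[of 0] by auto
  ultimately show "\<exists>r m. m \<in> {0, 1} \<and> vstrip r u \<and> hstrip r w \<and> carry_label dual_rule r u w m = l"
    using r p by (intro exI[of _ r] exI[of _ "c 0"]) (auto simp: hstrip_def vstrip_def)
qed (auto simp: hstrip_def vstrip_def part_zero zero_part_def)

text \<open>Recovers the corner \<open>r\<close> and the incoming carry \<open>c\<close> from the
  outgoing carry \<open>d\<close>. Distinct \<open>x\<close> and \<open>y\<close> leave the carry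
  alone. If \<open>x = y\<close>, a larger \<open>l\<close> shows that a unit of the carry was used
  up; an equal \<open>l\<close> with \<open>0 < d\<close> shows that a unit was gained, because both
  neighbours had grown beyond \<open>r\<close>.\<close>

lemma burge_rule_inverse:
  assumes l: "x \<le> l" "l \<le> Suc x" "y \<le> l" "l \<le> Suc y" and pos: "l = x \<Longrightarrow> 0 < d \<Longrightarrow> 0 < x"
    and c: "c = (if x \<noteq> y then d else if l = x then d - 1 else Suc d)"
    and r: "r = (if x \<noteq> y then min x y else if l = x \<and> 0 < d then x - 1 else x)"
  shows "burge_rule r x y c = l \<and> d + r + l = c + x + y"
proof (cases "x = y")
  case True
  show ?thesis
  proof (cases "l = x")
    case eq: True
    then show ?thesis using True pos c r by (cases "0 < d") (auto simp: burge_rule_def)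
  next
    case False
    then have "l = Suc x" using l by simp
    then show ?thesis using True c r by (simp add: burge_rule_def)
  qed
next
  case False
  then have "l = max x y" using l by auto
  then show ?thesis using False c r by (auto simp: burge_rule_def min_def max_def)
qed

lemma growth_burge: "growth UNIV vstrip vstrip zero_part (carry_label burge_rule) psize"
proof (rule burge.growthI)
  fix r u w :: "nat \<Rightarrow> nat" and m :: nat
  assume a: "vstrip r u" "vstrip r w" "m \<in> UNIV"
  then have p: "part r" "part u" "part w" and s: "\<And>i. r i \<le> u i" "\<And>i. u i \<le> Suc (r i)"
    "\<And>i. r i \<le> w i" "\<And>i. w i \<le> Suc (r i)"
    by (auto simp: vstrip_def)
  let ?l = "carry_label burge_rule r u w m" and ?c = "carry burge_rule r u w m"
  have l: "u i \<le> ?l i" "?l i \<le> Suc (u i)" "w i \<le> ?l i" "?l i \<le> Suc (w i)" for i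
    using s(1)[of i] s(2)[of i] s(3)[of i] s(4)[of i]
    by (auto simp: carry_label_def burge_rule_def max_def)
  \<comment> \<open>If part \<open>Suc i\<close> exceeded part \<open>i\<close>, it would have used
    a carry to rise above the common value \<open>x\<close> of \<open>u\<close> and \<open>w\<close>
    in both parts. But part \<open>i\<close> stays at \<open>r i = u i = w i = x\<close>, so its
    carry is 0 and it passes none on.\<close>
  have dec: "?l (Suc i) \<le> ?l i" for i
  proof (rule ccontr)
    assume "\<not> ?l (Suc i) \<le> ?l i"
    moreover define x where "x = ?l i"
    ultimately have eqs: "u i = x" "w i = x" "u (Suc i) = x" "w (Suc i) = x" "?l (Suc i) = Suc x"
      using l(1)[of i] l(3)[of i] l(2)[of "Suc i"] l(4)[of "Suc i"]
        part_antimono[OF p(2), of i "Suc i"] part_antimono[OF p(3), of i "Suc i"] by linarith+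
    have "burge_rule (r (Suc i)) x x (?c (Suc i)) = Suc x"
      using eqs unfolding carry_label_def by metis
    then have r': "r (Suc i) = x" and c': "0 < ?c (Suc i)"
      by (auto simp: burge_rule_def simp del: carry.simps split: if_splits)
    then have r: "r i = x" using part_antimono[OF p(1), of i "Suc i"] s(1)[of i] eqs by simp
    have "burge_rule x x x (?c i) = x"
      using eqs(1,2) r x_def unfolding carry_label_def by metis
    then have "?c i = 0" by (auto simp: burge_rule_def split: if_splits)
    then have "?c (Suc i) = 0" using eqs(1,2) r by (simp add: burge_rule_def)
    with c' show False by simp
  qed
  obtain K where "?l K = 0" using burge.carry_label_zero[of r u w m] s p by auto
  then have "part ?l" using dec by (intro partI[of _ K])
  then show "vstrip u ?l" "vstrip w ?l" using l p by (auto simp: vstrip_def)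
next
  fix u w l assume a: "vstrip u l" "vstrip w l"
  then have p: "part u" "part w" "part l" and s: "\<And>i. u i \<le> l i" "\<And>i. l i \<le> Suc (u i)"
    "\<And>i. w i \<le> l i" "\<And>i. l i \<le> Suc (w i)"
    by (auto simp: vstrip_def)
  obtain N0 where N0: "l N0 = 0" using p by (auto simp: part_def)
  \<comment> \<open>The least zero of \<open>l\<close>: all earlier parts are positive, and from
    there on carries vanish. Hence \<open>u i - 1\<close> is exact wherever a positive carry leaves
    a part with \<open>l i = u i\<close>.\<close>
  define N where "N = (LEAST i. l i = 0)"
  have lN: "l N = 0" unfolding N_def using N0 by (rule LeastI)
  have N: "l i = 0" if "N \<le> i" for i using part_antimono[OF p(3) that] lN by simp
  have uw: "u i = 0" "w i = 0" "l i = 0" if "N \<le> i" for i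
    using N[OF that] s(1)[of i] s(3)[of i] by simp_all
  have below_N: "0 < l i" if "i < N" for i using not_less_Least[of i "\<lambda>i. l i = 0"] that by (auto simp: N_def)
  define G where "G i k = (if u i \<noteq> w i then k else if l i = u i then k - 1 else Suc k)" for i k
  have G0: "G i 0 = 0" if "N \<le> i" for i using uw[OF that] by (simp add: G_def)
  obtain c where c0: "\<And>i. N \<le> i \<Longrightarrow> c i = 0" and c: "\<And>i. c i = G i (c (Suc i))"
    using backward_recursion[of N G, OF G0] by blast
  define r where "r i = (if u i \<noteq> w i then min (u i) (w i)
    else if l i = u i \<and> 0 < c (Suc i) then u i - 1 else u i)" for i
  have r: "r i \<le> u i" "u i \<le> Suc (r i)" "r i \<le> w i" "w i \<le> Suc (r i)" for i
    using s(1)[of i] s(2)[of i] s(3)[of i] s(4)[of i] by (auto simp: r_def)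
  have pos: "0 < u i" if "l i = u i" "0 < c (Suc i)" for i
    using below_N[of i] that c0[of "Suc i"] by (cases "i < N") auto
  \<comment> \<open>A violation forces the value \<open>Suc x\<close> on \<open>u\<close> and
    \<open>w\<close> in both parts and, by the case of \<open>r i\<close> that subtracts 1,
    \<open>0 < c (Suc i)\<close>. But part \<open>Suc i\<close> keeps its value without subtracting,
    so \<open>c (Suc (Suc i)) = 0\<close>, and then \<open>c (Suc i) = 0\<close>.\<close>
  have dec: "r (Suc i) \<le> r i" for i
  proof (rule ccontr)
    assume "\<not> r (Suc i) \<le> r i"
    moreover define x where "x = r i"
    ultimately have eqs: "u i = Suc x" "w i = Suc x" "u (Suc i) = Suc x" "w (Suc i) = Suc x"
      "r (Suc i) = Suc x"
      using r(1)[of "Suc i"] r(3)[of "Suc i"] r(2)[of i] r(4)[of i]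
        part_antimono[OF p(1), of i "Suc i"] part_antimono[OF p(2), of i "Suc i"] by linarith+
    have li: "l i = Suc x" "0 < c (Suc i)"
      using r_def[of i] eqs(1,2) x_def by (auto split: if_splits)
    then have l': "l (Suc i) = Suc x"
      using part_antimono[OF p(3), of i "Suc i"] s(1)[of "Suc i"] eqs by simp
    have "c (Suc (Suc i)) = 0" using r_def[of "Suc i"] eqs(3-5) l' by (auto split: if_splits)
    then have "c (Suc i) = 0" using c[of "Suc i"] eqs(3,4) l' by (simp add: G_def)
    with li show False by simp
  qed
  obtain K where "u K = 0" using p by (auto simp: part_def)
  then have "r K = 0" using r(1)[of K] by simp
  then have "part r" using dec by (intro partI[of _ K])
  moreover have "carry_label burge_rule r u w (c 0) = l"
  proof (rule carry_label_eqI)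
    fix i
    have "burge_rule (r i) (u i) (w i) (c i) = l i \<and> c (Suc i) + r i + l i = c i + u i + w i"
      by (rule burge_rule_inverse[OF s(1)[of i] s(2)[of i] s(3)[of i] s(4)[of i] pos[of i]
          c[of i, unfolded G_def] r_def[of i]])
    then show "burge_rule (r i) (u i) (w i) (c i) = l i" "c (Suc i) + r i + l i = c i + u i + w i"
      by simp_all
  qed
  ultimately show "\<exists>r m. m \<in> UNIV \<and> vstrip r u \<and> vstrip r w \<and> carry_label burge_rule r u w m = l"
    using r p by (intro exI[of _ r] exI[of _ "c 0"]) (auto simp: vstrip_def)
qed (auto simp: vstrip_def part_zero zero_part_def)

section \<open>Transposition\<close>

text \<open>The arguments \<open>u\<close> and \<open>v\<close> are swapped because the diagram is
  reflected in the diagonal, which turns horizontal edges into vertical ones; this is why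
  \<open>H'\<close> comes from \<open>V\<close> and \<open>V'\<close> from \<open>H\<close>.\<close>

lemma growth_transpose:
  assumes g: "growth E H V zero_part \<phi> psize"
    and H: "\<And>r l. H r l \<Longrightarrow> part r \<and> part l" and V: "\<And>r l. V r l \<Longrightarrow> part r \<and> part l"
    and H': "\<And>r l. H' r l \<longleftrightarrow> part r \<and> part l \<and> V (conj_part r) (conj_part l)"
    and V': "\<And>r l. V' r l \<longleftrightarrow> part r \<and> part l \<and> H (conj_part r) (conj_part l)"
  shows "growth E H' V' zero_part
    (\<lambda>r u v m. conj_part (\<phi> (conj_part r) (conj_part v) (conj_part u) m)) psize"
proof -
  interpret growth E H V zero_part \<phi> psize by (rule g)
  let ?\<phi> = "\<lambda>r u v m. conj_part (\<phi> (conj_part r) (conj_part v) (conj_part u) m)"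
  show ?thesis
  proof
    show "H' zero_part zero_part" "V' zero_part zero_part"
      using H_Z V_Z by (simp_all add: H' V' part_zero conj_zero)
    show "r = zero_part" if "H' r zero_part" for r
      using that V_Z_left[of "conj_part r"] conj_conj[of r] by (auto simp: H' conj_zero)
    show "r = zero_part" if "V' r zero_part" for r
      using that H_Z_left[of "conj_part r"] conj_conj[of r] by (auto simp: V' conj_zero)
  next
    fix r u v m assume a: "V' r u" "H' r v" "m \<in> E"
    then have b: "V (conj_part r) (conj_part v)" "H (conj_part r) (conj_part u)" "part r" "part u" "part v"
      by (auto simp: H' V')
    note hv = rule_H[OF b(1,2) a(3)] rule_V[OF b(1,2) a(3)]
    then have p: "part (\<phi> (conj_part r) (conj_part v) (conj_part u) m)" using H by blast
    then show "H' u (?\<phi> r u v m)" "V' v (?\<phi> r u v m)"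
      using hv b by (simp_all add: H' V' part_conj conj_conj)
    show "psize (?\<phi> r u v m) + psize r = psize u + psize v + m"
      using rule_size[OF b(1,2) a(3)] b p by (simp add: psize_conj)
    fix r' m' assume a': "V' r' u" "H' r' v" "m' \<in> E" "?\<phi> r u v m = ?\<phi> r' u v m'"
    then have b': "V (conj_part r') (conj_part v)" "H (conj_part r') (conj_part u)" "part r'"
      by (auto simp: H' V')
    have "part (\<phi> (conj_part r') (conj_part v) (conj_part u) m')"
      using H[OF rule_H[OF b'(1,2) a'(3)]] by blast
    with p a'(4) have "\<phi> (conj_part r) (conj_part v) (conj_part u) m =
        \<phi> (conj_part r') (conj_part v) (conj_part u) m'" by (metis conj_conj)
    from rule_inj[OF b(1,2) a(3) b'(1,2) a'(3) this] show "r = r' \<and> m = m'"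
      using b(3) b'(3) by (metis conj_conj)
  next
    fix u l v assume "H' u l" "V' v l"
    then have b: "V (conj_part u) (conj_part l)" "H (conj_part v) (conj_part l)" "part u" "part v" "part l"
      by (auto simp: H' V')
    obtain r m where r: "m \<in> E" "V r (conj_part v)" "H r (conj_part u)"
      "\<phi> r (conj_part v) (conj_part u) m = conj_part l"
      using rule_surj[OF b(2,1)] by blast
    then have "part r" using H by blast
    with r b show "\<exists>r m. m \<in> E \<and> V' r u \<and> H' r v \<and> ?\<phi> r u v m = l"
      by (intro exI[of _ "conj_part r"] exI[of _ m]) (simp add: H' V' part_conj conj_conj)
  qed
qed

lemma (in growth) lab_steps_all:
  assumes "\<And>c. f c \<in> E"
  shows "H (lab f p q) (lab f (Suc p) q)" "V (lab f p q) (lab f p (Suc q))"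
proof -
  have "down_shape (rect (Suc p) (Suc q))"
    by (auto simp: down_shape_def rect_def)
  from lab_steps[OF this, of f p q] assms
  have "(q = 0 \<or> (Suc p, q) \<in> rect (Suc p) (Suc q) \<longrightarrow> H (lab f p q) (lab f (Suc p) q)) \<and>
    (p = 0 \<or> (p, Suc q) \<in> rect (Suc p) (Suc q) \<longrightarrow> V (lab f p q) (lab f p (Suc q)))"
    by (simp add: corners_def)
  then show "H (lab f p q) (lab f (Suc p) q)" "V (lab f p q) (lab f p (Suc q))"
    by (cases q; cases p; simp add: H_Z V_Z)+
qed

lemma grow_transpose:
  assumes g: "growth E H V zero_part \<phi> psize" and H: "\<And>r l. H r l \<Longrightarrow> part r \<and> part l"
    and f: "\<And>c. f c \<in> E"
  shows "grow (\<lambda>r u v m. conj_part (\<phi> (conj_part r) (conj_part v) (conj_part u) m)) zero_part f p q =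
    conj_part (grow \<phi> zero_part (\<lambda>c. f (prod.swap c)) q p)" (is "grow ?\<phi> _ _ _ _ = _")
proof -
  have p: "part (grow \<phi> zero_part (\<lambda>c. f (prod.swap c)) p q)" for p q
    using H growth.lab_steps_all(1)[OF g, of "\<lambda>c. f (prod.swap c)" p q] f by auto
  show ?thesis
  proof (induction p arbitrary: q)
    case (Suc p)
    note IH = Suc
    show ?case
    proof (induction q)
      case (Suc q)
      then show ?case by (simp add: IH conj_conj p)
    qed (simp add: conj_zero)
  qed (simp add: conj_zero)
qed

section \<open>First parts of the labels\<close>

lemma carry_label_0: "carry_label g r u v m 0 = g (r 0) (u 0) (v 0) m"
  by (simp add: carry_label_def)

text \<open>Part 0 of a label depends only on the parts 0 of its neighbours, so the first parts form
  a growth diagram of numbers, grown by \<open>g\<close> itself.\<close>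

lemma grow_carry_label_0: "grow (carry_label g) zero_part f p q 0 = grow g 0 f p q"
proof (induction p arbitrary: q)
  case (Suc p)
  note IH = Suc
  show ?case
  proof (induction q)
    case (Suc q)
    then show ?case by (simp add: IH carry_label_0)
  qed (simp add: zero_part_def)
qed (simp add: zero_part_def)

text \<open>The carries out of the first part form a filling whose labels are the labels of \<open>f\<close> without
  their first part.\<close>

definition peel :: "(nat \<Rightarrow> nat \<Rightarrow> nat \<Rightarrow> nat \<Rightarrow> nat) \<Rightarrow> (cell \<Rightarrow> nat) \<Rightarrow> cell \<Rightarrow> nat" where
  "peel g f = (\<lambda>(p, q). f (p, q) + grow g 0 f (p - 1) q + grow g 0 f p (q - 1)
     - grow g 0 f (p - 1) (q - 1) - grow g 0 f p q)"

lemma carry_Suc: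
  "carry g r u v m (Suc i) =
     carry g (\<lambda>i. r (Suc i)) (\<lambda>i. u (Suc i)) (\<lambda>i. v (Suc i)) (carry g r u v m 1) i"
  by (induction i) simp_all

lemma carry_label_Suc:
  "carry_label g r u v m (Suc i) =
     carry_label g (\<lambda>i. r (Suc i)) (\<lambda>i. u (Suc i)) (\<lambda>i. v (Suc i)) (carry g r u v m 1) i"
  unfolding carry_label_def carry_Suc by (rule refl)

lemma grow_carry_label_Suc:
  "(\<lambda>i. grow (carry_label g) zero_part f p q (Suc i)) = grow (carry_label g) zero_part (peel g f) p q"
proof (induction p arbitrary: q)
  case (Suc p)
  note IH = Suc
  show ?case
  proof (induction q)
    case (Suc q)
    let ?l = "grow (carry_label g) zero_part f"
    have m: "carry g (?l p q) (?l p (Suc q)) (?l (Suc p) q) (f (Suc p, Suc q)) 1 = peel g f (Suc p, Suc q)"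
      by (simp add: peel_def grow_carry_label_0)
    have "(\<lambda>i. ?l (Suc p) (Suc q) (Suc i)) = carry_label g (\<lambda>i. ?l p q (Suc i)) (\<lambda>i. ?l p (Suc q) (Suc i))
        (\<lambda>i. ?l (Suc p) q (Suc i)) (peel g f (Suc p, Suc q))"
      unfolding m[symmetric] grow.simps(3) carry_label_Suc[symmetric] ..
    then show ?case unfolding IH Suc by simp
  qed (simp add: zero_part_def fun_eq_iff)
qed (simp add: zero_part_def fun_eq_iff)

lemma chain_bound_0_iff:
  "chain_bound R w S 0 \<longleftrightarrow> (\<forall>c\<in>S. w c = 0)"
proof
  assume "chain_bound R w S 0"
  from chain_boundD[OF this, of "[c]" for c] show "\<forall>c\<in>S. w c = 0" by auto
next
  assume "\<forall>c\<in>S. w c = 0"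
  then show "chain_bound R w S 0" by (intro chain_boundI_support) auto
qed

text \<open>A discrete intermediate value argument, used to find where a row or column enters a
  level set of the first parts.\<close>

lemma crossing:
  fixes k :: "nat \<Rightarrow> nat"
  assumes "k lo < v" "v \<le> k hi" "lo \<le> hi"
  obtains i where "lo \<le> i" "i < hi" "k i < v" "v \<le> k (Suc i)"
proof -
  define j where "j = (LEAST j. lo \<le> j \<and> v \<le> k j)"
  have j: "lo \<le> j \<and> v \<le> k j" unfolding j_def by (rule LeastI[of _ hi]) (use assms in auto)
  have le: "j \<le> hi" unfolding j_def by (rule Least_le) (use assms in auto)
  have "lo < j" using j assms(1) by (metis le_neq_implies_less not_le)
  then obtain i where i: "j = Suc i" "lo \<le> i" by (cases j) auto
  have "\<not> (lo \<le> i \<and> v \<le> k i)" using not_less_Least[of i "\<lambda>j. lo \<le> j \<and> v \<le> k j"] i(1) by (simp add: j_def)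
  with i j le show ?thesis by (intro that[of i]) auto
qed

text \<open>What the three rules share on first parts: the regions \<open>L >= v\<close> are closed
  upwards and to the right, and without an entry a label does not rise above both of its
  neighbours.\<close>

locale row_rule =
  fixes g :: "nat \<Rightarrow> nat \<Rightarrow> nat \<Rightarrow> nat \<Rightarrow> nat"
  assumes ge_left: "x \<le> g r x y c" and ge_right: "y \<le> g r x y c"
    and no_entry: "g r x y 0 = max x y"
    and entry_pos: "0 < c \<Longrightarrow> r \<le> x \<Longrightarrow> r \<le> y \<Longrightarrow> 0 < g r x y c"
begin

abbreviation "L \<equiv> grow g 0"

lemma L_mono:
  assumes "p \<le> p'" "q \<le> q'"
  shows "L f p q \<le> L f p' q'"
proof -
  have "L f p q \<le> L f (Suc p) q" "L f p q \<le> L f p (Suc q)" for p q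
    by (cases q; simp add: ge_left) (cases p; simp add: ge_right)
  then have "L f p q \<le> L f p' q" "L f p' q \<le> L f p' q'"
    using assms lift_Suc_mono_le[of "\<lambda>p. L f p q"] lift_Suc_mono_le[of "L f p'"] by blast+
  then show ?thesis by simp
qed

text \<open>Such a cell is a lower left corner of the region \<open>L >= v\<close>: shadow lines
  turn outwards only at entries.\<close>

lemma outer_corner:
  "L f a (Suc b) < v \<Longrightarrow> L f (Suc a) b < v \<Longrightarrow> v \<le> L f (Suc a) (Suc b) \<Longrightarrow> f (Suc a, Suc b) \<noteq> 0"
  by (rule ccontr) (simp add: no_entry)

lemma L_eq_0_iff: "L f p q = 0 \<longleftrightarrow> (\<forall>c\<in>rect p q. f c = 0)"
proof
  assume z: "L f p q = 0"
  show "\<forall>c\<in>rect p q. f c = 0"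
  proof clarify
    fix x y assume xy: "(x, y) \<in> rect p q"
    then obtain a b where ab: "x = Suc a" "y = Suc b" by (cases x; cases y) auto
    have "L f (Suc a) (Suc b) = 0" using L_mono[of "Suc a" p "Suc b" q f] xy ab z by simp
    then show "f (x, y) = 0"
      using entry_pos[of "f (x, y)" "L f a b" "L f a (Suc b)" "L f (Suc a) b"] ab
        L_mono[of a a b "Suc b" f] L_mono[of a "Suc a" b b f] by (cases "f (x, y)") auto
  qed
next
  assume "\<forall>c\<in>rect p q. f c = 0"
  then have "L f p q = L (\<lambda>_. 0) p q" by (intro grow_cong) auto
  also have "L (\<lambda>_. 0) p q = 0" for p q
  proof (induction p arbitrary: q)
    case (Suc p)
    note IH = Suc
    show ?case by (induction q) (simp_all add: IH no_entry)
  qed simp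
  finally show "L f p q = 0" .
qed

text \<open>Peeling shifts the labels by one part and lowers the bound by one, until
  \<open>k = 0\<close> asks for a filling without nonzero entries. \<open>E\<close> is stable under
  peeling, so the hypothesis applies again at each stage.\<close>

lemma part_0_iff_chain_bound:
  assumes peel: "\<And>f k. \<forall>c. f c \<in> E \<Longrightarrow>
      chain_bound R (w f) (rect p q) (Suc k) \<longleftrightarrow> chain_bound R (w (peel g f)) (rect p q) k"
    and E: "\<And>f c. \<forall>c. f c \<in> E \<Longrightarrow> peel g f c \<in> E"
    and w: "\<And>f c. w f c = 0 \<longleftrightarrow> f c = 0" and f: "\<forall>c. f c \<in> E"
  shows "grow (carry_label g) zero_part f p q k = 0 \<longleftrightarrow> chain_bound R (w f) (rect p q) k"
  using f
proof (induction k arbitrary: f)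
  case 0
  then show ?case by (simp add: grow_carry_label_0 L_eq_0_iff chain_bound_0_iff w)
next
  case (Suc k)
  have "grow (carry_label g) zero_part f p q (Suc k) = grow (carry_label g) zero_part (peel g f) p q k"
    using fun_cong[OF grow_carry_label_Suc, of g f p q k] .
  then show ?case using Suc.IH[of "peel g f"] E[OF Suc.prems] peel[OF Suc.prems] by simp
qed

text \<open>A recursion for longest chains. A chain that does not end in the upper right cell lies
  in one of two smaller rectangles; \<open>append\<close> bounds the chains that do end there, and
  \<open>attain\<close> provides a chain with equality.\<close>

lemma chain_bound_iff_L_le:
  assumes R: "ne_chain_order R"
    and append: "\<And>p q ds. sorted_wrt (strict R) (ds @ [(Suc p, Suc q)]) \<Longrightarrow> set ds \<subseteq> rect (Suc p) (Suc q) \<Longrightarrow>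
      chain_bound R w (rect p q) (L f p q) \<Longrightarrow> chain_bound R w (rect p (Suc q)) (L f p (Suc q)) \<Longrightarrow>
      chain_bound R w (rect (Suc p) q) (L f (Suc p) q) \<Longrightarrow>
      (\<Sum>c\<leftarrow>ds. w c) + w (Suc p, Suc q) \<le> L f (Suc p) (Suc q)"
    and attain: "\<And>p q. L f (Suc p) (Suc q) = L f p (Suc q) \<or> L f (Suc p) (Suc q) = L f (Suc p) q \<or>
      (\<exists>x\<le>Suc p. \<exists>y\<le>Suc q. (x, y) \<noteq> (Suc p, Suc q) \<and> (\<forall>c\<in>rect x y. strict R c (Suc p, Suc q)) \<and>
        L f (Suc p) (Suc q) = L f x y + w (Suc p, Suc q))"
  shows "chain_bound R w (rect p q) k \<longleftrightarrow> L f p q \<le> k"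
proof -
  have "chain_bound R w (rect p q) (L f p q) \<and>
    (\<exists>cs. sorted_wrt (strict R) cs \<and> set cs \<subseteq> rect p q \<and> (\<Sum>c\<leftarrow>cs. w c) = L f p q)"
  proof (induction "p + q" arbitrary: p q rule: less_induct)
    case less
    show ?case
    proof (cases "p = 0 \<or> q = 0")
      case True
      then have "rect p q = {}" "L f p q = 0" by (auto simp: rect_def)
      then show ?thesis by (auto simp: chain_bound_def intro: exI[of _ "[]"])
    next
      case False
      then obtain a b where ab: "p = Suc a" "q = Suc b" by (metis not0_implies_Suc)
      note IH = less[of a b] less[of a "Suc b"] less[of "Suc a" b]
      have "(\<Sum>c\<leftarrow>cs. w c) \<le> L f p q" if cs: "sorted_wrt (strict R) cs" "set cs \<subseteq> rect p q" for cs
      proof (cases cs rule: rev_cases)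
        case (snoc ds d)
        obtain x y where d: "d = (x, y)" by fastforce
        have ds: "down_shape (rect p q)" by (auto simp: down_shape_def rect_def)
        have sub: "set cs \<subseteq> rect x y"
          using ne_chain_in_rect[OF R, of ds x y "rect p q"] cs snoc d ds by simp
        have xy: "x \<le> p" "y \<le> q" using cs snoc d by auto
        consider "x \<le> a" | "y \<le> b" | "x = Suc a" "y = Suc b" using xy ab by linarith
        then show ?thesis
        proof cases
          case 1
          then have "(\<Sum>c\<leftarrow>cs. w c) \<le> L f a (Suc b)"
            using IH(2) ab chain_boundD[OF _ cs(1)] sub rect_mono[of x a y "Suc b"] xy by auto
          then show ?thesis using L_mono[of a p "Suc b" q f] ab by simp
        next
          case 2
          then have "(\<Sum>c\<leftarrow>cs. w c) \<le> L f (Suc a) b"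
            using IH(3) ab chain_boundD[OF _ cs(1)] sub rect_mono[of x "Suc a" y b] xy by auto
          then show ?thesis using L_mono[of "Suc a" p b q f] ab by simp
        next
          case 3
          then show ?thesis using append[of ds a b] IH cs snoc d ab by simp
        qed
      qed simp
      then have 1: "chain_bound R w (rect p q) (L f p q)" by (simp add: chain_bound_def)
      have "\<exists>cs. sorted_wrt (strict R) cs \<and> set cs \<subseteq> rect p q \<and> (\<Sum>c\<leftarrow>cs. w c) = L f p q"
      proof -
        consider (l) "L f p q = L f a (Suc b)" | (r) "L f p q = L f (Suc a) b"
          | (c) x y where "x \<le> Suc a" "y \<le> Suc b" "(x, y) \<noteq> (Suc a, Suc b)"
            "\<forall>c\<in>rect x y. strict R c (Suc a, Suc b)"
            "L f p q = L f x y + w (Suc a, Suc b)"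
          using attain[of a b] ab by blast
        then show ?thesis
        proof cases
          case l
          obtain cs where "sorted_wrt (strict R) cs" "set cs \<subseteq> rect a (Suc b)" "(\<Sum>c\<leftarrow>cs. w c) = L f p q"
            using IH(2) ab l by auto
          moreover have "rect a (Suc b) \<subseteq> rect p q" using ab by (intro rect_mono) auto
          ultimately show ?thesis by blast
        next
          case r
          obtain cs where "sorted_wrt (strict R) cs" "set cs \<subseteq> rect (Suc a) b" "(\<Sum>c\<leftarrow>cs. w c) = L f p q"
            using IH(3) ab r by auto
          moreover have "rect (Suc a) b \<subseteq> rect p q" using ab by (intro rect_mono) auto
          ultimately show ?thesis by blast
        next
          case c
          have "x + y < p + q" using c(1-3) ab by (auto simp: le_less)
          then obtain cs where cs: "sorted_wrt (strict R) cs" "set cs \<subseteq> rect x y" "(\<Sum>c\<leftarrow>cs. w c) = L f x y"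
            using less by blast
          have "rect x y \<subseteq> rect p q" using ab c by (intro rect_mono) auto
          then have "sorted_wrt (strict R) (cs @ [(Suc a, Suc b)]) \<and> set (cs @ [(Suc a, Suc b)]) \<subseteq> rect p q \<and>
              (\<Sum>c\<leftarrow>cs @ [(Suc a, Suc b)]. w c) = L f p q"
            using cs c ab by (auto simp: sorted_wrt_append)
          then show ?thesis by blast
        qed
      qed
      with 1 show ?thesis by blast
    qed
  qed
  then obtain cs where "chain_bound R w (rect p q) (L f p q)"
    and cs: "sorted_wrt (strict R) cs" "set cs \<subseteq> rect p q" "(\<Sum>c\<leftarrow>cs. w c) = L f p q" by blast
  show ?thesis
  proof
    assume "chain_bound R w (rect p q) k"
    from chain_boundD[OF this cs(1,2)] cs(3) show "L f p q \<le> k" by simp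
  next
    assume "L f p q \<le> k"
    with \<open>chain_bound R w (rect p q) (L f p q)\<close> show "chain_bound R w (rect p q) k"
      unfolding chain_bound_def by (meson le_trans)
  qed
qed

end

section \<open>Longest chains as first parts for the three rules\<close>

interpretation rsk_row: row_rule rsk_rule
  by unfold_locales (auto simp: rsk_rule_def)

interpretation dual_row: row_rule dual_rule
  by unfold_locales (auto simp: dual_rule_def)

interpretation burge_row: row_rule burge_rule
  by unfold_locales (auto simp: burge_rule_def)

lemma rsk_first_part:
  "chain_bound rel_NE f (rect p q) k \<longleftrightarrow> grow rsk_rule 0 f p q \<le> k"
proof (rule rsk_row.chain_bound_iff_L_le[OF chain_orders(1)])
  fix p q ds
  let ?L = "grow rsk_rule 0 f"
  assume ds: "sorted_wrt (strict rel_NE) (ds @ [(Suc p, Suc q)])" "set ds \<subseteq> rect (Suc p) (Suc q)"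
    and b: "chain_bound rel_NE f (rect p (Suc q)) (?L p (Suc q))"
      "chain_bound rel_NE f (rect (Suc p) q) (?L (Suc p) q)"
  \<comment> \<open>The predecessors of the corner cell form a chain whose last cell is a different
    one; they lie in the rectangle below it, hence in one of the two smaller rectangles.\<close>
  have "(\<Sum>c\<leftarrow>ds. f c) \<le> max (?L p (Suc q)) (?L (Suc p) q)"
  proof (cases ds rule: rev_cases)
    case (snoc es e)
    obtain x y where e: "e = (x, y)" by fastforce
    have "down_shape (rect (Suc p) (Suc q))" by (auto simp: down_shape_def rect_def)
    then have sub: "set ds \<subseteq> rect x y"
      using ne_chain_in_rect[OF chain_orders(1), of es x y "rect (Suc p) (Suc q)"] ds snoc e
      by (simp add: sorted_wrt_append)
    have "x \<le> Suc p" "y \<le> Suc q" "(x, y) \<noteq> (Suc p, Suc q)"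
      using ds snoc e by (auto simp: sorted_wrt_append strict_def)
    then consider "x \<le> p" "y \<le> Suc q" | "x \<le> Suc p" "y \<le> q" by fastforce
    then show ?thesis
    proof cases
      case 1
      then have "set ds \<subseteq> rect p (Suc q)" using sub rect_mono[of x p y "Suc q"] by blast
      from chain_boundD[OF b(1) _ this] show ?thesis using ds(1) by (simp add: sorted_wrt_append)
    next
      case 2
      then have "set ds \<subseteq> rect (Suc p) q" using sub rect_mono[of x "Suc p" y q] by blast
      from chain_boundD[OF b(2) _ this] show ?thesis using ds(1) by (simp add: sorted_wrt_append)
    qed
  qed simp
  then show "(\<Sum>c\<leftarrow>ds. f c) + f (Suc p, Suc q) \<le> ?L (Suc p) (Suc q)"
    by (simp add: rsk_rule_def)
next
  fix p q
  let ?L = "grow rsk_rule 0 f"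
  have "\<forall>c\<in>rect p (Suc q). strict rel_NE c (Suc p, Suc q)" "\<forall>c\<in>rect (Suc p) q. strict rel_NE c (Suc p, Suc q)"
    by (auto simp: strict_def rel_NE_def)
  moreover have "?L (Suc p) (Suc q) = ?L p (Suc q) + f (Suc p, Suc q) \<or>
      ?L (Suc p) (Suc q) = ?L (Suc p) q + f (Suc p, Suc q)"
    by (simp add: rsk_rule_def max_def)
  ultimately show "?L (Suc p) (Suc q) = ?L p (Suc q) \<or> ?L (Suc p) (Suc q) = ?L (Suc p) q \<or>
      (\<exists>x\<le>Suc p. \<exists>y\<le>Suc q. (x, y) \<noteq> (Suc p, Suc q) \<and> (\<forall>c\<in>rect x y. strict rel_NE c (Suc p, Suc q)) \<and>
        ?L (Suc p) (Suc q) = ?L x y + f (Suc p, Suc q))"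
    by (metis le_refl le_SucI n_not_Suc_n prod.inject)
qed

lemma dual_first_part:
  assumes f: "\<forall>c. f c \<in> {0, 1}"
  shows "chain_bound rel_nE (ind f) (rect p q) k \<longleftrightarrow> grow dual_rule 0 f p q \<le> k"
proof (rule dual_row.chain_bound_iff_L_le[OF chain_orders(3)])
  have ind: "ind f c = f c" for c using f[rule_format, of c] by (auto simp: ind_def)
  fix p q
  let ?L = "grow dual_rule 0 f"
  {
    fix ds
    assume ds: "sorted_wrt (strict rel_nE) (ds @ [(Suc p, Suc q)])" "set ds \<subseteq> rect (Suc p) (Suc q)"
      and b: "chain_bound rel_nE (ind f) (rect (Suc p) q) (?L (Suc p) q)"
    have "set ds \<subseteq> rect (Suc p) q"
    proof
      fix c assume c: "c \<in> set ds"
      then have "c \<in> rect (Suc p) (Suc q)" "rel_nE c (Suc p, Suc q)"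
        using ds by (auto simp: sorted_wrt_append strict_def)
      then show "c \<in> rect (Suc p) q" by (cases c) (auto simp: rel_nE_def)
    qed
    then have "(\<Sum>c\<leftarrow>ds. ind f c) \<le> ?L (Suc p) q"
      using chain_boundD[OF b, of ds] ds(1) by (simp add: sorted_wrt_append)
    then show "(\<Sum>c\<leftarrow>ds. ind f c) + ind f (Suc p, Suc q) \<le> ?L (Suc p) (Suc q)"
      by (simp add: dual_rule_def ind)
  }
  have "\<forall>c\<in>rect (Suc p) q. strict rel_nE c (Suc p, Suc q)"
    by (auto simp: strict_def rel_nE_def)
  moreover have "?L (Suc p) (Suc q) = ?L p (Suc q) \<or> ?L (Suc p) (Suc q) = ?L (Suc p) q + ind f (Suc p, Suc q)"
    by (simp add: dual_rule_def max_def ind)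
  ultimately show "?L (Suc p) (Suc q) = ?L p (Suc q) \<or> ?L (Suc p) (Suc q) = ?L (Suc p) q \<or>
      (\<exists>x\<le>Suc p. \<exists>y\<le>Suc q. (x, y) \<noteq> (Suc p, Suc q) \<and> (\<forall>c\<in>rect x y. strict rel_nE c (Suc p, Suc q)) \<and>
        ?L (Suc p) (Suc q) = ?L x y + ind f (Suc p, Suc q))"
    by (metis le_refl le_SucI n_not_Suc_n prod.inject)
qed

text \<open>All predecessors in a strict chain lie in \<open>rect p q\<close>, and the rule lets an
  entry raise the label only while both neighbours still have the value of that rectangle.\<close>

lemma burge_first_part:
  "chain_bound rel_ne (ind f) (rect p q) k \<longleftrightarrow> grow burge_rule 0 f p q \<le> k"
proof (rule burge_row.chain_bound_iff_L_le[OF chain_orders(2)])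
  fix p q
  let ?L = "grow burge_rule 0 f"
  {
    fix ds
    assume ds: "sorted_wrt (strict rel_ne) (ds @ [(Suc p, Suc q)])" "set ds \<subseteq> rect (Suc p) (Suc q)"
      and b: "chain_bound rel_ne (ind f) (rect p q) (?L p q)"
    have "set ds \<subseteq> rect p q"
    proof
      fix c assume c: "c \<in> set ds"
      then have "c \<in> rect (Suc p) (Suc q)" "rel_ne c (Suc p, Suc q)"
        using ds by (auto simp: sorted_wrt_append strict_def)
      then show "c \<in> rect p q" by (cases c) (auto simp: rel_ne_def)
    qed
    then have "(\<Sum>c\<leftarrow>ds. ind f c) \<le> ?L p q"
      using chain_boundD[OF b, of ds] ds(1) by (simp add: sorted_wrt_append)
    moreover have "?L p q \<le> ?L p (Suc q)" "?L p q \<le> ?L (Suc p) q" by (simp_all add: burge_row.L_mono)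
    ultimately show "(\<Sum>c\<leftarrow>ds. ind f c) + ind f (Suc p, Suc q) \<le> ?L (Suc p) (Suc q)"
      by (auto simp: burge_rule_def ind_def)
  }
  have "\<forall>c\<in>rect p q. strict rel_ne c (Suc p, Suc q)"
    by (auto simp: strict_def rel_ne_def)
  moreover have "?L (Suc p) (Suc q) = ?L p (Suc q) \<or> ?L (Suc p) (Suc q) = ?L (Suc p) q \<or>
      ?L (Suc p) (Suc q) = ?L p q + ind f (Suc p, Suc q)"
    by (simp add: burge_rule_def ind_def max_def)
  ultimately show "?L (Suc p) (Suc q) = ?L p (Suc q) \<or> ?L (Suc p) (Suc q) = ?L (Suc p) q \<or>
      (\<exists>x\<le>Suc p. \<exists>y\<le>Suc q. (x, y) \<noteq> (Suc p, Suc q) \<and> (\<forall>c\<in>rect x y. strict rel_ne c (Suc p, Suc q)) \<and>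
        ?L (Suc p) (Suc q) = ?L x y + ind f (Suc p, Suc q))"
    by (metis le_refl le_SucI n_not_Suc_n prod.inject)
qed

section \<open>Shadow lines for the rules of RSK and dual RSK\<close>

text \<open>\<open>X\<close> and \<open>Y\<close> stand for the cells with nonzero entries and
  nonzero carries, \<open>lt\<close> for the strict or weak order of rows. On the way from an entry
  to a carry and on to the next entry, and likewise from carry to carry, one comparison of columns
  is strict and one of rows is \<open>lt\<close>, so the two compose to a step of \<open>R\<close>.
  A chain of carries has an entry between any two neighbours and one more at each end.\<close>

lemma interlacing_chains:
  fixes lt :: "nat \<Rightarrow> nat \<Rightarrow> bool"
  assumes R: "\<And>a b. strict R a b \<longleftrightarrow> fst a < fst b \<and> lt (snd b) (snd a)"
    and lt: "\<And>x y. lt x y \<Longrightarrow> x \<le> y" "\<And>x y z. lt x y \<Longrightarrow> y \<le> z \<Longrightarrow> lt x z"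
      "\<And>x y z. x \<le> y \<Longrightarrow> lt y z \<Longrightarrow> lt x z"
    and between: "\<And>x y. x \<in> X \<Longrightarrow> y \<in> X \<Longrightarrow> strict R x y \<Longrightarrow>
      \<exists>c\<in>Y. fst x < fst c \<and> fst c \<le> fst y \<and> lt (snd y) (snd c) \<and> snd c \<le> snd x"
    and between': "\<And>c d. c \<in> Y \<Longrightarrow> d \<in> Y \<Longrightarrow> strict R c d \<Longrightarrow>
      \<exists>x\<in>X. fst c \<le> fst x \<and> fst x < fst d \<and> snd d \<le> snd x \<and> lt (snd x) (snd c)"
    and left: "\<And>c. c \<in> Y \<Longrightarrow> \<exists>x\<in>X. fst x < fst c \<and> snd c \<le> snd x"
    and below: "\<And>c. c \<in> Y \<Longrightarrow> \<exists>x\<in>X. fst c \<le> fst x \<and> lt (snd x) (snd c)"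
  shows "(\<forall>cs. sorted_wrt (strict R) cs \<longrightarrow> set cs \<subseteq> X \<longrightarrow> length cs \<le> Suc k) \<longleftrightarrow>
    (\<forall>cs. sorted_wrt (strict R) cs \<longrightarrow> set cs \<subseteq> Y \<longrightarrow> length cs \<le> k)" (is "?X \<longleftrightarrow> ?Y")
proof
  \<comment> \<open>The entries found stay weakly right of and below the first carry, so that one
    more entry, found to the left of it, can be put in front.\<close>
  have to_X: "\<exists>xs. sorted_wrt (strict R) xs \<and> set xs \<subseteq> X \<and> length xs = length (c # cs) \<and>
      (\<forall>x\<in>set xs. fst c \<le> fst x \<and> lt (snd x) (snd c))"
    if "sorted_wrt (strict R) (c # cs)" "set (c # cs) \<subseteq> Y" for c cs
    using that
  proof (induction cs arbitrary: c)
    case Nil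
    then obtain x where "x \<in> X" "fst c \<le> fst x" "lt (snd x) (snd c)" using below[of c] by auto
    then show ?case by (intro exI[of _ "[x]"]) auto
  next
    case (Cons d ds)
    have cd: "strict R c d" using Cons.prems by simp
    have "sorted_wrt (strict R) (d # ds)" "set (d # ds) \<subseteq> Y" using Cons.prems by auto
    from Cons.IH[OF this] obtain xs where xs: "sorted_wrt (strict R) xs" "set xs \<subseteq> X"
      "length xs = length (d # ds)" "\<And>x. x \<in> set xs \<Longrightarrow> fst d \<le> fst x \<and> lt (snd x) (snd d)"
      by blast
    obtain x0 where x0: "x0 \<in> X" "fst c \<le> fst x0" "fst x0 < fst d" "snd d \<le> snd x0" "lt (snd x0) (snd c)"
      using between'[OF _ _ cd] Cons.prems by auto
    have "strict R x0 x" if "x \<in> set xs" for x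
      using xs(4)[OF that] x0 lt(2) by (auto simp: R intro: less_le_trans)
    moreover have "fst c \<le> fst x \<and> lt (snd x) (snd c)" if "x \<in> set xs" for x
      using xs(4)[OF that] x0 lt(2) by (meson le_trans less_imp_le lt(1))
    ultimately show ?case using xs x0 by (intro exI[of _ "x0 # xs"]) auto
  qed
  show ?Y if ?X
  proof (intro allI impI)
    fix cs assume cs: "sorted_wrt (strict R) cs" "set cs \<subseteq> Y"
    show "length cs \<le> k"
    proof (cases cs)
      case (Cons c ds)
      obtain xs where xs: "sorted_wrt (strict R) xs" "set xs \<subseteq> X" "length xs = length cs"
        "\<And>x. x \<in> set xs \<Longrightarrow> fst c \<le> fst x \<and> lt (snd x) (snd c)"
        using to_X[of c ds] cs unfolding Cons by blast
      obtain x0 where x0: "x0 \<in> X" "fst x0 < fst c" "snd c \<le> snd x0" using left[of c] cs Cons by auto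
      have "strict R x0 x" if "x \<in> set xs" for x
        using xs(4)[OF that] x0 lt(2) by (auto simp: R intro: less_le_trans)
      then have "length (x0 # xs) \<le> Suc k"
        using xs x0 \<open>?X\<close> by (intro \<open>?X\<close>[rule_format]) auto
      then show ?thesis using xs(3) by simp
    qed simp
  qed
next
  have to_Y: "\<exists>cs. sorted_wrt (strict R) cs \<and> set cs \<subseteq> Y \<and> length cs = length xs \<and>
      (\<forall>c\<in>set cs. fst x < fst c \<and> snd c \<le> snd x)"
    if "sorted_wrt (strict R) (x # xs)" "set (x # xs) \<subseteq> X" for x xs
    using that
  proof (induction xs arbitrary: x)
    case Nil
    then show ?case by (intro exI[of _ "[]"]) auto
  next
    case (Cons y ys)
    have xy: "strict R x y" using Cons.prems by simp
    have "sorted_wrt (strict R) (y # ys)" "set (y # ys) \<subseteq> X" using Cons.prems by auto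
    from Cons.IH[OF this] obtain cs where cs: "sorted_wrt (strict R) cs" "set cs \<subseteq> Y"
      "length cs = length ys" "\<And>c. c \<in> set cs \<Longrightarrow> fst y < fst c \<and> snd c \<le> snd y"
      by blast
    obtain c0 where c0: "c0 \<in> Y" "fst x < fst c0" "fst c0 \<le> fst y" "lt (snd y) (snd c0)" "snd c0 \<le> snd x"
      using between[OF _ _ xy] Cons.prems by auto
    have "strict R c0 c" if "c \<in> set cs" for c
      using cs(4)[OF that] c0 lt(3) by (auto simp: R intro: le_less_trans)
    moreover have "fst x < fst c \<and> snd c \<le> snd x" if "c \<in> set cs" for c
      using cs(4)[OF that] c0 lt(1)[OF c0(4)] by linarith
    ultimately show ?case using cs c0 by (intro exI[of _ "c0 # cs"]) auto
  qed
  show ?X if ?Y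
  proof (intro allI impI)
    fix cs assume cs: "sorted_wrt (strict R) cs" "set cs \<subseteq> X"
    show "length cs \<le> Suc k"
    proof (cases cs)
      case (Cons x xs)
      then obtain ds where "sorted_wrt (strict R) ds" "set ds \<subseteq> Y" "length ds = length xs"
        using to_Y[of x xs] cs by blast
      then show ?thesis using \<open>?Y\<close> Cons by auto
    qed simp
  qed
qed

lemma rect_SucE:
  assumes "c \<in> rect p q"
  obtains a b where "c = (Suc a, Suc b)" "a < p" "b < q"
proof -
  obtain x y where "c = (x, y)" by fastforce
  then show ?thesis using assms that[of "x - 1" "y - 1"] by auto
qed

context row_rule
begin

text \<open>At height \<open>Suc q\<close> the region \<open>L >= v\<close> starts no later than at
  column \<open>p\<close>, while at height \<open>q\<close> everything up to column \<open>p\<close>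
  is outside. The cell where it starts is therefore an outer corner.\<close>

lemma left_corner:
  assumes "L f p q < v" "v \<le> L f p (Suc q)"
  obtains k where "k < p" "f (Suc k, Suc q) \<noteq> 0" "v \<le> L f (Suc k) (Suc q)"
proof -
  obtain k where k: "k < p" "L f k (Suc q) < v" "v \<le> L f (Suc k) (Suc q)"
    by (rule crossing[of "\<lambda>x. L f x (Suc q)" 0 v p]) (use assms in auto)
  have "L f (Suc k) q < v" using L_mono[of "Suc k" p q q f] k(1) assms(1) by simp
  with k show ?thesis using outer_corner that by blast
qed

lemma lower_corner:
  assumes "L f p q < v" "v \<le> L f (Suc p) q"
  obtains k where "k < q" "f (Suc p, Suc k) \<noteq> 0" "v \<le> L f (Suc p) (Suc k)"
proof -
  obtain k where k: "k < q" "L f (Suc p) k < v" "v \<le> L f (Suc p) (Suc k)"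
    by (rule crossing[of "\<lambda>x. L f (Suc p) x" 0 v q]) (use assms in auto)
  have "L f p (Suc k) < v" using L_mono[of p p "Suc k" q f] k(1) assms(1) by simp
  with k show ?thesis using outer_corner that by blast
qed

text \<open>The boundaries of the regions \<open>L >= v\<close> have entries at their outer corners
  and carries at their inner corners. The order \<open>lt\<close> and the assumptions on inner
  corners are what distinguishes RSK from dual RSK.\<close>

lemma shadow_lines:
  fixes lt :: "nat \<Rightarrow> nat \<Rightarrow> bool"
  assumes R: "\<And>a b. strict R a b \<longleftrightarrow> fst a < fst b \<and> lt (snd b) (snd a)"
    and lt: "\<And>x y. lt x y \<Longrightarrow> x \<le> y" "\<And>x y z. lt x y \<Longrightarrow> y \<le> z \<Longrightarrow> lt x z"
      "\<And>x y z. x \<le> y \<Longrightarrow> lt y z \<Longrightarrow> lt x z"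
    and inner_left: "\<And>p q. peel g f (Suc p, Suc q) \<noteq> 0 \<Longrightarrow> L f p q < L f p (Suc q)"
    and inner_below: "\<And>p q. peel g f (Suc p, Suc q) \<noteq> 0 \<Longrightarrow>
      \<exists>k. lt (Suc k) (Suc q) \<and> f (Suc p, Suc k) \<noteq> 0 \<and> L f p q < L f (Suc p) (Suc k)"
    and inner_le: "\<And>p q y. peel g f (Suc p, Suc q) \<noteq> 0 \<Longrightarrow> lt (Suc y) (Suc q) \<Longrightarrow>
      L f p (Suc y) \<le> Suc (L f p q)"
    and inner_exists: "\<And>a b a' b'. f (Suc a, Suc b) \<noteq> 0 \<Longrightarrow> f (Suc a', Suc b') \<noteq> 0 \<Longrightarrow> a < a' \<Longrightarrow>
      lt (Suc b') (Suc b) \<Longrightarrow> \<exists>x y. peel g f (Suc x, Suc y) \<noteq> 0 \<and> a < x \<and> x \<le> a' \<and>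
        lt (Suc b') (Suc y) \<and> y \<le> b"
  shows "chain_bound R (ind f) (rect p q) (Suc k) \<longleftrightarrow> chain_bound R (ind (peel g f)) (rect p q) k"
  unfolding chain_bound_ind_iff
proof (rule interlacing_chains[where lt=lt, OF R lt])
  let ?X = "{c \<in> rect p q. f c \<noteq> 0}" and ?Y = "{c \<in> rect p q. peel g f c \<noteq> 0}"
  fix x y assume a: "x \<in> ?X" "y \<in> ?X" "strict R x y"
  obtain a b where x: "x = (Suc a, Suc b)" using a(1) by (auto elim: rect_SucE)
  obtain a' b' where y: "y = (Suc a', Suc b')" using a(2) by (auto elim: rect_SucE)
  obtain x' y' where "peel g f (Suc x', Suc y') \<noteq> 0" "a < x'" "x' \<le> a'" "lt (Suc b') (Suc y')" "y' \<le> b"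
    using inner_exists[of a b a' b'] a x y by (auto simp: R)
  then show "\<exists>c\<in>?Y. fst x < fst c \<and> fst c \<le> fst y \<and> lt (snd y) (snd c) \<and> snd c \<le> snd x"
    using a x y by (intro bexI[of _ "(Suc x', Suc y')"]) auto
next
  let ?X = "{c \<in> rect p q. f c \<noteq> 0}" and ?Y = "{c \<in> rect p q. peel g f c \<noteq> 0}"
  fix c assume c: "c \<in> ?Y"
  obtain a b where ab: "c = (Suc a, Suc b)" using c by (auto elim: rect_SucE)
  have pc: "peel g f (Suc a, Suc b) \<noteq> 0" using c ab by simp
  obtain k where k: "k < a" "f (Suc k, Suc b) \<noteq> 0"
    by (rule left_corner[of f a b "Suc (L f a b)"]) (use inner_left[OF pc] in auto)
  then show "\<exists>x\<in>?X. fst x < fst c \<and> snd c \<le> snd x"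
    using c ab by (intro bexI[of _ "(Suc k, Suc b)"]) auto
  obtain j where j: "lt (Suc j) (Suc b)" "f (Suc a, Suc j) \<noteq> 0" "L f a b < L f (Suc a) (Suc j)"
    using inner_below[OF pc] by blast
  then show "\<exists>x\<in>?X. fst c \<le> fst x \<and> lt (snd x) (snd c)"
    using c ab lt(1)[OF j(1)] by (intro bexI[of _ "(Suc a, Suc j)"]) auto
  fix d assume d: "d \<in> ?Y" "strict R c d"
  obtain a' b' where ab': "d = (Suc a', Suc b')" using d by (auto elim: rect_SucE)
  have pd: "peel g f (Suc a', Suc b') \<noteq> 0" using d ab' by simp
  have lt': "a < a'" "lt (Suc b') (Suc b)" using d ab ab' by (auto simp: R)
  show "\<exists>x\<in>?X. fst c \<le> fst x \<and> fst x < fst d \<and> snd d \<le> snd x \<and> lt (snd x) (snd c)"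
  \<comment> \<open>In the first case the entry found below \<open>c\<close> cannot lie below the
    row of \<open>d\<close>, since \<open>L\<close> would then be at most \<open>L f a' b'\<close>
    there. In the second case the entry found left of \<open>d\<close> cannot lie left of the column
    of \<open>c\<close>, by \<open>inner_le\<close>.\<close>
  proof (cases "L f a' b' \<le> L f a b")
    case True
    have "b' \<le> j"
    proof (rule ccontr)
      assume "\<not> b' \<le> j"
      then have "L f (Suc a) (Suc j) \<le> L f a' b'" using lt' by (intro L_mono) auto
      with True j(3) show False by simp
    qed
    then show ?thesis
      using j c ab ab' lt' lt(1)[OF j(1)] by (intro bexI[of _ "(Suc a, Suc j)"]) auto
  next
    case False
    obtain i where i: "i < a'" "f (Suc i, Suc b') \<noteq> 0" "Suc (L f a' b') \<le> L f (Suc i) (Suc b')"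
      by (rule left_corner[of f a' b' "Suc (L f a' b')"]) (use inner_left[OF pd] in auto)
    have "a \<le> i"
    proof (rule ccontr)
      assume "\<not> a \<le> i"
      then have "L f (Suc i) (Suc b') \<le> L f a (Suc b')" by (intro L_mono) auto
      also have "\<dots> \<le> Suc (L f a b)" using inner_le[OF pc lt'(2)] .
      finally show False using i False by simp
    qed
    then show ?thesis
      using i d ab ab' lt' by (intro bexI[of _ "(Suc i, Suc b')"]) auto
  qed
qed

end

lemma rsk_peel:
  "chain_bound rel_se (ind f) (rect p q) (Suc k) \<longleftrightarrow>
   chain_bound rel_se (ind (peel rsk_rule f)) (rect p q) k"
proof (rule rsk_row.shadow_lines[where lt="(<)"])
  let ?L = "grow rsk_rule 0 f"
  note mono = rsk_row.L_mono
  \<comment> \<open>For RSK the carry is the minimum of the upper left and lower right labels, less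
    the lower left label.\<close>
  have peel: "peel rsk_rule f (Suc a, Suc b) \<noteq> 0 \<longleftrightarrow> ?L a b < ?L a (Suc b) \<and> ?L a b < ?L (Suc a) b" for a b
    using mono[of a a b "Suc b" f] mono[of a "Suc a" b b f] by (auto simp: peel_def rsk_rule_def)
  show "strict rel_se a b \<longleftrightarrow> fst a < fst b \<and> snd b < snd a" for a b
    by (auto simp: strict_def rel_se_def)
  fix a b
  show "?L a b < ?L a (Suc b)" if "peel rsk_rule f (Suc a, Suc b) \<noteq> 0"
    using that peel by blast
  show "\<exists>k. Suc k < Suc b \<and> f (Suc a, Suc k) \<noteq> 0 \<and> ?L a b < ?L (Suc a) (Suc k)"
    if pc: "peel rsk_rule f (Suc a, Suc b) \<noteq> 0"
  proof -
    obtain k where "k < b" "f (Suc a, Suc k) \<noteq> 0" "Suc (?L a b) \<le> ?L (Suc a) (Suc k)"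
      by (rule rsk_row.lower_corner[of f a b "Suc (?L a b)"]) (use pc peel in auto)
    then show ?thesis by (intro exI[of _ k]) auto
  qed
  show "?L a (Suc y) \<le> Suc (?L a b)" if "Suc y < Suc b" for y
    using mono[of a a "Suc y" b f] that by simp
  fix a' b' assume f: "f (Suc a, Suc b) \<noteq> 0" "f (Suc a', Suc b') \<noteq> 0" "a < a'" "Suc b' < Suc b"
  define v where "v = ?L (Suc a) (Suc b)"
  define w where "w = ?L (Suc a') (Suc b')"
  have v: "?L (Suc a) b < v" "?L a (Suc b) < v" "?L a' (Suc b') < w" using f by (auto simp: v_def w_def rsk_rule_def)
  \<comment> \<open>The line of the smaller level is followed: level \<open>v\<close> at height
    \<open>b\<close> to the right of the first entry, or level \<open>w\<close> at column
    \<open>a'\<close> above the second one. It has to cross, and does so at an inner corner.\<close>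
  show "\<exists>x y. peel rsk_rule f (Suc x, Suc y) \<noteq> 0 \<and> a < x \<and> x \<le> a' \<and> Suc b' < Suc y \<and> y \<le> b"
  proof (cases "v \<le> w")
    case True
    then have "v \<le> ?L (Suc a') b" using mono[of "Suc a'" "Suc a'" "Suc b'" b f] f by (simp add: w_def)
    then obtain i where i: "Suc a \<le> i" "i < Suc a'" "?L i b < v" "v \<le> ?L (Suc i) b"
      by (rule crossing[of "\<lambda>x. ?L x b" "Suc a" v "Suc a'", OF v(1)]) (use f in auto)
    have "v \<le> ?L i (Suc b)" using mono[of "Suc a" i "Suc b" "Suc b" f] i by (simp add: v_def)
    with i f show ?thesis by (intro exI[of _ i] exI[of _ b]) (auto simp only: peel)
  next
    case False
    have "v \<le> ?L a' (Suc b)" using mono[of "Suc a" a' "Suc b" "Suc b" f] f by (simp add: v_def)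
    then have "w \<le> ?L a' (Suc b)" using False by simp
    then obtain j where j: "Suc b' \<le> j" "j < Suc b" "?L a' j < w" "w \<le> ?L a' (Suc j)"
      by (rule crossing[of "\<lambda>y. ?L a' y" "Suc b'" w "Suc b", OF v(3)]) (use f in auto)
    have "w \<le> ?L (Suc a') j" using mono[of "Suc a'" "Suc a'" "Suc b'" j f] j by (simp add: w_def)
    with j f show ?thesis by (intro exI[of _ a'] exI[of _ j]) (auto simp only: peel)
  qed
qed auto

lemma dual_L_step:
  assumes f: "\<forall>c. f c \<in> {0, 1}"
  shows "grow dual_rule 0 f a (Suc b) \<le> Suc (grow dual_rule 0 f a b)"
proof -
  have "vstrip (grow (carry_label dual_rule) zero_part f a b) (grow (carry_label dual_rule) zero_part f a (Suc b))"
    using growth.lab_steps_all(2)[OF growth_dual] f by blast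
  then show ?thesis unfolding vstrip_def grow_carry_label_0[symmetric] by blast
qed

lemma dual_peel_in:
  assumes f: "\<forall>c. f c \<in> {0, 1}"
  shows "peel dual_rule f c \<in> {0, 1}"
proof (cases "fst c = 0 \<or> snd c = 0")
  \<comment> \<open>On the axes all labels are 0, so \<open>peel\<close> returns the entry of
    \<open>f\<close> itself.\<close>
  case True
  then show ?thesis using f[rule_format, of c] by (cases c) (auto simp: peel_def)
next
  case False
  then obtain a b where c: "c = (Suc a, Suc b)" by (cases c) (auto simp: gr0_conv_Suc)
  let ?L = "grow dual_rule 0 f"
  have "?L a b \<le> ?L a (Suc b) \<and> ?L a (Suc b) \<le> Suc (?L a b)" "?L a b \<le> ?L (Suc a) b"
    using dual_L_step[OF f] by (simp_all add: dual_row.L_mono)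
  from dual.conserve[OF this f[rule_format, of "(Suc a, Suc b)"]] show ?thesis
    by (simp add: peel_def c)
qed

lemma dual_peel:
  assumes f01: "\<forall>c. f c \<in> {0, 1}"
  shows "chain_bound rel_Se (ind f) (rect p q) (Suc k) \<longleftrightarrow>
    chain_bound rel_Se (ind (peel dual_rule f)) (rect p q) k"
proof (rule dual_row.shadow_lines[where lt="(\<le>)"])
  let ?L = "grow dual_rule 0 f"
  note mono = dual_row.L_mono
  \<comment> \<open>The carry is the minimum of the upper left label and of the lower right label
    plus the entry, less the lower left label; the upper left label exceeds the latter by at most
    1.\<close>
  have peel: "peel dual_rule f (Suc a, Suc b) \<noteq> 0 \<longleftrightarrow>
      ?L a b < ?L a (Suc b) \<and> (f (Suc a, Suc b) \<noteq> 0 \<or> ?L a b < ?L (Suc a) b)" for a b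
    using mono[of a a b "Suc b" f] mono[of a "Suc a" b b f] dual_L_step[OF f01, of a b]
      f01[rule_format, of "(Suc a, Suc b)"] by (auto simp: peel_def dual_rule_def max_def)
  have entry: "?L (Suc a) b < ?L (Suc a) (Suc b)" if "f (Suc a, Suc b) \<noteq> 0" for a b
    using that by (auto simp: dual_rule_def)
  show "strict rel_Se a b \<longleftrightarrow> fst a < fst b \<and> snd b \<le> snd a" for a b
    by (auto simp: strict_def rel_Se_def)
  fix a b
  show "?L a b < ?L a (Suc b)" if "peel dual_rule f (Suc a, Suc b) \<noteq> 0"
    using that peel by blast
  show "\<exists>k. Suc k \<le> Suc b \<and> f (Suc a, Suc k) \<noteq> 0 \<and> ?L a b < ?L (Suc a) (Suc k)"
    if pc: "peel dual_rule f (Suc a, Suc b) \<noteq> 0"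
  proof (cases "?L a b < ?L (Suc a) b")
    case True
    obtain k where "k < b" "f (Suc a, Suc k) \<noteq> 0" "Suc (?L a b) \<le> ?L (Suc a) (Suc k)"
      by (rule dual_row.lower_corner[of f a b "Suc (?L a b)"]) (use True in auto)
    then show ?thesis by (intro exI[of _ k]) auto
  next
    case False
    then have "f (Suc a, Suc b) \<noteq> 0" "?L a b < ?L a (Suc b)" using pc peel by blast+
    then show ?thesis using mono[of a "Suc a" "Suc b" "Suc b" f] by (intro exI[of _ b]) auto
  qed
  show "?L a (Suc y) \<le> Suc (?L a b)" if "Suc y \<le> Suc b" for y
    using mono[of a a "Suc y" "Suc b" f] dual_L_step[OF f01, of a b] that by simp
  fix a' b' assume f: "f (Suc a, Suc b) \<noteq> 0" "f (Suc a', Suc b') \<noteq> 0" "a < a'" "Suc b' \<le> Suc b"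
  \<comment> \<open>For dual RSK an entry is sure to raise the label only above the lower right one,
    so its level is counted from there.\<close>
  define v where "v = Suc (?L (Suc a) b)"
  define w where "w = Suc (?L (Suc a') b')"
  have vw: "v \<le> ?L (Suc a) (Suc b)" "w \<le> ?L (Suc a') (Suc b')"
    using entry[OF f(1)] entry[OF f(2)] by (simp_all add: v_def w_def)
  show "\<exists>x y. peel dual_rule f (Suc x, Suc y) \<noteq> 0 \<and> a < x \<and> x \<le> a' \<and> Suc b' \<le> Suc y \<and> y \<le> b"
  proof (cases "v \<le> ?L (Suc a') b")
    case True
    obtain i where i: "Suc a \<le> i" "i < Suc a'" "?L i b < v" "v \<le> ?L (Suc i) b"
      by (rule crossing[of "\<lambda>x. ?L x b" "Suc a" v "Suc a'"]) (use f True in \<open>auto simp: v_def\<close>)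
    have "v \<le> ?L i (Suc b)" using mono[of "Suc a" i "Suc b" "Suc b" f] i vw by simp
    with i f show ?thesis by (intro exI[of _ i] exI[of _ b]) (auto simp only: peel)
  next
    case False
    have "w \<le> v" using False mono[of "Suc a'" "Suc a'" b' b f] f by (simp add: w_def)
    moreover have "v \<le> ?L a' (Suc b)" using mono[of "Suc a" a' "Suc b" "Suc b" f] f vw by simp
    ultimately have hi: "w \<le> ?L a' (Suc b)" by simp
    have lo: "?L a' b' < w" using mono[of a' "Suc a'" b' b' f] by (simp add: w_def)
    obtain j where j: "b' \<le> j" "j < Suc b" "?L a' j < w" "w \<le> ?L a' (Suc j)"
      by (rule crossing[of "\<lambda>y. ?L a' y" b' w "Suc b", OF lo hi]) (use f in auto)
    \<comment> \<open>The search started at \<open>b'\<close> itself; there the second entry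
      supplies the condition for a carry.\<close>
    have "f (Suc a', Suc j) \<noteq> 0 \<or> ?L a' j < ?L (Suc a') j"
    proof (cases "j = b'")
      case False
      then have "w \<le> ?L (Suc a') j" using mono[of "Suc a'" "Suc a'" "Suc b'" j f] j vw by simp
      with j show ?thesis by simp
    qed (use f in simp)
    with j f show ?thesis by (intro exI[of _ a'] exI[of _ j]) (auto simp only: peel)
  qed
qed auto

section \<open>Ribbons for Burge's rule\<close>

text \<open>The rule raises the first part by at most 1 even across the diagonal of a cell, so the
  boundaries of different levels never share a cell.\<close>

lemma burge_L_steps:
  "grow burge_rule 0 f (Suc a) b \<le> Suc (grow burge_rule 0 f a b)"
  "grow burge_rule 0 f a (Suc b) \<le> Suc (grow burge_rule 0 f a b)"
  "grow burge_rule 0 f (Suc a) (Suc b) \<le> Suc (grow burge_rule 0 f a b)"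
proof -
  have "vstrip (grow (carry_label burge_rule) zero_part f a b) (grow (carry_label burge_rule) zero_part f (Suc a) b)"
    "vstrip (grow (carry_label burge_rule) zero_part f a b) (grow (carry_label burge_rule) zero_part f a (Suc b))"
    using growth.lab_steps_all[OF growth_burge] by blast+
  then show 1: "grow burge_rule 0 f (Suc a) b \<le> Suc (grow burge_rule 0 f a b)"
    "grow burge_rule 0 f a (Suc b) \<le> Suc (grow burge_rule 0 f a b)"
    unfolding vstrip_def grow_carry_label_0[symmetric] by blast+
  then show "grow burge_rule 0 f (Suc a) (Suc b) \<le> Suc (grow burge_rule 0 f a b)"
    by (simp add: burge_rule_def)
qed

context
  fixes f :: "cell \<Rightarrow> nat" and p q :: nat
begin

abbreviation (input) L where "L \<equiv> grow burge_rule 0 f"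

text \<open>The cells on the boundaries of the regions where \<open>L \<ge> v\<close>. All nonzero entries lie on them.\<close>

definition ribbon :: "cell \<Rightarrow> bool" where
  "ribbon c \<longleftrightarrow> c \<in> rect p q \<and> L (fst c - 1) (snd c - 1) < L (fst c) (snd c)"

text \<open>For a ribbon cell of level \<open>v\<close> this is 1 exactly if its upper left corner
  already has \<open>L >= v\<close>, that is, if the ribbon enters the cell from its left
  neighbour.\<close>

definition from_left :: "cell \<Rightarrow> nat" where
  "from_left c = L (fst c - 1) (snd c) - L (fst c - 1) (snd c - 1)"

definition to_below :: "cell \<Rightarrow> nat" where
  "to_below c = L (fst c) (snd c - 1) - L (fst c - 1) (snd c - 1)"

text \<open>Along a ribbon, the term \<open>to_below c\<close> of a cell and the term \<open>from_left d\<close> of the next cell add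
  up to 1, because a ribbon runs either downwards or to the right. Links between different ribbons
  are admitted under the same condition, so that the sum in \<open>link_chain_sum\<close> telescopes.\<close>

definition link :: "cell \<Rightarrow> cell \<Rightarrow> bool" where
  "link c d \<longleftrightarrow> ribbon c \<and> ribbon d \<and> strict rel_SE c d \<and> to_below c + from_left d = 1"

lemmas ribbon_defs = ribbon_def from_left_def to_below_def

lemma from_left_le: "from_left c \<le> 1"
proof (cases "snd c")
  case (Suc b) then show ?thesis using burge_L_steps(2)[of f "fst c - 1" b] by (simp add: from_left_def)
qed (simp add: from_left_def)

lemma to_below_le: "to_below c \<le> 1"
proof (cases "fst c")
  case (Suc a) then show ?thesis using burge_L_steps(1)[of f a "snd c - 1"] by (simp add: to_below_def)
qed (simp add: to_below_def)

text \<open>Conservation of entries, with a first part that grows by exactly 1 across the diagonal.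
  The terms on the right do not all vanish, since the label would not have grown otherwise; so the
  subtraction in \<open>peel\<close> is exact.\<close>

lemma burge_peel_ribbon:
  assumes "ribbon c"
  shows "peel burge_rule f c + 1 = f c + from_left c + to_below c"
proof -
  obtain a b where c: "c = (Suc a, Suc b)" using assms by (auto simp: ribbon_def elim: rect_SucE)
  have le: "L a b \<le> L (Suc a) b" "L a b \<le> L a (Suc b)" by (simp_all add: burge_row.L_mono)
  have r: "L a b < L (Suc a) (Suc b)" using assms c by (simp add: ribbon_def)
  then have e: "L (Suc a) (Suc b) = Suc (L a b)" using burge_L_steps(3)[of f a b] by simp
  have "0 < f (Suc a, Suc b) \<or> L a b < L (Suc a) b \<or> L a b < L a (Suc b)"
    using r by (auto simp: burge_rule_def split: if_splits)
  then show ?thesis using le e unfolding c peel_def from_left_def to_below_def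
    by (simp del: grow.simps)  linarith
qed

lemma burge_off_ribbon:
  assumes "c \<in> rect p q" "\<not> ribbon c"
  shows "f c = 0 \<and> peel burge_rule f c = 0"
proof -
  obtain a b where c: "c = (Suc a, Suc b)" using assms by (auto elim: rect_SucE)
  have le: "L a b \<le> L (Suc a) b" "L a b \<le> L a (Suc b)"
    "L (Suc a) b \<le> L (Suc a) (Suc b)" "L a (Suc b) \<le> L (Suc a) (Suc b)" by (simp_all only: burge_row.L_mono le_SucI le_refl)
  have "L (Suc a) (Suc b) \<le> L a b" using assms c by (simp add: ribbon_def)
  then have eq: "L (Suc a) b = L a b" "L a (Suc b) = L a b" "L (Suc a) (Suc b) = L a b" using le by linarith+
  have "burge_rule (L a b) (L a b) (L a b) (f c) = L a b" using eq c by simp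
  then have "f c = 0" by (auto simp: burge_rule_def split: if_splits)
  then show ?thesis using eq c by (simp add: peel_def del: grow.simps)
qed

text \<open>This and the next three lemmas follow a ribbon, read from the upper left to the lower
  right: \<open>from_left\<close> tells whether the previous cell is to the left or above,
  \<open>to_below\<close> whether the next one is below or to the right.\<close>

lemma ribbon_left:
  assumes "ribbon (Suc a, Suc b)" "from_left (Suc a, Suc b) = 1"
  obtains a' where "a = Suc a'" "ribbon (Suc a', Suc b)" "to_below (Suc a', Suc b) = 0"
proof -
  obtain a' where a: "a = Suc a'" using assms(2) by (cases a) (auto simp: from_left_def)
  have "L a (Suc b) \<le> Suc (L a' b)" unfolding a by (rule burge_L_steps)
  moreover have "L a' b \<le> L a b" unfolding a by (simp add: burge_row.L_mono)
  moreover have "L a (Suc b) = Suc (L a b)" using assms(2) by (simp add: from_left_def del: grow.simps)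
  ultimately have "L a' b = L a b" "L a b < L a (Suc b)" by linarith+
  then show ?thesis using assms(1) a by (intro that[of a']) (auto simp: ribbon_defs simp del: grow.simps)
qed

lemma ribbon_below:
  assumes "ribbon (Suc a, Suc b)" "to_below (Suc a, Suc b) = 1"
  obtains b' where "b = Suc b'" "ribbon (Suc a, Suc b')" "from_left (Suc a, Suc b') = 0"
proof -
  obtain b' where b: "b = Suc b'" using assms(2) by (cases b) (auto simp: to_below_def)
  have "L (Suc a) b \<le> Suc (L a b')" unfolding b by (rule burge_L_steps)
  moreover have "L a b' \<le> L a b" unfolding b by (simp add: burge_row.L_mono)
  moreover have "L (Suc a) b = Suc (L a b)" using assms(2) by (simp add: to_below_def del: grow.simps)
  ultimately have "L a b' = L a b" "L a b < L (Suc a) b" by linarith+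
  then show ?thesis using assms(1) b by (intro that[of b']) (auto simp: ribbon_defs simp del: grow.simps)
qed

lemma ribbon_right:
  assumes "ribbon (Suc a, Suc b)" "to_below (Suc a, Suc b) = 0" "Suc a < p"
  shows "ribbon (Suc (Suc a), Suc b)" "from_left (Suc (Suc a), Suc b) = 1"
proof -
  have "L (Suc a) b \<le> L a b" using assms(2) by (simp add: to_below_def del: grow.simps)
  moreover have "L a b < L (Suc a) (Suc b)" using assms(1) by (simp add: ribbon_def del: grow.simps)
  moreover have "L (Suc a) (Suc b) \<le> L (Suc (Suc a)) (Suc b)" by (rule burge_row.L_mono) simp_all
  ultimately have "L (Suc a) b < L (Suc (Suc a)) (Suc b)" "L (Suc a) b < L (Suc a) (Suc b)" by linarith+
  then show "ribbon (Suc (Suc a), Suc b)" "from_left (Suc (Suc a), Suc b) = 1"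
    using assms(1,3) burge_L_steps(2)[of f "Suc a" b] by (auto simp: ribbon_defs simp del: grow.simps)
qed

lemma ribbon_above:
  assumes "ribbon (Suc a, Suc b)" "from_left (Suc a, Suc b) = 0" "Suc b < q"
  shows "ribbon (Suc a, Suc (Suc b))" "to_below (Suc a, Suc (Suc b)) = 1"
proof -
  have "L a (Suc b) \<le> L a b" using assms(2) by (simp add: from_left_def del: grow.simps)
  moreover have "L a b < L (Suc a) (Suc b)" using assms(1) by (simp add: ribbon_def del: grow.simps)
  moreover have "L (Suc a) (Suc b) \<le> L (Suc a) (Suc (Suc b))" by (rule burge_row.L_mono) simp_all
  ultimately have "L a (Suc b) < L (Suc a) (Suc (Suc b))" "L a (Suc b) < L (Suc a) (Suc b)" by linarith+
  then show "ribbon (Suc a, Suc (Suc b))" "to_below (Suc a, Suc (Suc b)) = 1"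
    using assms(1,3) burge_L_steps(1)[of f a "Suc b"] by (auto simp: ribbon_defs simp del: grow.simps)
qed

text \<open>The two cells may lie on different ribbons; the chain moves along either ribbon until a
  direct link is possible.\<close>

lemma connect_ribbon_cells:
  assumes "ribbon c" "ribbon d" "strict rel_SE c d"
  shows "\<exists>ds. successively link (c # ds @ [d])"
  using assms
proof (induction "(fst d - fst c) + (snd c - snd d)" arbitrary: c d rule: less_induct)
  case less
  obtain a b where c: "c = (Suc a, Suc b)" using less(2) by (auto simp: ribbon_def elim: rect_SucE)
  obtain a' b' where d: "d = (Suc a', Suc b')" using less(3) by (auto simp: ribbon_def elim: rect_SucE)
  have se: "a \<le> a'" "b' \<le> b" "a \<noteq> a' \<or> b \<noteq> b'" using less(4) c d by (auto simp: strict_def rel_SE_def)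
  have bounds: "Suc a' \<le> p" "Suc b \<le> q" using less(2,3) c d by (auto simp: ribbon_def)
  have after: ?case if e: "link c e" "ribbon e" "strict rel_SE e d"
    "(fst d - fst e) + (snd e - snd d) < (fst d - fst c) + (snd c - snd d)" for e
  proof -
    obtain ds where "successively link (e # ds @ [d])" using less(1)[OF e(4,2) less(3) e(3)] by blast
    then have "successively link (c # (e # ds) @ [d])" using e(1) by simp
    then show ?thesis by blast
  qed
  have before: ?case if e: "link e d" "ribbon e" "strict rel_SE c e"
    "(fst e - fst c) + (snd c - snd e) < (fst d - fst c) + (snd c - snd d)" for e
  proof -
    obtain ds where "successively link (c # ds @ [e])" using less(1)[OF e(4) less(2) e(2,3)] by blast
    then have "successively link ((c # ds @ [e]) @ [d])"
      using e(1) by (subst successively_append_iff) simp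
    then have "successively link (c # (ds @ [e]) @ [d])" by simp
    then show ?thesis by blast
  qed
  \<comment> \<open>If the two terms have the wrong sum, one end is moved by a cell along its ribbon
    towards the other. The new cell has the opposite value of the relevant term, so it differs from
    the other end and the distance shrinks.\<close>
  consider (ok) "to_below c + from_left d = 1" | (one) "to_below c = 1" "from_left d = 1"
    | (zero) "to_below c = 0" "from_left d = 0"
    using to_below_le[of c] from_left_le[of d] by linarith
  then show ?case
  proof cases
    case ok
    then have "successively link (c # [] @ [d])" using less by (simp add: link_def)
    then show ?thesis by blast
  next
    case one
    show ?thesis
    proof (cases "b' < b")
      case True
      obtain e where e: "b = Suc e" "ribbon (Suc a, Suc e)" "from_left (Suc a, Suc e) = 0"
        using ribbon_below less(2) one(1) unfolding c by blast
      have "(Suc a, Suc e) \<noteq> d" using e(3) one(2) by auto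
      then show ?thesis using e True se one less(2) c d
        by (intro after[of "(Suc a, Suc e)"]) (auto simp: link_def strict_def rel_SE_def)
    next
      case False
      obtain e where e: "a' = Suc e" "ribbon (Suc e, Suc b')" "to_below (Suc e, Suc b') = 0"
        using ribbon_left less(3) one(2) unfolding d by blast
      have "(Suc e, Suc b') \<noteq> c" using e(3) one(1) by auto
      then show ?thesis using e False se one less(3) c d
        by (intro before[of "(Suc e, Suc b')"]) (auto simp: link_def strict_def rel_SE_def)
    qed
  next
    case zero
    show ?thesis
    proof (cases "a < a'")
      case True
      have e: "ribbon (Suc (Suc a), Suc b)" "from_left (Suc (Suc a), Suc b) = 1"
        using ribbon_right[of a b] less(2) zero(1) True bounds unfolding c by auto
      have "(Suc (Suc a), Suc b) \<noteq> d" using e(2) zero(2) by auto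
      then show ?thesis using e True se zero less(2) c d
        by (intro after[of "(Suc (Suc a), Suc b)"]) (auto simp: link_def strict_def rel_SE_def)
    next
      case False
      have e: "ribbon (Suc a', Suc (Suc b'))" "to_below (Suc a', Suc (Suc b')) = 1"
        using ribbon_above[of a' b'] less(3) zero(2) False se bounds unfolding d by auto
      have "(Suc a', Suc (Suc b')) \<noteq> c" using e(2) zero(1) by auto
      then show ?thesis using e False se zero less(3) c d
        by (intro before[of "(Suc a', Suc (Suc b'))"]) (auto simp: link_def strict_def rel_SE_def)
    qed
  qed
qed

text \<open>The ribbon is followed downwards until it no longer continues below; this ends because
  the labels on the bottom axis are 0.\<close>

lemma extend_below:
  assumes "ribbon c"
  shows "\<exists>ds. successively link (c # ds) \<and> to_below (last (c # ds)) = 0"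
  using assms
proof (induction "snd c" arbitrary: c rule: less_induct)
  case less
  show ?case
  proof (cases "to_below c = 0")
    case True
    then show ?thesis by (intro exI[of _ "[]"]) simp
  next
    case False
    obtain a b where c: "c = (Suc a, Suc b)" using less(2) by (auto simp: ribbon_def elim: rect_SucE)
    have one: "to_below c = 1" using False to_below_le[of c] by simp
    obtain e where e: "b = Suc e" "ribbon (Suc a, Suc e)" "from_left (Suc a, Suc e) = 0"
      using ribbon_below less(2) one unfolding c by blast
    then have "link c (Suc a, Suc e)" using one less(2) c by (auto simp: link_def strict_def rel_SE_def)
    moreover obtain ds where "successively link ((Suc a, Suc e) # ds)" "to_below (last ((Suc a, Suc e) # ds)) = 0"
      using less(1)[OF _ e(2)] c e(1) by auto
    ultimately show ?thesis by (intro exI[of _ "(Suc a, Suc e) # ds"]) simp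
  qed
qed

lemma extend_left:
  assumes "ribbon c" "successively link (c # ds)"
  shows "\<exists>c' ds'. successively link (c' # ds') \<and> ribbon c' \<and> from_left c' = 0 \<and>
    set (c # ds) \<subseteq> set (c' # ds') \<and> last (c' # ds') = last (c # ds)"
  using assms
proof (induction "fst c" arbitrary: c ds rule: less_induct)
  case less
  show ?case
  proof (cases "from_left c = 0")
    case True
    then show ?thesis using less by blast
  next
    case False
    obtain a b where c: "c = (Suc a, Suc b)" using less(2) by (auto simp: ribbon_def elim: rect_SucE)
    have one: "from_left c = 1" using False from_left_le[of c] by simp
    obtain e where e: "a = Suc e" "ribbon (Suc e, Suc b)" "to_below (Suc e, Suc b) = 0"
      using ribbon_left less(2) one unfolding c by blast
    then have "link (Suc e, Suc b) c" using one less(2) c by (auto simp: link_def strict_def rel_SE_def)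
    then have "successively link ((Suc e, Suc b) # c # ds)" using less(3) by simp
    from less(1)[OF _ e(2) this] c e(1) obtain c' ds' where "successively link (c' # ds')" "ribbon c'"
      "from_left c' = 0" "set ((Suc e, Suc b) # c # ds) \<subseteq> set (c' # ds')"
      "last (c' # ds') = last ((Suc e, Suc b) # c # ds)" by auto
    then show ?thesis by (intro exI[of _ c'] exI[of _ ds']) auto
  qed
qed

lemma extend_chain:
  assumes "sorted_wrt (strict rel_SE) (c # cs)" "\<And>x. x \<in> set (c # cs) \<Longrightarrow> ribbon x"
  shows "\<exists>ds. successively link (c # ds) \<and> to_below (last (c # ds)) = 0 \<and> set (c # cs) \<subseteq> set (c # ds)"
  using assms
proof (induction cs arbitrary: c)
  case Nil
  then show ?case using extend_below[of c] by auto
next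
  case (Cons d es)
  obtain ds where ds: "successively link (d # ds)" "to_below (last (d # ds)) = 0" "set (d # es) \<subseteq> set (d # ds)"
    using Cons.IH[of d] Cons.prems by auto
  obtain bs where bs: "successively link (c # bs @ [d])"
    using connect_ribbon_cells[of c d] Cons.prems by auto
  have "successively link ((c # bs) @ (d # ds))"
    using bs ds(1) successively_append_iff[of link "c # bs" "[d]"]
      successively_append_iff[of link "c # bs" "d # ds"] by simp
  then show ?case using ds by (intro exI[of _ "bs @ d # ds"]) auto
qed

text \<open>\<open>burge_peel_ribbon\<close> is summed over the chain; there is one link fewer than
  there are cells, which is the source of the \<open>+ 1\<close>.\<close>

lemma link_chain_sum:
  assumes "successively link (c # ds)" "ribbon c"
  shows "(\<Sum>x\<leftarrow>c # ds. peel burge_rule f x) + 1 =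
    (\<Sum>x\<leftarrow>c # ds. f x) + from_left c + to_below (last (c # ds))"
  using assms
proof (induction ds arbitrary: c)
  case Nil
  then show ?case using burge_peel_ribbon[of c] by simp
next
  case (Cons d ds)
  have l: "link c d" "ribbon d" using Cons.prems by (auto simp: link_def)
  then have "(\<Sum>x\<leftarrow>d # ds. peel burge_rule f x) + 1 =
    (\<Sum>x\<leftarrow>d # ds. f x) + from_left d + to_below (last (d # ds))"
    using Cons by simp
  moreover have "to_below c + from_left d = 1" using l by (simp add: link_def)
  ultimately show ?case using burge_peel_ribbon[OF Cons.prems(2)] by simp
qed

text \<open>Both ends are pushed on until \<open>from_left\<close> of the first and
  \<open>to_below\<close> of the last cell vanish, which removes the boundary terms of
  \<open>link_chain_sum\<close>.\<close>

lemma ribbon_chain_extension: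
  assumes "sorted_wrt (strict rel_SE) cs" "\<And>x. x \<in> set cs \<Longrightarrow> ribbon x" "cs \<noteq> []"
  obtains ds where "sorted_wrt (strict rel_SE) ds" "set ds \<subseteq> rect p q" "set cs \<subseteq> set ds"
    "(\<Sum>x\<leftarrow>ds. peel burge_rule f x) + 1 = (\<Sum>x\<leftarrow>ds. f x)"
proof -
  obtain c es where cs: "cs = c # es" using assms(3) by (cases cs) auto
  obtain ds where ds: "successively link (c # ds)" "to_below (last (c # ds)) = 0" "set (c # es) \<subseteq> set (c # ds)"
    using extend_chain[of c es] assms(1,2) unfolding cs by blast
  obtain c' ds' where ds': "successively link (c' # ds')" "ribbon c'" "from_left c' = 0"
    "set (c # ds) \<subseteq> set (c' # ds')" "last (c' # ds') = last (c # ds)"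
    using extend_left[OF _ ds(1)] assms(2) cs by auto
  have "successively (strict rel_SE) (c' # ds')"
    using ds'(1) by (rule successively_mono) (auto simp: link_def)
  moreover have "transp (strict rel_SE)"
    using chain_orders(5) by (auto simp: se_chain_order_def intro: transp_strict)
  ultimately have s: "sorted_wrt (strict rel_SE) (c' # ds')" using successively_conv_sorted_wrt by blast
  have "ribbon x" if "x \<in> set ds'" for x
    using ds'(1) that by (induction ds' arbitrary: c') (auto simp: link_def)
  then have "set (c' # ds') \<subseteq> rect p q" using ds'(2) by (auto simp: ribbon_def)
  moreover have "(\<Sum>x\<leftarrow>c' # ds'. peel burge_rule f x) + 1 = (\<Sum>x\<leftarrow>c' # ds'. f x)"
    using link_chain_sum[OF ds'(1,2)] ds'(3,5) ds(2) by simp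
  ultimately show ?thesis using s ds(3) ds'(4) cs that[of "c' # ds'"] by auto
qed

text \<open>All nonzero entries and carries lie on ribbons, so chains supported on them can be
  extended. This lowers neither the sum of entries nor that of carries, and afterwards the two
  differ by 1, so a bound for one sum gives a bound for the other in both directions.\<close>

lemma burge_peel:
  "chain_bound rel_SE f (rect p q) (Suc k) \<longleftrightarrow> chain_bound rel_SE (peel burge_rule f) (rect p q) k"
proof -
  have mono: "(\<Sum>x\<leftarrow>cs. w x) \<le> (\<Sum>x\<leftarrow>ds. w x)"
    if "sorted_wrt (strict rel_SE) cs" "sorted_wrt (strict rel_SE) ds" "set cs \<subseteq> set ds"
    for cs ds and w :: "cell \<Rightarrow> nat"
    using that sum_mono2[of "set ds" "set cs" w] sorted_wrt_strict_distinct
    by (simp add: sum_list_distinct_conv_sum_set)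
  show ?thesis
  proof
    assume b: "chain_bound rel_SE f (rect p q) (Suc k)"
    show "chain_bound rel_SE (peel burge_rule f) (rect p q) k"
    proof (rule chain_boundI_support)
      fix cs assume cs: "sorted_wrt (strict rel_SE) cs" "set cs \<subseteq> {c \<in> rect p q. peel burge_rule f c \<noteq> 0}"
      show "(\<Sum>x\<leftarrow>cs. peel burge_rule f x) \<le> k"
      proof (cases "cs = []")
        case False
        have "ribbon x" if "x \<in> set cs" for x using burge_off_ribbon[of x] subsetD[OF cs(2) that] by auto
        then obtain ds where ds: "sorted_wrt (strict rel_SE) ds" "set ds \<subseteq> rect p q" "set cs \<subseteq> set ds"
          "(\<Sum>x\<leftarrow>ds. peel burge_rule f x) + 1 = (\<Sum>x\<leftarrow>ds. f x)"
          by (rule ribbon_chain_extension[OF cs(1) _ False])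
        show ?thesis using mono[OF cs(1) ds(1,3), of "peel burge_rule f"] chain_boundD[OF b ds(1,2)] ds(4)
          by linarith
      qed simp
    qed
  next
    assume b: "chain_bound rel_SE (peel burge_rule f) (rect p q) k"
    show "chain_bound rel_SE f (rect p q) (Suc k)"
    proof (rule chain_boundI_support)
      fix cs assume cs: "sorted_wrt (strict rel_SE) cs" "set cs \<subseteq> {c \<in> rect p q. f c \<noteq> 0}"
      show "(\<Sum>x\<leftarrow>cs. f x) \<le> Suc k"
      proof (cases "cs = []")
        case False
        have "ribbon x" if "x \<in> set cs" for x using burge_off_ribbon[of x] subsetD[OF cs(2) that] by auto
        then obtain ds where ds: "sorted_wrt (strict rel_SE) ds" "set ds \<subseteq> rect p q" "set cs \<subseteq> set ds"
          "(\<Sum>x\<leftarrow>ds. peel burge_rule f x) + 1 = (\<Sum>x\<leftarrow>ds. f x)"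
          by (rule ribbon_chain_extension[OF cs(1) _ False])
        show ?thesis using mono[OF cs(1) ds(1,3), of f] chain_boundD[OF b ds(1,2)] ds(4)
          by linarith
      qed simp
    qed
  qed
qed

end

section \<open>Chain statistics of the labels\<close>

lemma rsk_statistics:
  "grow (carry_label rsk_rule) zero_part f p q 0 \<le> k \<longleftrightarrow> chain_bound rel_NE f (rect p q) k"
  "grow (carry_label rsk_rule) zero_part f p q k = 0 \<longleftrightarrow> chain_bound rel_se (ind f) (rect p q) k"
proof -
  show "grow (carry_label rsk_rule) zero_part f p q 0 \<le> k \<longleftrightarrow> chain_bound rel_NE f (rect p q) k"
    by (simp add: grow_carry_label_0 rsk_first_part)
  show "grow (carry_label rsk_rule) zero_part f p q k = 0 \<longleftrightarrow> chain_bound rel_se (ind f) (rect p q) k"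
    by (rule rsk_row.part_0_iff_chain_bound[where E=UNIV]) (simp_all add: rsk_peel ind_eq_0_iff)
qed

lemma dual_statistics:
  assumes f: "\<forall>c. f c \<in> {0, 1}"
  shows "grow (carry_label dual_rule) zero_part f p q 0 \<le> k \<longleftrightarrow> chain_bound rel_nE (ind f) (rect p q) k"
    and "grow (carry_label dual_rule) zero_part f p q k = 0 \<longleftrightarrow> chain_bound rel_Se (ind f) (rect p q) k"
proof -
  show "grow (carry_label dual_rule) zero_part f p q 0 \<le> k \<longleftrightarrow> chain_bound rel_nE (ind f) (rect p q) k"
    by (simp add: grow_carry_label_0 dual_first_part[OF f])
  show "grow (carry_label dual_rule) zero_part f p q k = 0 \<longleftrightarrow> chain_bound rel_Se (ind f) (rect p q) k"
    by (rule dual_row.part_0_iff_chain_bound[where E="{0, 1}", OF dual_peel dual_peel_in ind_eq_0_iff f])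
qed

lemma burge_statistics:
  "grow (carry_label burge_rule) zero_part f p q 0 \<le> k \<longleftrightarrow> chain_bound rel_ne (ind f) (rect p q) k"
  "grow (carry_label burge_rule) zero_part f p q k = 0 \<longleftrightarrow> chain_bound rel_SE f (rect p q) k"
proof -
  show "grow (carry_label burge_rule) zero_part f p q 0 \<le> k \<longleftrightarrow> chain_bound rel_ne (ind f) (rect p q) k"
    by (simp add: grow_carry_label_0 burge_first_part)
  show "grow (carry_label burge_rule) zero_part f p q k = 0 \<longleftrightarrow> chain_bound rel_SE f (rect p q) k"
    by (rule burge_row.part_0_iff_chain_bound[where E=UNIV and w="\<lambda>f. f"]) (simp_all add: burge_peel)
qed

section \<open>Symmetries of chain bounds and the transposed rules\<close>

lemma chain_bound_swap:
  assumes R: "\<And>a b. R' a b \<longleftrightarrow> R (prod.swap a) (prod.swap b)"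
  shows "chain_bound R' (\<lambda>c. w (prod.swap c)) (rect q p) k \<longleftrightarrow> chain_bound R w (rect p q) k"
proof -
  have main: "chain_bound R' w' (rect q p) k"
    if b: "chain_bound R w (rect p q) k" and R: "\<And>a b. R' a b \<longleftrightarrow> R (prod.swap a) (prod.swap b)"
      and w: "\<And>c. w' c = w (prod.swap c)" for R R' w w' p q
    unfolding chain_bound_def
  proof (intro allI impI)
    fix cs assume cs: "sorted_wrt (strict R') cs" "set cs \<subseteq> rect q p"
    have st: "strict R (prod.swap a) (prod.swap b) = strict R' a b" for a b
      by (cases a; cases b) (auto simp: strict_def R)
    have "sorted_wrt (strict R) (map prod.swap cs)" using cs(1) by (simp add: sorted_wrt_map st)
    moreover have "set (map prod.swap cs) \<subseteq> rect p q" using cs(2) by (auto simp: rect_def)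
    ultimately have "(\<Sum>c\<leftarrow>map prod.swap cs. w c) \<le> k" by (rule chain_boundD[OF b])
    then show "(\<Sum>c\<leftarrow>cs. w' c) \<le> k" by (simp add: w comp_def)
  qed
  show ?thesis
  proof
    assume "chain_bound R' (\<lambda>c. w (prod.swap c)) (rect q p) k"
    then show "chain_bound R w (rect p q) k" by (rule main) (simp_all add: R)
  next
    assume "chain_bound R w (rect p q) k"
    then show "chain_bound R' (\<lambda>c. w (prod.swap c)) (rect q p) k" by (rule main) (simp_all add: R)
  qed
qed

lemma chain_bound_rev:
  assumes R: "\<And>a b. R' a b \<longleftrightarrow> R b a"
  shows "chain_bound R' w S k \<longleftrightarrow> chain_bound R w S k"
proof -
  have main: "chain_bound R' w S k"
    if b: "chain_bound R w S k" and R: "\<And>a b. R' a b \<longleftrightarrow> R b a" for R R'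
    unfolding chain_bound_def
  proof (intro allI impI)
    fix cs assume cs: "sorted_wrt (strict R') cs" "set cs \<subseteq> S"
    have st: "strict R' = (\<lambda>a b. strict R b a)" by (auto simp: strict_def R fun_eq_iff)
    have "sorted_wrt (strict R) (rev cs)" using cs(1) unfolding st by (simp add: sorted_wrt_rev)
    from chain_boundD[OF b this] show "(\<Sum>c\<leftarrow>cs. w c) \<le> k"
      using cs(2) by (simp add: rev_map[symmetric])
  qed
  show ?thesis using main[of R R'] main[of R' R] R by blast
qed

text \<open>Reflection in the diagonal keeps the order along upward chains but reverses it along
  chains going down to the right.\<close>

lemma chain_bound_swap_rev:
  assumes R: "\<And>a b. R' a b \<longleftrightarrow> R (prod.swap b) (prod.swap a)"
  shows "chain_bound R' (\<lambda>c. w (prod.swap c)) (rect q p) k \<longleftrightarrow> chain_bound R w (rect p q) k"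
  using chain_bound_swap[of "\<lambda>a b. R' b a" R w q p k] chain_bound_rev[of "\<lambda>a b. R' b a" R'] R by simp

definition transpose_rule where
  "transpose_rule \<phi> = (\<lambda>r u v m. conj_part (\<phi> (conj_part r) (conj_part v) (conj_part u) m))"

lemma hstrip_iff_conj: "hstrip r l \<longleftrightarrow> part r \<and> part l \<and> vstrip (conj_part r) (conj_part l)"
  using vstrip_conj[of r l] hstrip_conj[of "conj_part r" "conj_part l"] conj_conj[of r] conj_conj[of l]
  by (auto simp: hstrip_def)

lemma vstrip_iff_conj: "vstrip r l \<longleftrightarrow> part r \<and> part l \<and> hstrip (conj_part r) (conj_part l)"
  using hstrip_conj[of r l] vstrip_conj[of "conj_part r" "conj_part l"] conj_conj[of r] conj_conj[of l]
  by (auto simp: vstrip_def)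

lemma growth_burge_transpose:
  "growth UNIV hstrip hstrip zero_part (transpose_rule (carry_label burge_rule)) psize"
  unfolding transpose_rule_def
  by (rule growth_transpose[OF growth_burge]) (auto simp: vstrip_def hstrip_iff_conj)

lemma growth_dual_transpose:
  "growth {0, 1} hstrip vstrip zero_part (transpose_rule (carry_label dual_rule)) psize"
  unfolding transpose_rule_def
  by (rule growth_transpose[OF growth_dual _ _ hstrip_iff_conj vstrip_iff_conj])
    (auto simp: vstrip_def hstrip_def)

lemma part_grow:
  assumes "growth E H V zero_part \<phi> psize" "\<And>r l. H r l \<Longrightarrow> part r" "\<And>c. f c \<in> E"
  shows "part (grow \<phi> zero_part f p q)"
  using assms growth.lab_steps_all(1)[OF assms(1), of f p q] by blast

lemma conj_part_eq_0_iff: "part l \<Longrightarrow> conj_part l k = 0 \<longleftrightarrow> l 0 \<le> k"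
  using conj_part_le_iff[of l k 0] by simp

lemma conj_part_0_le_iff: "part l \<Longrightarrow> conj_part l 0 \<le> k \<longleftrightarrow> l k = 0"
  using conj_part_le_iff[of l 0 k] by simp

text \<open>Conjugation exchanges the first part with the number of parts; under reflection
  \<open>rel_ne\<close> is symmetric, and \<open>rel_SE\<close> is symmetric up to reversal.\<close>

lemma burge_transpose_statistics:
  "grow (transpose_rule (carry_label burge_rule)) zero_part f p q 0 \<le> k \<longleftrightarrow>
     chain_bound rel_SE f (rect p q) k"
  "grow (transpose_rule (carry_label burge_rule)) zero_part f p q k = 0 \<longleftrightarrow>
     chain_bound rel_ne (ind f) (rect p q) k"
proof -
  let ?f = "\<lambda>c. f (prod.swap c)"
  let ?l = "grow (carry_label burge_rule) zero_part ?f q p"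
  have l: "grow (transpose_rule (carry_label burge_rule)) zero_part f p q = conj_part ?l"
    unfolding transpose_rule_def by (rule grow_transpose[OF growth_burge]) (auto simp: vstrip_def)
  have p: "part ?l" by (rule part_grow[OF growth_burge]) (auto simp: vstrip_def)
  have ind: "ind ?f = (\<lambda>c. ind f (prod.swap c))" by (auto simp: ind_def)
  show "grow (transpose_rule (carry_label burge_rule)) zero_part f p q 0 \<le> k \<longleftrightarrow>
      chain_bound rel_SE f (rect p q) k"
    unfolding l conj_part_0_le_iff[OF p] burge_statistics
    by (rule chain_bound_swap_rev) (auto simp: rel_SE_def)
  show "grow (transpose_rule (carry_label burge_rule)) zero_part f p q k = 0 \<longleftrightarrow>
      chain_bound rel_ne (ind f) (rect p q) k"
    unfolding l conj_part_eq_0_iff[OF p] burge_statistics ind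
    by (rule chain_bound_swap) (auto simp: rel_ne_def)
qed

text \<open>Reflection moves the strict comparison to the other coordinate, so \<open>rel_nE\<close>
  turns into \<open>rel_Ne\<close> and, after reversal, \<open>rel_Se\<close> into
  \<open>rel_sE\<close>.\<close>

lemma dual_transpose_statistics:
  assumes f: "\<forall>c. f c \<in> {0, 1}"
  shows "grow (transpose_rule (carry_label dual_rule)) zero_part f p q 0 \<le> k \<longleftrightarrow>
      chain_bound rel_sE (ind f) (rect p q) k"
    and "grow (transpose_rule (carry_label dual_rule)) zero_part f p q k = 0 \<longleftrightarrow>
      chain_bound rel_Ne (ind f) (rect p q) k"
proof -
  let ?f = "\<lambda>c. f (prod.swap c)"
  let ?l = "grow (carry_label dual_rule) zero_part ?f q p"
  have f': "\<forall>c. ?f c \<in> {0, 1}" using f by blast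
  have l: "grow (transpose_rule (carry_label dual_rule)) zero_part f p q = conj_part ?l"
    unfolding transpose_rule_def
    by (rule grow_transpose[OF growth_dual]) (use f in \<open>auto simp: hstrip_def\<close>)
  have p: "part ?l"
    by (rule part_grow[OF growth_dual _ f'[rule_format]]) (simp add: hstrip_def)
  have ind: "ind ?f = (\<lambda>c. ind f (prod.swap c))" by (auto simp: ind_def)
  show "grow (transpose_rule (carry_label dual_rule)) zero_part f p q 0 \<le> k \<longleftrightarrow>
      chain_bound rel_sE (ind f) (rect p q) k"
    unfolding l conj_part_0_le_iff[OF p] dual_statistics[OF f'] ind
    by (rule chain_bound_swap_rev) (auto simp: rel_Se_def rel_sE_def)
  show "grow (transpose_rule (carry_label dual_rule)) zero_part f p q k = 0 \<longleftrightarrow>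
      chain_bound rel_Ne (ind f) (rect p q) k"
    unfolding l conj_part_eq_0_iff[OF p] dual_statistics[OF f'] ind
    by (rule chain_bound_swap) (auto simp: rel_nE_def rel_Ne_def)
qed

section \<open>Comparison of fillings along the border\<close>

text \<open>Moving up along the diagonal from any cell reaches the border inside \<open>F\<close>,
  and the rectangles only grow on the way.\<close>

lemma chain_bound_border:
  assumes F: "down_shape F"
  shows "(\<forall>(p, q)\<in>F. chain_bound R w (rect p q) k) \<longleftrightarrow>
    (\<forall>(p, q)\<in>F \<inter> border F. chain_bound R w (rect p q) k)"
proof
  assume b: "\<forall>(p, q)\<in>F \<inter> border F. chain_bound R w (rect p q) k"
  have "finite (fst ` F)" using F by (simp add: down_shape_def)
  then obtain N where N: "\<And>p q. (p, q) \<in> F \<Longrightarrow> p \<le> N"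
    using finite_nat_set_iff_bounded_le[of "fst ` F"] by force
  have "chain_bound R w (rect p q) k" if "(p, q) \<in> F" for p q
    using that
  proof (induction "N - p" arbitrary: p q rule: less_induct)
    case less
    show ?case
    proof (cases "(Suc p, Suc q) \<in> F")
      case True
      then have "chain_bound R w (rect (Suc p) (Suc q)) k" using less(1)[OF _ True] N[OF True] by simp
      then show ?thesis by (rule chain_bound_mono) (auto intro: rect_mono)
    next
      case False
      then show ?thesis using b less(2) by (auto simp: border_def corners_def)
    qed
  qed
  then show "\<forall>(p, q)\<in>F. chain_bound R w (rect p q) k" by auto
qed auto

text \<open>The statistics of dual RSK ask for 0-1-entries in all cells, while an extensional
  filling is \<open>undefined\<close> outside \<open>F\<close>.\<close>

definition zero_ext :: "cell set \<Rightarrow> (cell \<Rightarrow> nat) \<Rightarrow> cell \<Rightarrow> nat" where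
  "zero_ext F f c = (if c \<in> F then f c else 0)"

lemma zero_ext_on_rect:
  assumes "down_shape F" "(p, q) \<in> F"
  shows "grow \<phi> Z (zero_ext F f) p q = grow \<phi> Z f p q"
    and "chain_bound R (zero_ext F f) (rect p q) k \<longleftrightarrow> chain_bound R f (rect p q) k"
    and "chain_bound R (ind (zero_ext F f)) (rect p q) k \<longleftrightarrow> chain_bound R (ind f) (rect p q) k"
proof -
  have "rect p q \<subseteq> F" using assms by (simp add: down_shape_def)
  then have eq: "zero_ext F f c = f c" if "c \<in> rect p q" for c using that by (auto simp: zero_ext_def)
  then show "grow \<phi> Z (zero_ext F f) p q = grow \<phi> Z f p q" by (rule grow_cong)
  show "chain_bound R (zero_ext F f) (rect p q) k \<longleftrightarrow> chain_bound R f (rect p q) k"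
    using eq by (rule chain_bound_cong)
  show "chain_bound R (ind (zero_ext F f)) (rect p q) k \<longleftrightarrow> chain_bound R (ind f) (rect p q) k"
    by (rule chain_bound_cong) (simp add: ind_def eq)
qed

lemma zero_ext_01: "f \<in> F \<rightarrow>\<^sub>E {0, 1} \<Longrightarrow> \<forall>c. zero_ext F f c \<in> {0, 1}"
  by (auto simp: zero_ext_def PiE_iff)

lemma eq_if_same_bounds: "(\<And>k. a \<le> k \<longleftrightarrow> b \<le> k) \<Longrightarrow> a = (b :: nat)"
  by (meson antisym le_refl)

lemma border_bounds_eq:
  assumes F: "down_shape F"
    and f: "\<And>k. a \<le> k \<longleftrightarrow> (\<forall>(p, q)\<in>F. chain_bound R w (rect p q) k)"
    and g: "\<And>k. b \<le> k \<longleftrightarrow> (\<forall>(p, q)\<in>F. chain_bound R' w' (rect p q) k)"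
    and eq: "\<And>p q k. (p, q) \<in> F \<Longrightarrow> (p, q) \<in> border F \<Longrightarrow>
      chain_bound R w (rect p q) k \<longleftrightarrow> chain_bound R' w' (rect p q) k"
  shows "a = (b :: nat)"
proof (rule eq_if_same_bounds)
  fix k
  show "a \<le> k \<longleftrightarrow> b \<le> k"
    unfolding f g chain_bound_border[OF F, of R] chain_bound_border[OF F, of R']
    by (rule ball_cong[OF refl]) (auto simp: eq)
qed

text \<open>Equal border labels have the same first part and the same number of parts, which matches
  NE with SE and se with ne at each border corner.\<close>

lemma Nstar_eq:
  assumes F: "down_shape F"
  shows "Nstar_NE_se F n s t = Nstar_ne_SE F n t s"
proof -
  let ?\<phi> = "carry_label rsk_rule" and ?\<psi> = "transpose_rule (carry_label burge_rule)"
  have "card {f \<in> F \<rightarrow>\<^sub>E UNIV. (\<Sum>c\<in>F. f c) = n \<and> longest_NE F f = s \<and> longest_se F f = t} =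
    card {g \<in> F \<rightarrow>\<^sub>E UNIV. (\<Sum>c\<in>F. g c) = n \<and> longest_ne F g = t \<and> longest_SE F g = s}"
  proof (rule equinumerous_fillings[OF growth_rsk growth_burge_transpose F])
    fix f g :: "cell \<Rightarrow> nat"
    assume sum: "(\<Sum>c\<in>F. f c) = (\<Sum>c\<in>F. g c)"
      and lab: "\<And>p q. (p, q) \<in> border F \<Longrightarrow> grow ?\<phi> zero_part f p q = grow ?\<psi> zero_part g p q"
    have "longest_NE F f = longest_SE F g"
      using longest_le_iff(1)[OF F] longest_le_iff(5)[OF F]
      by (rule border_bounds_eq[OF F])
        (metis lab rsk_statistics(1) burge_transpose_statistics(1))
    moreover have "longest_se F f = longest_ne F g"
      using longest_le_iff(6)[OF F] longest_le_iff(2)[OF F]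
      by (rule border_bounds_eq[OF F])
        (metis lab rsk_statistics(2) burge_transpose_statistics(2))
    ultimately show "(\<Sum>c\<in>F. f c) = n \<and> longest_NE F f = s \<and> longest_se F f = t \<longleftrightarrow>
        (\<Sum>c\<in>F. g c) = n \<and> longest_ne F g = t \<and> longest_SE F g = s"
      using sum by auto
  qed
  then show ?thesis
    by (simp add: Nstar_NE_se_def Nstar_ne_SE_def fillings_def conj_assoc)
qed

lemma N01_eq:
  assumes F: "down_shape F"
  shows "N01_nE_Se F n s t = N01_Ne_sE F n t s"
proof -
  let ?\<phi> = "carry_label dual_rule" and ?\<psi> = "transpose_rule (carry_label dual_rule)"
  have fin: "finite F" using F by (simp add: down_shape_def)
  \<comment> \<open>Counting ones is turned into summing entries, the quantity that equal border
    labels preserve.\<close>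
  have sum: "card {c \<in> F. f c = 1} = (\<Sum>c\<in>F. f c)" if "f \<in> F \<rightarrow>\<^sub>E {0, 1}" for f :: "cell \<Rightarrow> nat"
  proof -
    have "(\<Sum>c\<in>F. f c) = (\<Sum>c\<in>F. if f c = 1 then 1 else 0)"
      using that by (intro sum.cong) (auto simp: PiE_iff)
    then show ?thesis using fin by (simp add: sum.If_cases Int_def)
  qed
  have "card {f \<in> F \<rightarrow>\<^sub>E {0, 1}. card {c \<in> F. f c = 1} = n \<and> longest_nE F f = s \<and> longest_Se F f = t} =
    card {g \<in> F \<rightarrow>\<^sub>E {0, 1}. card {c \<in> F. g c = 1} = n \<and> longest_Ne F g = t \<and> longest_sE F g = s}"
  proof (rule equinumerous_fillings[OF growth_dual growth_dual_transpose F])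
    fix f g :: "cell \<Rightarrow> nat"
    assume fg: "f \<in> F \<rightarrow>\<^sub>E {0, 1}" "g \<in> F \<rightarrow>\<^sub>E {0, 1}" and eq: "(\<Sum>c\<in>F. f c) = (\<Sum>c\<in>F. g c)"
      and lab: "\<And>p q. (p, q) \<in> border F \<Longrightarrow> grow ?\<phi> zero_part f p q = grow ?\<psi> zero_part g p q"
    note z = zero_ext_01[OF fg(1)] zero_ext_01[OF fg(2)]
    have "longest_nE F f = longest_sE F g"
      using longest_le_iff(3)[OF F] longest_le_iff(8)[OF F]
    proof (rule border_bounds_eq[OF F])
      fix p q k assume "(p, q) \<in> F" "(p, q) \<in> border F"
      then show "chain_bound rel_nE (ind f) (rect p q) k \<longleftrightarrow> chain_bound rel_sE (ind g) (rect p q) k"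
        using dual_statistics(1)[OF z(1), of p q k] dual_transpose_statistics(1)[OF z(2), of p q k] lab
        by (simp add: zero_ext_on_rect[OF F])
    qed
    moreover have "longest_Se F f = longest_Ne F g"
      using longest_le_iff(7)[OF F] longest_le_iff(4)[OF F]
    proof (rule border_bounds_eq[OF F])
      fix p q k assume "(p, q) \<in> F" "(p, q) \<in> border F"
      then show "chain_bound rel_Se (ind f) (rect p q) k \<longleftrightarrow> chain_bound rel_Ne (ind g) (rect p q) k"
        using dual_statistics(2)[OF z(1), of p q k] dual_transpose_statistics(2)[OF z(2), of p q k] lab
        by (simp add: zero_ext_on_rect[OF F])
    qed
    ultimately show "card {c \<in> F. f c = 1} = n \<and> longest_nE F f = s \<and> longest_Se F f = t \<longleftrightarrow>
        card {c \<in> F. g c = 1} = n \<and> longest_Ne F g = t \<and> longest_sE F g = s"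
      using eq sum[OF fg(1)] sum[OF fg(2)] by auto
  qed
  then show ?thesis
    by (simp add: N01_nE_Se_def N01_Ne_sE_def fillings01_def conj_assoc)
qed

theorem theorem13:
  fixes F :: "cell set" and n s t :: nat
  assumes "ferrers_shape F" and "s > 0" and "t > 0"
  shows "Nstar_NE_se F n s t = Nstar_ne_SE F n t s \<and>
         N01_nE_Se F n s t = N01_Ne_sE F n t s"
  using Nstar_eq N01_eq ferrers_down_shape[OF assms(1)] by blast

end
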